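(* Let $G$ be a finite group and $H \leq G$ a subgroup. Consider the subgroup $\widetilde{H}=\{(h,h,h):h\in H\}$ of $G\times G\times H$. Then the following conditions are equivalent: (i) $(G\times G\times H,\widetilde{H})$ is a Gelfand pair; (ii) $\mathrm{Res}^G_H(\rho_1\otimes \rho_2)$ is multiplicity-free for all $\rho_1,\rho_2\in \widehat{G}$.
   Context: All representations are finite-dimensional, complex and unitary. $\widehat{G}$ denotes a complete set of pairwise inequivalent irreducible representations of $G$. For $\rho_1,\rho_2 \in \widehat G$, $\rho_1\otimes\rho_2$ denotes the inner (Kronecker) tensor product, i.e. the $G$-representation $g\mapsto \rho_1(g)\otimes\rho_2(g)$, and $\mathrm{Res}^G_H$ denotes restriction to $H$. A representation is multiplicity-free if it decomposes as a direct sum of pairwise inequivalent irreducible representations. For a finite group $\Gamma$ and a subgroup $K\leq \Gamma$, $L(\Gamma)$ is the algebra of all functions $f\colon\Gamma\to\mathbb{C}$ with the convolution product $[f_1*f_2](g)=\sum_{h\in \Gamma}f_1(h)f_2(h^{-1}g)$. The pair $(\Gamma,K)$ is a Gelfand pair if the subalgebra $\{f\in L(\Gamma): f(k_1gk_2)=f(g)\ \forall g\in \Gamma,\ \forall k_1,k_2\in K\}$ of bi-$K$-invariant functions is commutative. *)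

theory Defs
  imports
    "HOL-Algebra.Group"
    "HOL-Library.FuncSet"
    "Jordan_Normal_Form.Schur_Decomposition"
    "Jordan_Normal_Form.VS_Connect"
begin

section \<open>Gelfand pairs\<close>

text \<open>Functions on a group are extensional functions on its carrier, so that equality in
  \<open>L(\<Gamma>)\<close> is equality of HOL functions.\<close>

definition group_functions :: "('g, 'b) monoid_scheme \<Rightarrow> ('g \<Rightarrow> complex) set" where
  "group_functions \<Gamma> = carrier \<Gamma> \<rightarrow>\<^sub>E UNIV"

definition convolution ::
  "('g, 'b) monoid_scheme \<Rightarrow> ('g \<Rightarrow> complex) \<Rightarrow> ('g \<Rightarrow> complex) \<Rightarrow> 'g \<Rightarrow> complex" where
  "convolution \<Gamma> f1 f2 =
     (\<lambda>g\<in>carrier \<Gamma>. \<Sum>h\<in>carrier \<Gamma>. f1 h * f2 (inv\<^bsub>\<Gamma>\<^esub> h \<otimes>\<^bsub>\<Gamma>\<^esub> g))"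

definition bi_invariant_functions ::
  "('g, 'b) monoid_scheme \<Rightarrow> 'g set \<Rightarrow> ('g \<Rightarrow> complex) set" where
  "bi_invariant_functions \<Gamma> K =
     {f \<in> group_functions \<Gamma>.
        \<forall>g\<in>carrier \<Gamma>. \<forall>k1\<in>K. \<forall>k2\<in>K. f (k1 \<otimes>\<^bsub>\<Gamma>\<^esub> g \<otimes>\<^bsub>\<Gamma>\<^esub> k2) = f g}"

text \<open>Meant for a finite group \<open>\<Gamma>\<close> and a subgroup \<open>K\<close> of it.\<close>

definition gelfand_pair :: "('g, 'b) monoid_scheme \<Rightarrow> 'g set \<Rightarrow> bool" where
  "gelfand_pair \<Gamma> K \<longleftrightarrow>
     (\<forall>f1\<in>bi_invariant_functions \<Gamma> K. \<forall>f2\<in>bi_invariant_functions \<Gamma> K.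
        convolution \<Gamma> f1 f2 = convolution \<Gamma> f2 f1)"

definition triple_diagonal :: "'g set \<Rightarrow> ('g \<times> 'g \<times> 'g) set" where
  "triple_diagonal H = {(h, h, h) | h. h \<in> H}"

section \<open>Unitary matrix representations\<close>

text \<open>A finite-dimensional unitary representation is given in an orthonormal basis, as a
  homomorphism into the unitary matrices of some size. Values outside \<open>carrier G\<close> are
  irrelevant; the dimension is the size of the matrix of the identity.\<close>

definition rep_dim :: "('g, 'b) monoid_scheme \<Rightarrow> ('g \<Rightarrow> complex mat) \<Rightarrow> nat" where
  "rep_dim G \<rho> = dim_row (\<rho> \<one>\<^bsub>G\<^esub>)"

definition unitary_rep :: "('g, 'b) monoid_scheme \<Rightarrow> ('g \<Rightarrow> complex mat) \<Rightarrow> bool" where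
  "unitary_rep G \<rho> \<longleftrightarrow>
     (\<forall>g\<in>carrier G. \<rho> g \<in> carrier_mat (rep_dim G \<rho>) (rep_dim G \<rho>)
        \<and> \<rho> g * mat_adjoint (\<rho> g) = 1\<^sub>m (rep_dim G \<rho>)) \<and>
     (\<forall>g\<in>carrier G. \<forall>h\<in>carrier G. \<rho> (g \<otimes>\<^bsub>G\<^esub> h) = \<rho> g * \<rho> h)"

definition invariant_subspace ::
  "('g, 'b) monoid_scheme \<Rightarrow> ('g \<Rightarrow> complex mat) \<Rightarrow> complex vec set \<Rightarrow> bool" where
  "invariant_subspace G \<rho> W \<longleftrightarrow>
     VectorSpace.subspace class_ring W (module_vec TYPE(complex) (rep_dim G \<rho>)) \<and>
     (\<forall>g\<in>carrier G. \<forall>w\<in>W. \<rho> g *\<^sub>v w \<in> W)"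

definition irreducible_rep :: "('g, 'b) monoid_scheme \<Rightarrow> ('g \<Rightarrow> complex mat) \<Rightarrow> bool" where
  "irreducible_rep G \<rho> \<longleftrightarrow>
     unitary_rep G \<rho> \<and> rep_dim G \<rho> \<noteq> 0 \<and>
     (\<forall>W. invariant_subspace G \<rho> W \<longrightarrow>
        W = {0\<^sub>v (rep_dim G \<rho>)} \<or> W = carrier_vec (rep_dim G \<rho>))"

definition equivalent_reps ::
  "('g, 'b) monoid_scheme \<Rightarrow> ('g \<Rightarrow> complex mat) \<Rightarrow> ('g \<Rightarrow> complex mat) \<Rightarrow> bool" where
  "equivalent_reps G \<rho> \<sigma> \<longleftrightarrow>
     rep_dim G \<rho> = rep_dim G \<sigma> \<and>
     (\<exists>T\<in>carrier_mat (rep_dim G \<sigma>) (rep_dim G \<rho>).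
        invertible_mat T \<and> (\<forall>g\<in>carrier G. T * \<rho> g = \<sigma> g * T))"

definition direct_sum_rep :: "('g \<Rightarrow> complex mat) list \<Rightarrow> 'g \<Rightarrow> complex mat" where
  "direct_sum_rep \<sigma>s = (\<lambda>g. diag_block_mat (map (\<lambda>\<sigma>. \<sigma> g) \<sigma>s))"

definition multiplicity_free :: "('g, 'b) monoid_scheme \<Rightarrow> ('g \<Rightarrow> complex mat) \<Rightarrow> bool" where
  "multiplicity_free G \<rho> \<longleftrightarrow>
     (\<exists>\<sigma>s. (\<forall>\<sigma>\<in>set \<sigma>s. irreducible_rep G \<sigma>) \<and>
        (\<forall>i<length \<sigma>s. \<forall>j<length \<sigma>s. i \<noteq> j \<longrightarrow> \<not> equivalent_reps G (\<sigma>s ! i) (\<sigma>s ! j)) \<and>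
        equivalent_reps G \<rho> (direct_sum_rep \<sigma>s))"

text \<open>A complete set of pairwise inequivalent irreducible representations is determined only
  up to the choice of representatives; the following says that \<open>R\<close> is such a set.\<close>

definition complete_irreps ::
  "('g, 'b) monoid_scheme \<Rightarrow> ('g \<Rightarrow> complex mat) set \<Rightarrow> bool" where
  "complete_irreps G R \<longleftrightarrow>
     (\<forall>\<rho>\<in>R. irreducible_rep G \<rho>) \<and>
     (\<forall>\<rho>\<in>R. \<forall>\<sigma>\<in>R. \<rho> \<noteq> \<sigma> \<longrightarrow> \<not> equivalent_reps G \<rho> \<sigma>) \<and>
     (\<forall>\<rho>. irreducible_rep G \<rho> \<longrightarrow> (\<exists>\<sigma>\<in>R. equivalent_reps G \<rho> \<sigma>))"

text \<open>The Kronecker product: the matrix of the tensor product of two linear maps in the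
  lexicographically ordered basis \<open>e\<^sub>i \<otimes> e\<^sub>j\<close>.\<close>

definition kronecker_mat :: "complex mat \<Rightarrow> complex mat \<Rightarrow> complex mat" where
  "kronecker_mat A B =
     mat (dim_row A * dim_row B) (dim_col A * dim_col B)
       (\<lambda>(i, j). A $$ (i div dim_row B, j div dim_col B) * B $$ (i mod dim_row B, j mod dim_col B))"

definition tensor_rep ::
  "('g \<Rightarrow> complex mat) \<Rightarrow> ('g \<Rightarrow> complex mat) \<Rightarrow> 'g \<Rightarrow> complex mat" where
  "tensor_rep \<rho>1 \<rho>2 = (\<lambda>g. kronecker_mat (\<rho>1 g) (\<rho>2 g))"

text \<open>The restriction to \<open>H\<close> is a representation of \<open>G\<lparr>carrier := H\<rparr>\<close>.\<close>

definition res_rep :: "'g set \<Rightarrow> ('g \<Rightarrow> complex mat) \<Rightarrow> 'g \<Rightarrow> complex mat" where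
  "res_rep H \<rho> = restrict \<rho> H"

section \<open>Sanity checks\<close>

lemma triple_diagonal_subgroup:
  assumes "group G" "subgroup H G"
  shows "group (G \<times>\<times> G \<times>\<times> G\<lparr>carrier := H\<rparr>)"
    and "subgroup (triple_diagonal H) (G \<times>\<times> G \<times>\<times> G\<lparr>carrier := H\<rparr>)"
proof -
  interpret G: group G by fact
  interpret H: subgroup H G by fact
  have gH: "group (G\<lparr>carrier := H\<rparr>)"
    using G.subgroup_imp_group assms(2) by blast
  have gGH: "group (G \<times>\<times> G\<lparr>carrier := H\<rparr>)"
    using DirProd_group assms(1) gH by blast
  show gr: "group (G \<times>\<times> G \<times>\<times> G\<lparr>carrier := H\<rparr>)"
    using DirProd_group assms(1) gGH by blast
  have inv: "inv\<^bsub>G \<times>\<times> G \<times>\<times> G\<lparr>carrier := H\<rparr>\<^esub> (h, h, h) = (inv\<^bsub>G\<^esub> h, inv\<^bsub>G\<^esub> h, inv\<^bsub>G\<^esub> h)"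
    if "h \<in> H" for h
    using that assms gH gGH
    by (simp add: inv_DirProd G.m_inv_consistent)
  show "subgroup (triple_diagonal H) (G \<times>\<times> G \<times>\<times> G\<lparr>carrier := H\<rparr>)"
    by (rule group.subgroupI[OF gr])
      (auto simp: triple_diagonal_def inv intro: H.one_closed)
qed

lemma equivalent_reps_refl:
  assumes "unitary_rep G \<rho>"
  shows "equivalent_reps G \<rho> \<rho>"
  unfolding equivalent_reps_def
proof (intro conjI bexI[of _ "1\<^sub>m (rep_dim G \<rho>)"] ballI)
  show "invertible_mat (1\<^sub>m (rep_dim G \<rho>) :: complex mat)"
    unfolding invertible_mat_def inverts_mat_def
    by (auto intro!: exI[of _ "1\<^sub>m (rep_dim G \<rho>)"])
next
  fix g assume "g \<in> carrier G"
  then have "\<rho> g \<in> carrier_mat (rep_dim G \<rho>) (rep_dim G \<rho>)"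
    using assms unfolding unitary_rep_def by blast
  then show "1\<^sub>m (rep_dim G \<rho>) * \<rho> g = \<rho> g * 1\<^sub>m (rep_dim G \<rho>)" by simp
qed auto

lemma complete_irreps_exists: "\<exists>R. complete_irreps G R"
proof -
  let ?ind = "\<lambda>R. (\<forall>\<rho>\<in>R. irreducible_rep G \<rho>) \<and>
    (\<forall>\<rho>\<in>R. \<forall>\<sigma>\<in>R. \<rho> \<noteq> \<sigma> \<longrightarrow> \<not> equivalent_reps G \<rho> \<sigma>)"
  have sym: "equivalent_reps G \<sigma> \<rho>"
    if eq: "equivalent_reps G \<rho> \<sigma>" and "unitary_rep G \<rho>" "unitary_rep G \<sigma>" for \<rho> \<sigma>
  proof -
    define n where "n = rep_dim G \<rho>"
    from eq obtain T where n: "rep_dim G \<sigma> = n" and T: "T \<in> carrier_mat n n"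
      and inv: "invertible_mat T" and tw: "\<And>g. g \<in> carrier G \<Longrightarrow> T * \<rho> g = \<sigma> g * T"
      unfolding equivalent_reps_def n_def by auto
    from inv obtain S where TS: "T * S = 1\<^sub>m n" and ST': "S * T = 1\<^sub>m (dim_row S)"
      using T unfolding invertible_mat_def inverts_mat_def by auto
    have "dim_col S = n" using arg_cong[OF TS, of dim_col] by simp
    moreover have "dim_row S = n" using arg_cong[OF ST', of dim_col] T by simp
    ultimately have S: "S \<in> carrier_mat n n" by blast
    then have ST: "S * T = 1\<^sub>m n" using ST' by simp
    have "S * \<sigma> g = \<rho> g * S" if g: "g \<in> carrier G" for g
    proof -
      have c: "\<rho> g \<in> carrier_mat n n" "\<sigma> g \<in> carrier_mat n n"
        using \<open>unitary_rep G \<rho>\<close> \<open>unitary_rep G \<sigma>\<close> g n n_def unfolding unitary_rep_def by auto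
      have "S * \<sigma> g = S * (\<sigma> g * (T * S))" using c TS by simp
      also have "\<dots> = S * (\<sigma> g * T * S)" using c S T by (simp add: assoc_mult_mat[of _ n n _ n _ n])
      also have "\<dots> = S * (T * \<rho> g * S)" using tw g by simp
      also have "\<dots> = (S * T) * (\<rho> g * S)"
        using c S T by (simp add: assoc_mult_mat[of _ n n _ n _ n])
      also have "\<dots> = \<rho> g * S" using c S ST by simp
      finally show ?thesis .
    qed
    moreover have "invertible_mat S"
      using S T ST TS unfolding invertible_mat_def inverts_mat_def by auto
    ultimately show ?thesis
      using S n unfolding equivalent_reps_def n_def by auto
  qed
  have "\<exists>M\<in>{R. ?ind R}. \<forall>X\<in>{R. ?ind R}. M \<subseteq> X \<longrightarrow> X = M"
  proof (rule subset_Zorn_nonempty)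
    show "{R. ?ind R} \<noteq> {}" by blast
  next
    fix C assume "C \<noteq> {}" "subset.chain {R. ?ind R} C"
    then have ind: "\<And>X. X \<in> C \<Longrightarrow> ?ind X" and tot: "\<And>X Y. X \<in> C \<Longrightarrow> Y \<in> C \<Longrightarrow> X \<subseteq> Y \<or> Y \<subseteq> X"
      unfolding subset_chain_def by blast+
    have "\<not> equivalent_reps G \<rho> \<sigma>"
      if "\<rho> \<in> X" "X \<in> C" "\<sigma> \<in> Y" "Y \<in> C" "\<rho> \<noteq> \<sigma>" for \<rho> \<sigma> X Y
      using ind[OF \<open>X \<in> C\<close>] ind[OF \<open>Y \<in> C\<close>] tot[OF \<open>X \<in> C\<close> \<open>Y \<in> C\<close>] that by blast
    then show "\<Union>C \<in> {R. ?ind R}" using ind by blast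
  qed
  then obtain M where M0: "M \<in> {R. ?ind R}" and max: "\<forall>X\<in>{R. ?ind R}. M \<subseteq> X \<longrightarrow> X = M"
    by (rule bexE)
  from M0 have M: "?ind M" by simp
  have "\<exists>\<sigma>\<in>M. equivalent_reps G \<rho> \<sigma>" if irr: "irreducible_rep G \<rho>" for \<rho>
  proof (rule ccontr)
    assume no: "\<not> ?thesis"
    have u: "unitary_rep G \<sigma>" if "irreducible_rep G \<sigma>" for \<sigma>
      using that unfolding irreducible_rep_def by blast
    have no': "\<not> equivalent_reps G \<rho> \<sigma>" "\<not> equivalent_reps G \<sigma> \<rho>" if "\<sigma> \<in> M" for \<sigma>
      using no that M sym[of \<sigma> \<rho>] u irr by auto
    have "insert \<rho> M \<in> {R. ?ind R}" using M no' irr by simp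
    with max have "insert \<rho> M = M" by blast
    then have "\<rho> \<in> M" by blast
    then show False using no equivalent_reps_refl[OF u[OF irr]] by blast
  qed
  with M show ?thesis unfolding complete_irreps_def by blast
qed

end

theory Submission
  imports Defs "Jordan_Normal_Form.Spectral_Radius"
begin

text \<open>
  Why the theorem holds. A bi-invariant function on \<open>G \<times> G \<times> H\<close> is determined by its values on the
  slice \<open>(x, y, 1)\<close>, because the diagonal acts transitively on the last coordinate; the slice is a
  function on \<open>G \<times> G\<close> invariant under simultaneous conjugation by \<open>H\<close>, every such function occurs,
  and convolution on \<open>G \<times> G \<times> H\<close> becomes \<open>|H|\<close> times convolution on \<open>G \<times> G\<close>. So condition (i) says
  that the algebra of \<open>H\<close>-class functions on \<open>G \<times> G\<close> is commutative
  (\<open>gelfand_pair_iff_class_functions_commute\<close>).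

  The Fourier transform sends \<open>f\<close> to the matrices \<open>\<Sum> f(x, y) \<rho>1(x) \<otimes> \<rho>2(y)\<close> for \<open>\<rho>1\<close>, \<open>\<rho>2\<close> irreducible.
  It turns convolution into the matrix product, and it maps \<open>H\<close>-class functions into the matrices that
  commute with \<open>\<rho>1(h) \<otimes> \<rho>2(h)\<close> for all \<open>h\<close> in \<open>H\<close>. It is injective because the matrix coefficients
  of the irreducible representations span all functions (\<open>complete_irreps_separating\<close>), and for
  each single pair \<open>(\<rho>1, \<rho>2)\<close> it maps onto the commutant because the Schur orthogonality relations give an
  explicit inverse (\<open>fourier_surjective\<close>). Hence the algebra of class functions is commutative if and
  only if the commutant of every restriction of \<open>\<rho>1 \<otimes> \<rho>2\<close> to \<open>H\<close> is
  (\<open>class_functions_commute_iff\<close>).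

  Finally, a unitary representation is multiplicity-free exactly when its commutant is commutative
  (\<open>multiplicity_free_iff_commuting_commutant\<close>): by Schur's lemma the commutant of a sum of
  inequivalent irreducibles consists of scalars on the summands, while two equivalent
  summands give an isomorphism between them that does not commute with the projection onto one of them.
\<close>

section \<open>Matrices and orthonormal bases\<close>

lemma dim_mat_adjoint [simp]:
  "dim_row (mat_adjoint A) = dim_col A" "dim_col (mat_adjoint A) = dim_row A"
  by (auto simp: mat_adjoint_def)

lemma index_mat_adjoint [simp]:
  fixes A :: "complex mat"
  shows "i < dim_col A \<Longrightarrow> j < dim_row A \<Longrightarrow> mat_adjoint A $$ (i, j) = cnj (A $$ (j, i))"
  by (simp add: mat_adjoint_def mat_of_rows_def conjugate_vec_def)

lemma mat_adjoint_carrier [simp, intro]: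
  "A \<in> carrier_mat m n \<Longrightarrow> mat_adjoint A \<in> carrier_mat n m"
  by auto

lemma index_mult_mat_sum:
  assumes "A \<in> carrier_mat n m" "B \<in> carrier_mat m l" "i < n" "j < l"
  shows "(A * B) $$ (i, j) = (\<Sum>k<m. A $$ (i, k) * B $$ (k, j))"
  using assms by (auto simp: scalar_prod_def lessThan_atLeast0)

lemma mat_adjoint_mult:
  fixes A B :: "complex mat"
  assumes "A \<in> carrier_mat n m" "B \<in> carrier_mat m l"
  shows "mat_adjoint (A * B) = mat_adjoint B * mat_adjoint A"
  using assms by (intro eq_matI) (auto simp: scalar_prod_def mult.commute)

lemma mat_adjoint_adjoint [simp]: "mat_adjoint (mat_adjoint A) = (A :: complex mat)"
  by (intro eq_matI) auto

lemma mat_adjoint_one [simp]: "mat_adjoint (1\<^sub>m n) = (1\<^sub>m n :: complex mat)"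
  by (intro eq_matI) auto

lemma mat_adjoint_zero [simp]: "mat_adjoint (0\<^sub>m n m) = (0\<^sub>m m n :: complex mat)"
  by (intro eq_matI) auto

text \<open>The locale predicate for subspaces, unfolded once so that later arguments only
  see closure properties of a set of vectors.\<close>
lemma subspace_vec_iff:
  fixes W :: "complex vec set"
  shows "VectorSpace.subspace class_ring W (module_vec TYPE(complex) n) \<longleftrightarrow>
    W \<subseteq> carrier_vec n \<and> 0\<^sub>v n \<in> W \<and> (\<forall>u\<in>W. \<forall>v\<in>W. u + v \<in> W) \<and> (\<forall>c. \<forall>v\<in>W. c \<cdot>\<^sub>v v \<in> W)"
proof -
  interpret V: vec_space "TYPE(complex)" n .
  show ?thesis
    using V.vectorspace_axioms V.module_axioms
    by (auto simp: VectorSpace.subspace_def submodule_def module_vec_simps class_ring_simps)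
qed

text \<open>Padding the matrix with zero rows gives a singular square matrix. All the dimension counting
  below rests on this one fact.\<close>
lemma wide_matrix_kernel:
  fixes A :: "complex mat"
  assumes A: "A \<in> carrier_mat n m" and "n < m"
  obtains v where "v \<in> carrier_vec m" "v \<noteq> 0\<^sub>v m" "A *\<^sub>v v = 0\<^sub>v n"
proof -
  define B where "B = mat m m (\<lambda>(i, j). if i < n then A $$ (i, j) else 0)"
  have B: "B \<in> carrier_mat m m" by (simp add: B_def)
  \<comment> \<open>Row \<open>n\<close> of \<open>B\<close> is the first of the padded zero rows, so this unit vector is in the kernel of the transpose.\<close>
  define e :: "complex vec" where "e = unit_vec m n"
  have "transpose_mat B *\<^sub>v e = 0\<^sub>v m"
    using assms by (intro eq_vecI) (auto simp: B_def e_def)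
  moreover have "e \<in> carrier_vec m" "e \<noteq> 0\<^sub>v m"
    using \<open>n < m\<close> unit_vec_nonzero[of m n] by (auto simp: e_def)
  ultimately have "det (transpose_mat B) = 0"
    using det_0_iff_vec_prod_zero[of "transpose_mat B" m] B by auto
  then have "det B = 0" using det_transpose[OF B] by simp
  then obtain v where v: "v \<in> carrier_vec m" "v \<noteq> 0\<^sub>v m" "B *\<^sub>v v = 0\<^sub>v m"
    using det_0_iff_vec_prod_zero[OF B] by auto
  have "A *\<^sub>v v = 0\<^sub>v n"
  proof (intro eq_vecI)
    fix i assume "i < dim_vec (0\<^sub>v n :: complex vec)"
    then have i: "i < n" by simp
    have "(A *\<^sub>v v) $ i = (B *\<^sub>v v) $ i"
      using i assms v(1) by (auto simp: B_def scalar_prod_def)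
    then show "(A *\<^sub>v v) $ i = 0\<^sub>v n $ i" using v(3) i assms by simp
  qed (use A in auto)
  then show ?thesis using that v by blast
qed

text \<open>One Gram-Schmidt step: a matrix with \<open>V\<^sup>* V = 1\<close> is a list of orthonormal columns,
  and \<open>V\<^sup>* v = 0\<close> says that \<open>v\<close> is orthogonal to all of them, so the normalised \<open>v\<close> can be appended.\<close>
lemma extend_isometry:
  fixes V :: "complex mat"
  assumes V: "V \<in> carrier_mat n m" "mat_adjoint V * V = 1\<^sub>m m"
    and v: "v \<in> carrier_vec n" "v \<noteq> 0\<^sub>v n" "mat_adjoint V *\<^sub>v v = 0\<^sub>v m"
  obtains U c where "U \<in> carrier_mat n (Suc m)" "mat_adjoint U * U = 1\<^sub>m (Suc m)"
    "\<And>j. j < m \<Longrightarrow> col U j = col V j" "col U m = c \<cdot>\<^sub>v v"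
proof -
  define s where "s = (\<Sum>i<n. (cmod (v $ i))\<^sup>2)"
  obtain i where "i < n" "v $ i \<noteq> 0" using v(1,2) by (metis eq_vecI carrier_vecD index_zero_vec)
  then have "s > 0"
    unfolding s_def by (intro sum_pos2[of _ i]) auto
  have vv: "(\<Sum>i<n. cnj (v $ i) * v $ i) = complex_of_real s"
    by (simp add: s_def mult.commute[of "cnj _"] flip: complex_norm_square)
  define c where "c = complex_of_real (1 / sqrt s)"
  have cc: "cnj c * c * complex_of_real s = 1"
    using \<open>s > 0\<close> by (simp add: c_def flip: of_real_mult) 
  define U where "U = mat n (Suc m) (\<lambda>(i, j). if j < m then V $$ (i, j) else c * v $ i)"
  have U: "U \<in> carrier_mat n (Suc m)" by (simp add: U_def)
  have V1: "(\<Sum>k<n. cnj (V $$ (k, i)) * V $$ (k, j)) = (if i = j then 1 else 0)"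
    if "i < m" "j < m" for i j
    using arg_cong[OF V(2), of "\<lambda>M. M $$ (i, j)"] that V(1)
    by (simp add: index_mult_mat_sum[of _ m n _ m] del: index_mult_mat)
  have V0: "(\<Sum>k<n. cnj (V $$ (k, i)) * v $ k) = 0" if "i < m" for i
    using arg_cong[OF v(3), of "\<lambda>x. x $ i"] that V(1) v(1)
    by (simp add: scalar_prod_def lessThan_atLeast0)
  have V0': "(\<Sum>k<n. cnj (v $ k) * V $$ (k, i)) = 0" if "i < m" for i
    using arg_cong[OF V0[OF that], of cnj] by (simp add: mult.commute)
  have "mat_adjoint U * U = 1\<^sub>m (Suc m)"
  proof (intro eq_matI)
    fix i j assume "i < dim_row (1\<^sub>m (Suc m) :: complex mat)" "j < dim_col (1\<^sub>m (Suc m) :: complex mat)"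
    then have ij: "i < Suc m" "j < Suc m" by auto
    have "(mat_adjoint U * U) $$ (i, j) = (\<Sum>k<n. cnj (U $$ (k, i)) * U $$ (k, j))"
      using ij U by (simp add: index_mult_mat_sum[of _ "Suc m" n _ "Suc m"] del: index_mult_mat)
    also have "\<dots> = (if i = j then 1 else 0)"
    proof (cases "i < m"; cases "j < m")
      assume "i < m" "j < m" then show ?thesis using V1 by (simp add: U_def)
    next
      assume "i < m" "\<not> j < m"
      then show ?thesis using V0[of i] ij
        by (simp add: U_def mult.left_commute[of _ c] flip: sum_distrib_left)
    next
      assume "\<not> i < m" "j < m"
      then show ?thesis using V0'[of j] ij
        by (simp add: U_def mult.assoc flip: sum_distrib_left)
    next
      assume "\<not> i < m" "\<not> j < m"
      then have "(\<Sum>k<n. cnj (U $$ (k, i)) * U $$ (k, j)) = (\<Sum>k<n. (cnj c * c) * (cnj (v $ k) * v $ k))"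
        using ij by (simp add: U_def mult_ac)
      also have "\<dots> = cnj c * c * complex_of_real s" by (simp only: vv flip: sum_distrib_left)
      finally show ?thesis using cc \<open>\<not> i < m\<close> \<open>\<not> j < m\<close> ij by simp
    qed
    finally show "(mat_adjoint U * U) $$ (i, j) = 1\<^sub>m (Suc m) $$ (i, j)" using ij by simp
  qed (auto simp: U_def)
  moreover have "col U j = col V j" if "j < m" for j
    using that V(1) by (intro eq_vecI) (auto simp: U_def)
  moreover have "col U m = c \<cdot>\<^sub>v v"
    using v(1) by (intro eq_vecI) (auto simp: U_def)
  ultimately show ?thesis using that U by blast
qed

lemma isometry_dim_le:
  fixes V :: "complex mat"
  assumes V: "V \<in> carrier_mat n m" "mat_adjoint V * V = 1\<^sub>m m"
  shows "m \<le> n"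
proof (rule ccontr)
  assume "\<not> m \<le> n"
  then have "n < m" by simp
  then obtain v where v: "v \<in> carrier_vec m" "v \<noteq> 0\<^sub>v m" "V *\<^sub>v v = 0\<^sub>v n"
    using wide_matrix_kernel[OF V(1)] by metis
  have "v = (mat_adjoint V * V) *\<^sub>v v" using v V by simp
  also have "\<dots> = mat_adjoint V *\<^sub>v (V *\<^sub>v v)"
    using V v by (intro assoc_mult_mat_vec) auto
  also have "\<dots> = 0\<^sub>v m" using V v by auto
  finally show False using v by simp
qed

lemma isometry_image_subspace:
  fixes V :: "complex mat"
  assumes W: "VectorSpace.subspace class_ring W (module_vec TYPE(complex) n)"
    and V: "V \<in> carrier_mat n m" "\<And>j. j < m \<Longrightarrow> col V j \<in> W" and x: "x \<in> carrier_vec m"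
  shows "V *\<^sub>v x \<in> W"
proof -
  have "vec n (\<lambda>i. \<Sum>l<j. V $$ (i, l) * x $ l) \<in> W" if "j \<le> m" for j
    using that
  proof (induction j)
    case 0
    have "vec n (\<lambda>i. 0) = (0\<^sub>v n :: complex vec)" by auto
    then show ?case using W by (simp add: subspace_vec_iff)
  next
    case (Suc j)
    have "vec n (\<lambda>i. \<Sum>l<Suc j. V $$ (i, l) * x $ l) =
      vec n (\<lambda>i. \<Sum>l<j. V $$ (i, l) * x $ l) + x $ j \<cdot>\<^sub>v col V j"
      using V Suc.prems by (intro eq_vecI) auto
    then show ?case using Suc W V by (simp add: subspace_vec_iff)
  qed
  moreover have "V *\<^sub>v x = vec n (\<lambda>i. \<Sum>l<m. V $$ (i, l) * x $ l)"
    using V x by (intro eq_vecI) (auto simp: scalar_prod_def lessThan_atLeast0)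
  ultimately show ?thesis by simp
qed

text \<open>The columns of \<open>U\<close> form an orthonormal basis whose first \<open>k\<close> members span \<open>W\<close>. Instead of
  choosing bases, the proof takes an orthonormal system in \<open>W\<close> of greatest length and then one of
  greatest length that continues it: by \<open>extend_isometry\<close>, no nonzero vector of \<open>W\<close> is orthogonal
  to the first, and none at all to the second.\<close>
lemma unitary_adapted_to_subspace:
  assumes W: "VectorSpace.subspace class_ring W (module_vec TYPE(complex) n)"
  obtains k U where "k \<le> n" "U \<in> carrier_mat n n"
    "mat_adjoint U * U = 1\<^sub>m n" "U * mat_adjoint U = 1\<^sub>m n"
    "\<forall>j<k. col U j \<in> W"
    "\<forall>w\<in>W. \<forall>i. k \<le> i \<longrightarrow> i < n \<longrightarrow> (mat_adjoint U *\<^sub>v w) $ i = 0"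
proof -
  define P where "P m V \<longleftrightarrow> V \<in> carrier_mat n m \<and> mat_adjoint V * V = 1\<^sub>m m" for m and V :: "complex mat"
  have bound: "m \<le> n" if "P m V" for m V
    using that isometry_dim_le by (auto simp: P_def)
  have W': "W \<subseteq> carrier_vec n" "\<And>u v. u \<in> W \<Longrightarrow> v \<in> W \<Longrightarrow> u + v \<in> W" "\<And>c v. v \<in> W \<Longrightarrow> c \<cdot>\<^sub>v v \<in> W"
    using W by (auto simp: subspace_vec_iff)
  let ?Q = "\<lambda>m. \<exists>V. P m V \<and> (\<forall>j<m. col V j \<in> W)"
  define k where "k = (GREATEST m. ?Q m)"
  have Q0: "?Q 0" by (rule exI[of _ "0\<^sub>m n 0"]) (auto simp: P_def)
  have Qn: "\<And>m. ?Q m \<Longrightarrow> m \<le> n" using bound by blast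
  have "?Q k" unfolding k_def by (rule GreatestI_nat[where P = ?Q, OF Q0 Qn])
  have kmax: "m \<le> k" if "?Q m" for m unfolding k_def by (rule Greatest_le_nat[where P = ?Q, OF that Qn])
  from \<open>?Q k\<close> obtain V where V: "P k V" "\<And>j. j < k \<Longrightarrow> col V j \<in> W" by auto
  let ?R = "\<lambda>m. \<exists>U. P m U \<and> k \<le> m \<and> (\<forall>j<k. col U j = col V j)"
  define m where "m = (GREATEST m. ?R m)"
  have Rk: "?R k" using V by auto
  have Rn: "\<And>l. ?R l \<Longrightarrow> l \<le> n" using bound by blast
  have "?R m" unfolding m_def by (rule GreatestI_nat[where P = ?R, OF Rk Rn])
  have mmax: "l \<le> m" if "?R l" for l unfolding m_def by (rule Greatest_le_nat[where P = ?R, OF that Rn])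
  from \<open>?R m\<close> obtain U where U: "P m U" "k \<le> m" "\<And>j. j < k \<Longrightarrow> col U j = col V j" by auto
  have "m = n"
  proof (rule ccontr)
    assume "m \<noteq> n"
    then have "m < n" using bound[OF U(1)] by simp
    moreover have "mat_adjoint U \<in> carrier_mat m n" using U by (auto simp: P_def)
    ultimately obtain v where "v \<in> carrier_vec n" "v \<noteq> 0\<^sub>v n" "mat_adjoint U *\<^sub>v v = 0\<^sub>v m"
      using wide_matrix_kernel by metis
    then obtain U' where "P (Suc m) U'" "\<And>j. j < m \<Longrightarrow> col U' j = col U j"
      using extend_isometry[of U n m v] U(1) unfolding P_def by metis
    then have "?R (Suc m)" using U by (intro exI[of _ U']) auto
    from mmax[OF this] show False by simp
  qed
  then have Uc: "U \<in> carrier_mat n n" and UU: "mat_adjoint U * U = 1\<^sub>m n" using U by (auto simp: P_def)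
  have UU': "U * mat_adjoint U = 1\<^sub>m n"
    by (rule mat_mult_left_right_inverse[OF _ Uc UU]) (use Uc in auto)
  have Vc: "V \<in> carrier_mat n k" and VV: "mat_adjoint V * V = 1\<^sub>m k" using V by (auto simp: P_def)
  have "(mat_adjoint U *\<^sub>v w) $ i = 0" if w: "w \<in> W" and i: "k \<le> i" "i < n" for w i
  proof -
    have wc: "w \<in> carrier_vec n" using w W' by auto
    define y where "y = mat_adjoint V *\<^sub>v w"
    have y: "y \<in> carrier_vec k" unfolding y_def by (rule mult_mat_vec_carrier) (use Vc wc in auto)
    \<comment> \<open>The component of \<open>w\<close> orthogonal to the first system; it stays in \<open>W\<close>, so it vanishes by maximality.\<close>
    define w' where "w' = w + (- 1) \<cdot>\<^sub>v (V *\<^sub>v y)"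
    have Vy: "V *\<^sub>v y \<in> carrier_vec n" by (rule mult_mat_vec_carrier[OF Vc y])
    have "V *\<^sub>v y \<in> W" using isometry_image_subspace[OF W Vc V(2) y] by simp
    then have w'W: "w' \<in> W" using W' w by (auto simp: w'_def)
    have w'c: "w' \<in> carrier_vec n" using w'W W' by auto
    have "mat_adjoint V *\<^sub>v (V *\<^sub>v y) = (mat_adjoint V * V) *\<^sub>v y"
      by (rule assoc_mult_mat_vec[symmetric]) (use Vc y in auto)
    then have VVy: "mat_adjoint V *\<^sub>v (V *\<^sub>v y) = y" using VV y by simp
    have "mat_adjoint V *\<^sub>v w' = mat_adjoint V *\<^sub>v w + mat_adjoint V *\<^sub>v ((- 1) \<cdot>\<^sub>v (V *\<^sub>v y))"
      unfolding w'_def by (rule mult_add_distrib_mat_vec) (use Vc wc Vy in auto)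
    also have "\<dots> = y + (- 1) \<cdot>\<^sub>v y"
      using mult_mat_vec[of "mat_adjoint V" k n "V *\<^sub>v y" "- 1"] Vc Vy VVy by (simp add: y_def)
    finally have Vw': "mat_adjoint V *\<^sub>v w' = 0\<^sub>v k" using y by auto
    have "w' = 0\<^sub>v n"
    proof (rule ccontr)
      assume "w' \<noteq> 0\<^sub>v n"
      then obtain V' c where V': "P (Suc k) V'" "\<And>j. j < k \<Longrightarrow> col V' j = col V j" "col V' k = c \<cdot>\<^sub>v w'"
        using extend_isometry[OF Vc VV w'c] Vw' unfolding P_def by metis
      then have "\<forall>j<Suc k. col V' j \<in> W" using V(2) w'W W' by (auto simp: less_Suc_eq)
      then have "?Q (Suc k)" using V' by blast
      from kmax[OF this] show False by simp
    qed
    then have "w = V *\<^sub>v y"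
    proof -
      have "w $ l = (V *\<^sub>v y) $ l" if "l < n" for l
        using arg_cong[OF \<open>w' = 0\<^sub>v n\<close>, of "\<lambda>x. x $ l"] that wc Vc by (simp add: w'_def)
      then show ?thesis using wc carrier_vecD[OF Vy] by (intro eq_vecI) (simp_all del: index_mult_mat_vec dim_mult_mat_vec)
    qed
    define z where "z = vec n (\<lambda>j. if j < k then y $ j else 0)"
    have Vk: "V $$ (a, j) = U $$ (a, j)" if "a < n" "j < k" for a j
      using arg_cong[OF U(3)[OF \<open>j < k\<close>], of "\<lambda>x. x $ a"] that Vc Uc U(2) \<open>m = n\<close> by simp
    have "V *\<^sub>v y = U *\<^sub>v z"
    proof (intro eq_vecI)
      fix a assume "a < dim_vec (U *\<^sub>v z)"
      then have a: "a < n" using Uc by simp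
      have "(U *\<^sub>v z) $ a = (\<Sum>j<n. U $$ (a, j) * (if j < k then y $ j else 0))"
        using a Uc by (simp add: scalar_prod_def z_def lessThan_atLeast0)
      also have "\<dots> = (\<Sum>j<k. U $$ (a, j) * y $ j)"
        using U(2) \<open>m = n\<close> by (intro sum.mono_neutral_cong_right) auto
      also have "\<dots> = (V *\<^sub>v y) $ a"
        using a Vc y Vk by (simp add: scalar_prod_def lessThan_atLeast0)
      finally show "(V *\<^sub>v y) $ a = (U *\<^sub>v z) $ a" by simp
    qed (use Uc Vc in auto)
    then have "mat_adjoint U *\<^sub>v w = mat_adjoint U *\<^sub>v (U *\<^sub>v z)" using \<open>w = V *\<^sub>v y\<close> by simp
    also have "\<dots> = (mat_adjoint U * U) *\<^sub>v z"
      by (rule assoc_mult_mat_vec[symmetric]) (use Uc in \<open>auto simp: z_def\<close>)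
    also have "\<dots> = z" using UU by (simp add: z_def)
    finally show ?thesis using i by (simp add: z_def)
  qed
  moreover have "col U j \<in> W" if "j < k" for j using V(2) U(3) that by simp
  ultimately show ?thesis using that[of k U] Uc UU UU' U(2) \<open>m = n\<close> by blast
qed

section \<open>Intertwiners and Schur's lemma\<close>

lemma unitary_repD:
  assumes "unitary_rep G \<rho>" "g \<in> carrier G"
  shows "\<rho> g \<in> carrier_mat (rep_dim G \<rho>) (rep_dim G \<rho>)"
    and "\<rho> g * mat_adjoint (\<rho> g) = 1\<^sub>m (rep_dim G \<rho>)"
    and "mat_adjoint (\<rho> g) * \<rho> g = 1\<^sub>m (rep_dim G \<rho>)"
    and "h \<in> carrier G \<Longrightarrow> \<rho> (g \<otimes>\<^bsub>G\<^esub> h) = \<rho> g * \<rho> h"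
proof -
  show c: "\<rho> g \<in> carrier_mat (rep_dim G \<rho>) (rep_dim G \<rho>)"
    and u: "\<rho> g * mat_adjoint (\<rho> g) = 1\<^sub>m (rep_dim G \<rho>)"
    and "h \<in> carrier G \<Longrightarrow> \<rho> (g \<otimes>\<^bsub>G\<^esub> h) = \<rho> g * \<rho> h"
    using assms unfolding unitary_rep_def by auto
  show "mat_adjoint (\<rho> g) * \<rho> g = 1\<^sub>m (rep_dim G \<rho>)"
    using mat_mult_left_right_inverse[OF c mat_adjoint_carrier[OF c] u] .
qed

lemma (in group) unitary_rep_one:
  assumes "unitary_rep G \<rho>"
  shows "\<rho> \<one> = 1\<^sub>m (rep_dim G \<rho>)"
proof -
  let ?n = "rep_dim G \<rho>"
  note r = unitary_repD[OF assms one_closed]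
  have "\<rho> \<one> = \<rho> \<one> * (\<rho> \<one> * mat_adjoint (\<rho> \<one>))" using r by simp
  also have "\<dots> = \<rho> \<one> * \<rho> \<one> * mat_adjoint (\<rho> \<one>)"
    by (rule assoc_mult_mat[symmetric, of _ ?n ?n _ ?n _ ?n]) (use r in auto)
  also have "\<rho> \<one> * \<rho> \<one> = \<rho> \<one>" using r(4)[OF one_closed] by simp
  finally show ?thesis using r by simp
qed

lemma (in group) unitary_rep_inv:
  assumes "unitary_rep G \<rho>" "g \<in> carrier G"
  shows "\<rho> (inv g) = mat_adjoint (\<rho> g)"
proof -
  let ?n = "rep_dim G \<rho>"
  note r = unitary_repD[OF assms] and r' = unitary_repD[OF assms(1) inv_closed[OF assms(2)]]
  have "\<rho> (inv g) = \<rho> (inv g) * (\<rho> g * mat_adjoint (\<rho> g))" using r r' by simp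
  also have "\<dots> = \<rho> (inv g) * \<rho> g * mat_adjoint (\<rho> g)"
    by (rule assoc_mult_mat[symmetric, of _ ?n ?n _ ?n _ ?n]) (use r r' in auto)
  also have "\<rho> (inv g) * \<rho> g = 1\<^sub>m ?n"
    using r'(4)[OF assms(2)] assms unitary_rep_one by simp
  finally show ?thesis using r by simp
qed

definition intertwiners ::
  "('g, 'b) monoid_scheme \<Rightarrow> ('g \<Rightarrow> complex mat) \<Rightarrow> ('g \<Rightarrow> complex mat) \<Rightarrow> complex mat set" where
  "intertwiners G \<rho> \<sigma> =
     {X \<in> carrier_mat (rep_dim G \<sigma>) (rep_dim G \<rho>). \<forall>g\<in>carrier G. X * \<rho> g = \<sigma> g * X}"

abbreviation "commutant G \<rho> \<equiv> intertwiners G \<rho> \<rho>"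

lemma intertwiners_mult:
  assumes "unitary_rep G \<rho>" "unitary_rep G \<sigma>" "unitary_rep G \<tau>"
    and X: "X \<in> intertwiners G \<rho> \<sigma>" and Y: "Y \<in> intertwiners G \<sigma> \<tau>"
  shows "Y * X \<in> intertwiners G \<rho> \<tau>"
proof -
  let ?l = "rep_dim G \<rho>" and ?m = "rep_dim G \<sigma>" and ?n = "rep_dim G \<tau>"
  have Xc: "X \<in> carrier_mat ?m ?l" and Yc: "Y \<in> carrier_mat ?n ?m"
    using X Y by (auto simp: intertwiners_def)
  have "Y * X * \<rho> g = \<tau> g * (Y * X)" if g: "g \<in> carrier G" for g
  proof -
    note r = unitary_repD(1)[OF assms(1) g] unitary_repD(1)[OF assms(2) g] unitary_repD(1)[OF assms(3) g]
    have "Y * X * \<rho> g = Y * (X * \<rho> g)" by (rule assoc_mult_mat) (use r Xc Yc in auto)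
    also have "\<dots> = Y * (\<sigma> g * X)" using X g by (simp add: intertwiners_def)
    also have "\<dots> = Y * \<sigma> g * X" by (rule assoc_mult_mat[symmetric]) (use r Xc Yc in auto)
    also have "\<dots> = \<tau> g * Y * X" using Y g by (simp add: intertwiners_def)
    also have "\<dots> = \<tau> g * (Y * X)" by (rule assoc_mult_mat) (use r Xc Yc in auto)
    finally show ?thesis .
  qed
  then show ?thesis using Xc Yc by (auto simp: intertwiners_def)
qed

lemma (in group) intertwiners_adjoint:
  assumes "unitary_rep G \<rho>" "unitary_rep G \<sigma>" and X: "X \<in> intertwiners G \<rho> \<sigma>"
  shows "mat_adjoint X \<in> intertwiners G \<sigma> \<rho>"
proof -
  have Xc: "X \<in> carrier_mat (rep_dim G \<sigma>) (rep_dim G \<rho>)" using X by (auto simp: intertwiners_def)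
  have "mat_adjoint X * \<sigma> g = \<rho> g * mat_adjoint X" if g: "g \<in> carrier G" for g
  proof -
    note r = unitary_repD(1)[OF assms(1) g] unitary_repD(1)[OF assms(2) g]
    have "X * mat_adjoint (\<rho> g) = mat_adjoint (\<sigma> g) * X"
      using X g assms(1,2) unitary_rep_inv by (auto simp: intertwiners_def)
    then have "mat_adjoint (X * mat_adjoint (\<rho> g)) = mat_adjoint (mat_adjoint (\<sigma> g) * X)" by simp
    then show ?thesis
      using r Xc by (simp add: mat_adjoint_mult[of X _ "rep_dim G \<rho>" _ "rep_dim G \<rho>"]
          mat_adjoint_mult[of _ "rep_dim G \<sigma>" "rep_dim G \<sigma>" X "rep_dim G \<rho>"])
  qed
  then show ?thesis using Xc by (auto simp: intertwiners_def)
qed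

lemma equivalent_repsI:
  assumes T: "T \<in> intertwiners G \<rho> \<sigma>"
    and dims: "rep_dim G \<rho> = n" "rep_dim G \<sigma> = n"
    and S: "S \<in> carrier_mat n n" "T * S = 1\<^sub>m n" "S * T = 1\<^sub>m n"
  shows "equivalent_reps G \<rho> \<sigma>"
proof -
  have Tc: "T \<in> carrier_mat n n" using T dims by (simp add: intertwiners_def)
  have "invertible_mat T"
    unfolding invertible_mat_def inverts_mat_def
    using Tc S by (intro conjI exI[of _ S]) auto
  then show ?thesis
    using T dims by (intro equivalent_reps_def[THEN iffD2] conjI bexI[of _ T])
      (auto simp: intertwiners_def)
qed

lemma equivalent_repsE:
  assumes "equivalent_reps G \<rho> \<sigma>" "unitary_rep G \<rho>" "unitary_rep G \<sigma>"
  obtains n T S where "rep_dim G \<rho> = n" "rep_dim G \<sigma> = n"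
    "T \<in> carrier_mat n n" "S \<in> carrier_mat n n" "T * S = 1\<^sub>m n" "S * T = 1\<^sub>m n"
    "T \<in> intertwiners G \<rho> \<sigma>" "S \<in> intertwiners G \<sigma> \<rho>"
proof -
  define n where "n = rep_dim G \<rho>"
  from assms obtain T where n: "rep_dim G \<sigma> = n" and T: "T \<in> carrier_mat n n"
    and inv: "invertible_mat T" and tw: "\<forall>g\<in>carrier G. T * \<rho> g = \<sigma> g * T"
    unfolding equivalent_reps_def n_def by metis
  from inv obtain S where TS: "T * S = 1\<^sub>m n" and ST': "S * T = 1\<^sub>m (dim_row S)"
    using T unfolding invertible_mat_def inverts_mat_def by auto
  have "dim_col S = n" using arg_cong[OF TS, of dim_col] by simp
  moreover have "dim_row S = n" using arg_cong[OF ST', of dim_col] T by simp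
  ultimately have S: "S \<in> carrier_mat n n" "S * T = 1\<^sub>m n" using ST' by auto
  have "S * \<sigma> g = \<rho> g * S" if g: "g \<in> carrier G" for g
  proof -
    have c: "\<rho> g \<in> carrier_mat n n" "\<sigma> g \<in> carrier_mat n n"
      using unitary_repD(1)[OF assms(2) g] unitary_repD(1)[OF assms(3) g] n n_def by auto
    have "S * \<sigma> g = S * (\<sigma> g * (T * S))" using c S TS by simp
    also have "\<dots> = S * (\<sigma> g * T * S)" using c T S by (simp add: assoc_mult_mat[of _ n n _ n _ n])
    also have "\<dots> = S * (T * \<rho> g * S)" using tw g by simp
    also have "\<dots> = (S * T) * (\<rho> g * S)"
      using c T S(1) by (simp add: assoc_mult_mat[of _ n n _ n _ n])
    also have "\<dots> = \<rho> g * S" using c S by simp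
    finally show ?thesis .
  qed
  then show ?thesis
    using that[of n T S] n n_def T S TS tw by (simp add: intertwiners_def)
qed

lemma equivalent_reps_sym:
  assumes "equivalent_reps G \<rho> \<sigma>" "unitary_rep G \<rho>" "unitary_rep G \<sigma>"
  shows "equivalent_reps G \<sigma> \<rho>"
  using assms by (elim equivalent_repsE) (auto intro: equivalent_repsI)

lemma equivalent_reps_trans:
  assumes eq: "equivalent_reps G \<rho> \<sigma>" "equivalent_reps G \<sigma> \<tau>"
    and u: "unitary_rep G \<rho>" "unitary_rep G \<sigma>" "unitary_rep G \<tau>"
  shows "equivalent_reps G \<rho> \<tau>"
proof -
  obtain n T S where a: "rep_dim G \<rho> = n" "rep_dim G \<sigma> = n"
    "T \<in> carrier_mat n n" "S \<in> carrier_mat n n" "T * S = 1\<^sub>m n" "S * T = 1\<^sub>m n"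
    "T \<in> intertwiners G \<rho> \<sigma>"
    using equivalent_repsE[OF eq(1) u(1,2)] by metis
  obtain m T' S' where b': "rep_dim G \<sigma> = m" "rep_dim G \<tau> = m"
    "T' \<in> carrier_mat m m" "S' \<in> carrier_mat m m" "T' * S' = 1\<^sub>m m" "S' * T' = 1\<^sub>m m"
    "T' \<in> intertwiners G \<sigma> \<tau>"
    using equivalent_repsE[OF eq(2) u(2,3)] by metis
  have "m = n" using a b' by simp
  note b = b'[unfolded this]
  have "T' * T * (S * S') = T' * (T * S) * S'" "S * S' * (T' * T) = S * (S' * T') * T"
    using a(3,4) b(3,4) by (simp_all add: assoc_mult_mat[of _ n n _ n _ n])
  then have "T' * T * (S * S') = 1\<^sub>m n" "S * S' * (T' * T) = 1\<^sub>m n" using a b by auto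
  moreover have "S * S' \<in> carrier_mat n n" using a b by auto
  ultimately show ?thesis
    using equivalent_repsI[OF intertwiners_mult[OF u a(7) b(7)] a(1) b(2)] by blast
qed

lemma mat_eqI_mult_vec:
  fixes A B :: "complex mat"
  assumes "A \<in> carrier_mat n m" "B \<in> carrier_mat n m"
    and "\<And>v. v \<in> carrier_vec m \<Longrightarrow> A *\<^sub>v v = B *\<^sub>v v"
  shows "A = B"
proof (intro eq_matI)
  fix i j assume ij: "i < dim_row B" "j < dim_col B"
  have "(A *\<^sub>v unit_vec m j) $ i = (B *\<^sub>v unit_vec m j) $ i" using assms(3) by simp
  then show "A $$ (i, j) = B $$ (i, j)" using ij assms(1,2) by simp
qed (use assms in auto)

lemma zero_mat_mult_vec:
  "v \<in> carrier_vec m \<Longrightarrow> 0\<^sub>m n m *\<^sub>v v = (0\<^sub>v n :: complex vec)"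
  by (intro eq_vecI) auto

text \<open>The kernel of an intertwiner is an invariant subspace.\<close>
lemma irreducible_intertwiner_injective:
  assumes irr: "irreducible_rep G \<rho>" and \<sigma>: "unitary_rep G \<sigma>"
    and X: "X \<in> intertwiners G \<rho> \<sigma>" "X \<noteq> 0\<^sub>m (rep_dim G \<sigma>) (rep_dim G \<rho>)"
    and v: "v \<in> carrier_vec (rep_dim G \<rho>)" "X *\<^sub>v v = 0\<^sub>v (rep_dim G \<sigma>)"
  shows "v = 0\<^sub>v (rep_dim G \<rho>)"
proof -
  let ?n = "rep_dim G \<rho>" and ?m = "rep_dim G \<sigma>"
  have Xc: "X \<in> carrier_mat ?m ?n" using X by (auto simp: intertwiners_def)
  have \<rho>: "unitary_rep G \<rho>" using irr by (simp add: irreducible_rep_def)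
  define W where "W = {v \<in> carrier_vec ?n. X *\<^sub>v v = 0\<^sub>v ?m}"
  have "\<rho> g *\<^sub>v w \<in> W" if g: "g \<in> carrier G" and w: "w \<in> W" for g w
  proof -
    note r = unitary_repD(1)[OF \<rho> g] unitary_repD(1)[OF \<sigma> g]
    have "X *\<^sub>v (\<rho> g *\<^sub>v w) = X * \<rho> g *\<^sub>v w"
      by (rule assoc_mult_mat_vec[symmetric]) (use r w Xc in \<open>auto simp: W_def\<close>)
    also have "\<dots> = \<sigma> g * X *\<^sub>v w" using X g by (simp add: intertwiners_def)
    also have "\<dots> = \<sigma> g *\<^sub>v (X *\<^sub>v w)"
      by (rule assoc_mult_mat_vec) (use r w Xc in \<open>auto simp: W_def\<close>)
    also have "\<dots> = 0\<^sub>v ?m" using w r by (auto simp: W_def)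
    finally show ?thesis using r w mult_mat_vec_carrier[OF r(1)] by (auto simp: W_def)
  qed
  moreover have "VectorSpace.subspace class_ring W (module_vec TYPE(complex) ?n)"
    unfolding subspace_vec_iff using Xc
    by (auto simp: W_def mult_add_distrib_mat_vec[OF Xc] mult_mat_vec[OF Xc])
  ultimately have "W = {0\<^sub>v ?n} \<or> W = carrier_vec ?n"
    using irr by (auto simp: irreducible_rep_def invariant_subspace_def)
  moreover have "W \<noteq> carrier_vec ?n"
  proof
    assume "W = carrier_vec ?n"
    then have "X = 0\<^sub>m ?m ?n"
      by (intro mat_eqI_mult_vec[OF Xc]) (auto simp: W_def zero_mat_mult_vec)
    then show False using X by simp
  qed
  ultimately show ?thesis using v by (auto simp: W_def)
qed

text \<open>The adjoint of an intertwiner is an intertwiner in the other direction, so both \<open>X\<close> and \<open>X\<^sup>*\<close>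
  are injective. This replaces the usual argument with the image of \<open>X\<close>.\<close>
lemma (in group) schur_lemma:
  assumes irr: "irreducible_rep G \<rho>" "irreducible_rep G \<sigma>"
    and X: "X \<in> intertwiners G \<rho> \<sigma>" "X \<noteq> 0\<^sub>m (rep_dim G \<sigma>) (rep_dim G \<rho>)"
  shows "equivalent_reps G \<rho> \<sigma>"
proof -
  let ?n = "rep_dim G \<rho>" and ?m = "rep_dim G \<sigma>"
  have u: "unitary_rep G \<rho>" "unitary_rep G \<sigma>" using irr by (auto simp: irreducible_rep_def)
  have Xc: "X \<in> carrier_mat ?m ?n" using X by (auto simp: intertwiners_def)
  have Y: "mat_adjoint X \<in> intertwiners G \<sigma> \<rho>" by (rule intertwiners_adjoint[OF u X(1)])
  have Y0: "mat_adjoint X \<noteq> 0\<^sub>m ?n ?m" 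
  proof
    assume "mat_adjoint X = 0\<^sub>m ?n ?m"
    then have "mat_adjoint (mat_adjoint X) = 0\<^sub>m ?m ?n" by simp
    then show False using X(2) by simp
  qed
  note inj = irreducible_intertwiner_injective[OF irr(1) u(2) X]
    irreducible_intertwiner_injective[OF irr(2) u(1) Y Y0]
  have "\<not> ?m < ?n" using wide_matrix_kernel[OF Xc] inj(1) by metis
  moreover have "\<not> ?n < ?m" using wide_matrix_kernel[OF mat_adjoint_carrier[OF Xc]] inj(2) by metis
  ultimately have mn: "?m = ?n" by simp
  then have Xc': "X \<in> carrier_mat ?n ?n" using Xc by simp
  have "det X \<noteq> 0" using det_0_iff_vec_prod_zero[OF Xc'] inj(1) mn by auto
  from det_non_zero_imp_unit[OF Xc' this]
  obtain S where "S \<in> carrier_mat ?n ?n" "X * S = 1\<^sub>m ?n" "S * X = 1\<^sub>m ?n"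
    unfolding Units_def by (auto simp: ring_mat_simps)
  then show ?thesis using equivalent_repsI[OF X(1) refl mn] by blast
qed

text \<open>An eigenvalue \<open>c\<close> exists over the complex numbers, and then \<open>X - c\<close> is an intertwiner that is
  not injective.\<close>
lemma schur_lemma_scalar:
  assumes irr: "irreducible_rep G \<rho>" and X: "X \<in> commutant G \<rho>"
  obtains c where "X = c \<cdot>\<^sub>m 1\<^sub>m (rep_dim G \<rho>)"
proof -
  let ?n = "rep_dim G \<rho>"
  have u: "unitary_rep G \<rho>" using irr by (auto simp: irreducible_rep_def)
  have Xc: "X \<in> carrier_mat ?n ?n" using X by (auto simp: intertwiners_def)
  have "?n > 0" using irr by (auto simp: irreducible_rep_def)
  then obtain c where "eigenvalue X c" using spectrum_non_empty[OF Xc] by (auto simp: spectrum_def)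
  then obtain v where v: "v \<in> carrier_vec ?n" "v \<noteq> 0\<^sub>v ?n" "X *\<^sub>v v = c \<cdot>\<^sub>v v"
    using Xc unfolding eigenvalue_def eigenvector_def by auto
  define Z where "Z = X + (- c) \<cdot>\<^sub>m 1\<^sub>m ?n"
  have Zc: "Z \<in> carrier_mat ?n ?n" using Xc by (simp add: Z_def)
  have "Z * \<rho> g = \<rho> g * Z" if g: "g \<in> carrier G" for g
  proof -
    note r = unitary_repD(1)[OF u g]
    have "Z * \<rho> g = X * \<rho> g + (- c) \<cdot>\<^sub>m \<rho> g"
      unfolding Z_def using r Xc
      by (subst add_mult_distrib_mat[of _ ?n ?n _ _ ?n]) auto
    also have "\<dots> = \<rho> g * X + (- c) \<cdot>\<^sub>m \<rho> g" using X g by (simp add: intertwiners_def)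
    also have "\<dots> = \<rho> g * Z" unfolding Z_def using r Xc
      by (subst mult_add_distrib_mat[of _ ?n ?n _ ?n]) (auto simp: mult_smult_distrib[of _ ?n ?n _ ?n])
    finally show ?thesis .
  qed
  then have ZI: "Z \<in> commutant G \<rho>" using Zc by (simp add: intertwiners_def)
  have "Z *\<^sub>v v = X *\<^sub>v v + ((- c) \<cdot>\<^sub>m 1\<^sub>m ?n) *\<^sub>v v"
    unfolding Z_def by (rule add_mult_distrib_mat_vec) (use Xc v in auto)
  also have "((- c) \<cdot>\<^sub>m 1\<^sub>m ?n) *\<^sub>v v = (- c) \<cdot>\<^sub>v v"
    using v by (intro eq_vecI) auto
  finally have "Z *\<^sub>v v = 0\<^sub>v ?n" using v by auto
  then have "Z = 0\<^sub>m ?n ?n"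
    using irreducible_intertwiner_injective[OF irr u ZI _ v(1)] v(2) by auto
  have "X = c \<cdot>\<^sub>m 1\<^sub>m ?n"
  proof (intro eq_matI)
    fix i j assume "i < dim_row (c \<cdot>\<^sub>m 1\<^sub>m ?n :: complex mat)" "j < dim_col (c \<cdot>\<^sub>m 1\<^sub>m ?n :: complex mat)"
    then show "X $$ (i, j) = (c \<cdot>\<^sub>m 1\<^sub>m ?n) $$ (i, j)"
      using arg_cong[OF \<open>Z = 0\<^sub>m ?n ?n\<close>, of "\<lambda>M. M $$ (i, j)"] Xc by (auto simp: Z_def)
  qed (use Xc in auto)
  then show ?thesis using that by blast
qed

section \<open>Direct sums and complete reducibility\<close>

text \<open>The direct sum of two representations. It makes the recursion in \<open>direct_sum_rep\<close> and the
  splitting off of an invariant subspace instances of the same construction.\<close>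
definition sum_rep ::
  "('g \<Rightarrow> complex mat) \<Rightarrow> ('g \<Rightarrow> complex mat) \<Rightarrow> 'g \<Rightarrow> complex mat" where
  "sum_rep \<rho> \<sigma> = (\<lambda>g. four_block_mat (\<rho> g) (0\<^sub>m (dim_row (\<rho> g)) (dim_col (\<sigma> g)))
     (0\<^sub>m (dim_row (\<sigma> g)) (dim_col (\<rho> g))) (\<sigma> g))"

lemma direct_sum_rep_Cons: "direct_sum_rep (\<sigma> # \<sigma>s) = sum_rep \<sigma> (direct_sum_rep \<sigma>s)"
  by (auto simp: direct_sum_rep_def sum_rep_def Let_def)

lemma direct_sum_rep_append:
  "direct_sum_rep (\<sigma>s @ \<tau>s) = sum_rep (direct_sum_rep \<sigma>s) (direct_sum_rep \<tau>s)"
  by (auto simp: direct_sum_rep_def sum_rep_def diag_block_mat_append Let_def)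

lemma rep_dim_sum_rep [simp]: "rep_dim G (sum_rep \<rho> \<sigma>) = rep_dim G \<rho> + rep_dim G \<sigma>"
  by (simp add: rep_dim_def sum_rep_def)

lemma mult_diag_block:
  fixes A A' D D' :: "complex mat"
  assumes "A \<in> carrier_mat m k" "D \<in> carrier_mat n l" "A' \<in> carrier_mat k p" "D' \<in> carrier_mat l q"
  shows "four_block_mat A (0\<^sub>m m l) (0\<^sub>m n k) D * four_block_mat A' (0\<^sub>m k q) (0\<^sub>m l p) D' =
    four_block_mat (A * A') (0\<^sub>m m q) (0\<^sub>m n p) (D * D')"
  using assms by (subst mult_four_block_mat[of _ m k _ l _ n _ _ p _ q]) auto

lemma mat_adjoint_diag_block:
  fixes A D :: "complex mat"
  assumes "A \<in> carrier_mat m k" "D \<in> carrier_mat n l"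
  shows "mat_adjoint (four_block_mat A (0\<^sub>m m l) (0\<^sub>m n k) D) =
    four_block_mat (mat_adjoint A) (0\<^sub>m k n) (0\<^sub>m l m) (mat_adjoint D)"
  using assms by (intro eq_matI) auto

lemma diag_block_cancel:
  fixes A D :: "complex mat"
  assumes eq: "four_block_mat A (0\<^sub>m m n) (0\<^sub>m n m) D = four_block_mat A' (0\<^sub>m m n) (0\<^sub>m n m) D'"
    and c: "A \<in> carrier_mat m m" "D \<in> carrier_mat n n" "A' \<in> carrier_mat m m" "D' \<in> carrier_mat n n"
  shows "A = A'" "D = D'"
proof -
  show "A = A'"
  proof (intro eq_matI)
    fix i j assume "i < dim_row A'" "j < dim_col A'"
    then show "A $$ (i, j) = A' $$ (i, j)" using arg_cong[OF eq, of "\<lambda>M. M $$ (i, j)"] c by simp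
  qed (use c in auto)
  show "D = D'"
  proof (intro eq_matI)
    fix i j assume "i < dim_row D'" "j < dim_col D'"
    then show "D $$ (i, j) = D' $$ (i, j)"
      using arg_cong[OF eq, of "\<lambda>M. M $$ (i + m, j + m)"] c by simp
  qed (use c in auto)
qed

lemma sum_rep_block:
  assumes "unitary_rep G \<rho>" "unitary_rep G \<sigma>" "g \<in> carrier G"
  shows "sum_rep \<rho> \<sigma> g = four_block_mat (\<rho> g) (0\<^sub>m (rep_dim G \<rho>) (rep_dim G \<sigma>))
     (0\<^sub>m (rep_dim G \<sigma>) (rep_dim G \<rho>)) (\<sigma> g)"
  using unitary_repD(1)[OF assms(1,3)] unitary_repD(1)[OF assms(2,3)] by (simp add: sum_rep_def)

lemma (in group) unitary_sum_rep:
  assumes u: "unitary_rep G \<rho>" "unitary_rep G \<sigma>"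
  shows "unitary_rep G (sum_rep \<rho> \<sigma>)"
  unfolding unitary_rep_def
proof (intro conjI ballI)
  fix g assume g: "g \<in> carrier G"
  note r = unitary_repD[OF u(1) g] and s = unitary_repD[OF u(2) g]
  show "sum_rep \<rho> \<sigma> g \<in> carrier_mat (rep_dim G (sum_rep \<rho> \<sigma>)) (rep_dim G (sum_rep \<rho> \<sigma>))"
    using r s by (simp add: sum_rep_block[OF u g])
  show "sum_rep \<rho> \<sigma> g * mat_adjoint (sum_rep \<rho> \<sigma> g) = 1\<^sub>m (rep_dim G (sum_rep \<rho> \<sigma>))"
    unfolding sum_rep_block[OF u g] mat_adjoint_diag_block[OF r(1) s(1)]
    by (subst mult_diag_block[OF r(1) s(1)]) (use r s in auto)
next
  fix g h assume g: "g \<in> carrier G" and h: "h \<in> carrier G"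
  have gh: "g \<otimes> h \<in> carrier G" using g h by simp
  show "sum_rep \<rho> \<sigma> (g \<otimes> h) = sum_rep \<rho> \<sigma> g * sum_rep \<rho> \<sigma> h"
    unfolding sum_rep_block[OF u g] sum_rep_block[OF u h] sum_rep_block[OF u gh]
    by (subst mult_diag_block[OF unitary_repD(1)[OF u(1) g] unitary_repD(1)[OF u(2) g]
          unitary_repD(1)[OF u(1) h] unitary_repD(1)[OF u(2) h]])
      (use unitary_repD(4)[OF u(1) g h] unitary_repD(4)[OF u(2) g h] in simp)
qed

lemma (in group) unitary_direct_sum_rep:
  "(\<And>\<sigma>. \<sigma> \<in> set \<sigma>s \<Longrightarrow> unitary_rep G \<sigma>) \<Longrightarrow> unitary_rep G (direct_sum_rep \<sigma>s)"
proof (induction \<sigma>s)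
  case Nil
  have "mat_adjoint (0\<^sub>m 0 0) = (0\<^sub>m 0 0 :: complex mat)" by (intro eq_matI) auto
  then show ?case by (auto simp: unitary_rep_def direct_sum_rep_def rep_dim_def)
next
  case (Cons \<sigma> \<sigma>s)
  then show ?case by (simp add: direct_sum_rep_Cons unitary_sum_rep)
qed

lemma equivalent_sum_rep:
  assumes eq: "equivalent_reps G \<rho> \<rho>'" "equivalent_reps G \<sigma> \<sigma>'"
    and u: "unitary_rep G \<rho>" "unitary_rep G \<rho>'" "unitary_rep G \<sigma>" "unitary_rep G \<sigma>'"
  shows "equivalent_reps G (sum_rep \<rho> \<sigma>) (sum_rep \<rho>' \<sigma>')"
proof -
  obtain m T S where a: "rep_dim G \<rho> = m" "rep_dim G \<rho>' = m"
    "T \<in> carrier_mat m m" "S \<in> carrier_mat m m" "T * S = 1\<^sub>m m" "S * T = 1\<^sub>m m"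
    "T \<in> intertwiners G \<rho> \<rho>'"
    using equivalent_repsE[OF eq(1) u(1,2)] by metis
  obtain n T' S' where b: "rep_dim G \<sigma> = n" "rep_dim G \<sigma>' = n"
    "T' \<in> carrier_mat n n" "S' \<in> carrier_mat n n" "T' * S' = 1\<^sub>m n" "S' * T' = 1\<^sub>m n"
    "T' \<in> intertwiners G \<sigma> \<sigma>'"
    using equivalent_repsE[OF eq(2) u(3,4)] by metis
  let ?T = "four_block_mat T (0\<^sub>m m n) (0\<^sub>m n m) T'" and ?S = "four_block_mat S (0\<^sub>m m n) (0\<^sub>m n m) S'"
  have "?T * sum_rep \<rho> \<sigma> g = sum_rep \<rho>' \<sigma>' g * ?T" if g: "g \<in> carrier G" for g
  proof -
    note r = unitary_repD(1)[OF u(1) g] unitary_repD(1)[OF u(2) g]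
      unitary_repD(1)[OF u(3) g] unitary_repD(1)[OF u(4) g]
    have "?T * sum_rep \<rho> \<sigma> g = four_block_mat (T * \<rho> g) (0\<^sub>m m n) (0\<^sub>m n m) (T' * \<sigma> g)"
      unfolding sum_rep_block[OF u(1,3) g] a b by (rule mult_diag_block) (use a b r in auto)
    also have "\<dots> = four_block_mat (\<rho>' g * T) (0\<^sub>m m n) (0\<^sub>m n m) (\<sigma>' g * T')"
      using a(7) b(7) g by (simp add: intertwiners_def)
    also have "\<dots> = sum_rep \<rho>' \<sigma>' g * ?T"
      unfolding sum_rep_block[OF u(2,4) g] a b by (rule mult_diag_block[symmetric]) (use a b r in auto)
    finally show ?thesis .
  qed
  then have "?T \<in> intertwiners G (sum_rep \<rho> \<sigma>) (sum_rep \<rho>' \<sigma>')"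
    using a b by (auto simp: intertwiners_def)
  moreover have "?T * ?S = 1\<^sub>m (m + n)" "?S * ?T = 1\<^sub>m (m + n)"
    using a(3-6) b(3-6) by (simp_all add: mult_diag_block[of _ m m _ n n _ m _ n])
  moreover have "?S \<in> carrier_mat (m + n) (m + n)" using a b by auto
  ultimately show ?thesis using a b by (intro equivalent_repsI[of ?T _ _ _ _ ?S]) auto
qed

text \<open>In an orthonormal basis adapted to \<open>W\<close> the matrices are block triangular because \<open>W\<close> is
  invariant, and block diagonal because the adjoint of \<open>\<rho> g\<close> is \<open>\<rho> (inv g)\<close>. The two diagonal blocks
  inherit multiplicativity and unitarity.\<close>
lemma (in group) invariant_subspace_splits:
  assumes u: "unitary_rep G \<rho>" and W: "invariant_subspace G \<rho> W"
    and ne: "W \<noteq> {0\<^sub>v (rep_dim G \<rho>)}" "W \<noteq> carrier_vec (rep_dim G \<rho>)"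
  obtains \<sigma> \<tau> where "unitary_rep G \<sigma>" "unitary_rep G \<tau>" "equivalent_reps G \<rho> (sum_rep \<sigma> \<tau>)"
    "rep_dim G \<sigma> < rep_dim G \<rho>" "rep_dim G \<tau> < rep_dim G \<rho>"
proof -
  define n where "n = rep_dim G \<rho>"
  have W': "VectorSpace.subspace class_ring W (module_vec TYPE(complex) n)"
    and inv: "\<And>g w. g \<in> carrier G \<Longrightarrow> w \<in> W \<Longrightarrow> \<rho> g *\<^sub>v w \<in> W"
    using W unfolding invariant_subspace_def n_def by blast+
  have Wc: "W \<subseteq> carrier_vec n" and W0: "0\<^sub>v n \<in> W" using W' by (auto simp: subspace_vec_iff)
  obtain k U where k: "k \<le> n" and Uc: "U \<in> carrier_mat n n"
    and UU: "mat_adjoint U * U = 1\<^sub>m n" "U * mat_adjoint U = 1\<^sub>m n"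
    and UW0: "\<forall>j<k. col U j \<in> W"
    and UW0': "\<forall>w\<in>W. \<forall>i. k \<le> i \<longrightarrow> i < n \<longrightarrow> (mat_adjoint U *\<^sub>v w) $ i = 0"
    by (rule unitary_adapted_to_subspace[OF W'])
  have UW: "col U j \<in> W" if "j < k" for j using UW0 that by blast
  have UW': "(mat_adjoint U *\<^sub>v w) $ i = 0" if "w \<in> W" "k \<le> i" "i < n" for w i
    using UW0' that by blast
  have Ucc: "mat_adjoint U \<in> carrier_mat n n" using Uc by auto
  have "k \<noteq> 0"
  proof
    assume "k = 0"
    have "w = 0\<^sub>v n" if w: "w \<in> W" for w
    proof -
      have wc: "w \<in> carrier_vec n" using w Wc by auto
      have "mat_adjoint U *\<^sub>v w = 0\<^sub>v n"
      proof (intro eq_vecI)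
        fix i assume "i < dim_vec (0\<^sub>v n :: complex vec)"
        then show "(mat_adjoint U *\<^sub>v w) $ i = 0\<^sub>v n $ i" using UW'[OF w, of i] \<open>k = 0\<close> by simp
      qed (use Uc in auto)
      then have "U *\<^sub>v (mat_adjoint U *\<^sub>v w) = 0\<^sub>v n" using Uc by auto
      moreover have "U *\<^sub>v (mat_adjoint U *\<^sub>v w) = w"
        using UU wc assoc_mult_mat_vec[OF Uc Ucc wc] by simp
      ultimately show ?thesis by simp
    qed
    then have "W = {0\<^sub>v n}" using W0 by blast
    then show False using ne(1) unfolding n_def by blast
  qed
  have "k \<noteq> n"
  proof
    assume "k = n"
    have "v \<in> W" if v: "v \<in> carrier_vec n" for v
    proof -
      have "U *\<^sub>v (mat_adjoint U *\<^sub>v v) \<in> W"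
        by (rule isometry_image_subspace[OF W' Uc]) (use UW \<open>k = n\<close> mult_mat_vec_carrier[OF Ucc v] in auto)
      then show ?thesis using UU v assoc_mult_mat_vec[OF Uc Ucc v] by simp
    qed
    then have "W = carrier_vec n" using Wc by blast
    then show False using ne(2) unfolding n_def by blast
  qed
  \<comment> \<open>\<open>\<rho>\<close> in the adapted basis.\<close>
  define C where "C g = mat_adjoint U * \<rho> g * U" for g
  define \<sigma> where "\<sigma> g = mat k k (\<lambda>(i, j). C g $$ (i, j))" for g
  define \<tau> where "\<tau> g = mat (n - k) (n - k) (\<lambda>(i, j). C g $$ (i + k, j + k))" for g
  have rc: "\<rho> g \<in> carrier_mat n n" if "g \<in> carrier G" for g
    using unitary_repD(1)[OF u that] by (simp add: n_def)
  have Cc: "C g \<in> carrier_mat n n" if "g \<in> carrier G" for g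
    unfolding C_def using rc[OF that] Uc Ucc by auto
  have Cadj: "mat_adjoint (C g) = C (inv g)" if g: "g \<in> carrier G" for g
  proof -
    have "mat_adjoint (C g) = mat_adjoint U * mat_adjoint (mat_adjoint U * \<rho> g)"
      unfolding C_def using rc[OF g] Uc Ucc by (intro mat_adjoint_mult[of _ n n _ n]) auto
    also have "mat_adjoint (mat_adjoint U * \<rho> g) = mat_adjoint (\<rho> g) * U"
      using rc[OF g] Uc Ucc by (subst mat_adjoint_mult[of _ n n _ n]) auto
    also have "mat_adjoint U * (mat_adjoint (\<rho> g) * U) = C (inv g)"
      unfolding C_def unitary_rep_inv[OF u g]
      using rc[OF g] Uc Ucc by (intro assoc_mult_mat[symmetric, of _ n n _ n _ n]) auto
    finally show ?thesis .
  qed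
  have Cmult: "C (g \<otimes> h) = C g * C h" if g: "g \<in> carrier G" and h: "h \<in> carrier G" for g h
  proof -
    have c: "\<rho> g * U \<in> carrier_mat n n" "\<rho> h * U \<in> carrier_mat n n"
      "mat_adjoint U * (\<rho> h * U) \<in> carrier_mat n n"
      using rc[OF g] rc[OF h] Uc Ucc by auto
    have "C g * C h = (mat_adjoint U * (\<rho> g * U)) * (mat_adjoint U * (\<rho> h * U))"
      unfolding C_def using assoc_mult_mat[OF Ucc rc[OF g] Uc] assoc_mult_mat[OF Ucc rc[OF h] Uc] by simp
    also have "\<dots> = mat_adjoint U * (\<rho> g * (U * (mat_adjoint U * (\<rho> h * U))))"
      using assoc_mult_mat[OF Ucc c(1) c(3)] assoc_mult_mat[OF rc[OF g] Uc c(3)] by simp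
    also have "U * (mat_adjoint U * (\<rho> h * U)) = (U * mat_adjoint U) * (\<rho> h * U)"
      by (rule assoc_mult_mat[OF Uc Ucc c(2), symmetric])
    also have "(U * mat_adjoint U) * (\<rho> h * U) = \<rho> h * U" using UU rc[OF h] Uc by simp
    also have "mat_adjoint U * (\<rho> g * (\<rho> h * U)) = C (g \<otimes> h)"
      unfolding C_def unitary_repD(4)[OF u g h] using rc[OF g] rc[OF h] Uc Ucc
      by (simp add: assoc_mult_mat[of _ n n _ n _ n])
    finally show ?thesis by simp
  qed
  have Clow: "C g $$ (i, j) = 0" if g: "g \<in> carrier G" and ij: "k \<le> i" "i < n" "j < k" for g i j
  proof -
    have "C g = mat_adjoint U * (\<rho> g * U)"
      unfolding C_def using rc[OF g] Uc Ucc by (intro assoc_mult_mat[of _ n n _ n _ n]) auto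
    moreover have "\<rho> g * U \<in> carrier_mat n n" using rc[OF g] Uc by auto
    ultimately have "col (C g) j = mat_adjoint U *\<^sub>v (\<rho> g *\<^sub>v col U j)"
      using col_mult2[OF Ucc, of "\<rho> g * U" n j] col_mult2[OF rc[OF g] Uc, of j] ij k
      by simp
    moreover have "C g $$ (i, j) = col (C g) j $ i" using Cc[OF g] ij k by simp
    ultimately have "C g $$ (i, j) = (mat_adjoint U *\<^sub>v (\<rho> g *\<^sub>v col U j)) $ i" by (simp only:)
    then show ?thesis using UW'[OF inv[OF g UW[OF ij(3)]] ij(1,2)] by simp
  qed
  have Cup: "C g $$ (i, j) = 0" if g: "g \<in> carrier G" and ij: "i < k" "k \<le> j" "j < n" for g i j
  proof -
    have "C g $$ (i, j) = cnj (mat_adjoint (C g) $$ (j, i))" using Cc[OF g] ij k by simp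
    then show ?thesis using Clow[of "inv g" j i] Cadj[OF g] g ij by simp
  qed
  have Cblock: "C g = four_block_mat (\<sigma> g) (0\<^sub>m k (n - k)) (0\<^sub>m (n - k) k) (\<tau> g)" if g: "g \<in> carrier G" for g
  proof (intro eq_matI)
    fix i j assume "i < dim_row (four_block_mat (\<sigma> g) (0\<^sub>m k (n - k)) (0\<^sub>m (n - k) k) (\<tau> g))"
      "j < dim_col (four_block_mat (\<sigma> g) (0\<^sub>m k (n - k)) (0\<^sub>m (n - k) k) (\<tau> g))"
    then have ij: "i < n" "j < n" using k by (auto simp: \<sigma>_def \<tau>_def)
    then show "C g $$ (i, j) = four_block_mat (\<sigma> g) (0\<^sub>m k (n - k)) (0\<^sub>m (n - k) k) (\<tau> g) $$ (i, j)"
      using Clow[OF g, of i j] Cup[OF g, of i j] k by (auto simp: \<sigma>_def \<tau>_def)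
  qed (use Cc[OF g] k in \<open>auto simp: \<sigma>_def \<tau>_def\<close>)
  have \<sigma>c: "\<sigma> g \<in> carrier_mat k k" and \<tau>c: "\<tau> g \<in> carrier_mat (n - k) (n - k)" for g
    by (auto simp: \<sigma>_def \<tau>_def)
  have dims: "rep_dim G \<sigma> = k" "rep_dim G \<tau> = n - k" using \<sigma>c \<tau>c by (auto simp: rep_dim_def)
  note blocks = \<sigma>c \<tau>c mult_carrier_mat[OF \<sigma>c \<sigma>c] mult_carrier_mat[OF \<tau>c \<tau>c]
    mult_carrier_mat[OF \<sigma>c mat_adjoint_carrier[OF \<sigma>c]]
    mult_carrier_mat[OF \<tau>c mat_adjoint_carrier[OF \<tau>c]]
  have CC: "C g * mat_adjoint (C g) = 1\<^sub>m n" if g: "g \<in> carrier G" for g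
  proof -
    have "C g * mat_adjoint (C g) = C \<one>" using Cadj[OF g] Cmult[of g "inv g"] g by simp
    also have "\<dots> = 1\<^sub>m n" using unitary_rep_one[OF u] UU Ucc Uc by (simp add: C_def n_def)
    finally show ?thesis .
  qed
  have mult: "\<sigma> (g \<otimes> h) = \<sigma> g * \<sigma> h" "\<tau> (g \<otimes> h) = \<tau> g * \<tau> h"
    if g: "g \<in> carrier G" and h: "h \<in> carrier G" for g h
  proof -
    have "C g * C h =
      four_block_mat (\<sigma> g * \<sigma> h) (0\<^sub>m k (n - k)) (0\<^sub>m (n - k) k) (\<tau> g * \<tau> h)"
      unfolding Cblock[OF g] Cblock[OF h] by (rule mult_diag_block[OF \<sigma>c \<tau>c \<sigma>c \<tau>c])
    then have eq: "four_block_mat (\<sigma> (g \<otimes> h)) (0\<^sub>m k (n - k)) (0\<^sub>m (n - k) k) (\<tau> (g \<otimes> h)) =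
      four_block_mat (\<sigma> g * \<sigma> h) (0\<^sub>m k (n - k)) (0\<^sub>m (n - k) k) (\<tau> g * \<tau> h)"
      using Cblock[of "g \<otimes> h"] Cmult[OF g h] g h by simp
    show "\<sigma> (g \<otimes> h) = \<sigma> g * \<sigma> h"
      by (rule diag_block_cancel(1)[OF eq]) (use blocks in auto)
    show "\<tau> (g \<otimes> h) = \<tau> g * \<tau> h"
      by (rule diag_block_cancel(2)[OF eq]) (use blocks in auto)
  qed
  have unit: "\<sigma> g * mat_adjoint (\<sigma> g) = 1\<^sub>m k" "\<tau> g * mat_adjoint (\<tau> g) = 1\<^sub>m (n - k)"
    if g: "g \<in> carrier G" for g
  proof -
    have "C g * mat_adjoint (C g) = four_block_mat (\<sigma> g * mat_adjoint (\<sigma> g))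
        (0\<^sub>m k (n - k)) (0\<^sub>m (n - k) k) (\<tau> g * mat_adjoint (\<tau> g))"
      unfolding Cblock[OF g] mat_adjoint_diag_block[OF \<sigma>c \<tau>c]
      by (rule mult_diag_block) (use \<sigma>c \<tau>c in auto)
    then have eq: "four_block_mat (\<sigma> g * mat_adjoint (\<sigma> g))
        (0\<^sub>m k (n - k)) (0\<^sub>m (n - k) k) (\<tau> g * mat_adjoint (\<tau> g)) =
        four_block_mat (1\<^sub>m k) (0\<^sub>m k (n - k)) (0\<^sub>m (n - k) k) (1\<^sub>m (n - k))"
      using CC[OF g] k by simp
    show "\<sigma> g * mat_adjoint (\<sigma> g) = 1\<^sub>m k"
      by (rule diag_block_cancel(1)[OF eq]) (use blocks in auto)
    show "\<tau> g * mat_adjoint (\<tau> g) = 1\<^sub>m (n - k)"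
      by (rule diag_block_cancel(2)[OF eq]) (use blocks in auto)
  qed
  have us: "unitary_rep G \<sigma>" "unitary_rep G \<tau>"
    unfolding unitary_rep_def dims using \<sigma>c \<tau>c mult unit by auto
  have "mat_adjoint U * \<rho> g = sum_rep \<sigma> \<tau> g * mat_adjoint U" if g: "g \<in> carrier G" for g
  proof -
    have "sum_rep \<sigma> \<tau> g * mat_adjoint U = C g * mat_adjoint U"
      using sum_rep_block[OF us g] Cblock[OF g] dims by simp
    also have "\<dots> = mat_adjoint U * (\<rho> g * (U * mat_adjoint U))"
      unfolding C_def using rc[OF g] Uc Ucc by (simp add: assoc_mult_mat[of _ n n _ n _ n])
    also have "\<dots> = mat_adjoint U * \<rho> g" using UU rc[OF g] by simp
    finally show ?thesis by simp
  qed
  then have "mat_adjoint U \<in> intertwiners G \<rho> (sum_rep \<sigma> \<tau>)"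
    using Ucc k dims by (auto simp: intertwiners_def n_def)
  then have "equivalent_reps G \<rho> (sum_rep \<sigma> \<tau>)"
    by (rule equivalent_repsI[of _ _ _ _ n U]) (use dims k Uc UU in \<open>auto simp: n_def\<close>)
  moreover have "rep_dim G \<sigma> < rep_dim G \<rho>" "rep_dim G \<tau> < rep_dim G \<rho>"
    using k \<open>k \<noteq> 0\<close> \<open>k \<noteq> n\<close> unfolding dims n_def[symmetric] by simp_all
  ultimately show ?thesis using that[OF us] by blast
qed

theorem (in group) complete_reducibility:
  assumes "unitary_rep G \<rho>"
  obtains \<sigma>s where "\<And>\<sigma>. \<sigma> \<in> set \<sigma>s \<Longrightarrow> irreducible_rep G \<sigma>"
    "equivalent_reps G \<rho> (direct_sum_rep \<sigma>s)"
proof -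
  have "\<exists>\<sigma>s. (\<forall>\<sigma>\<in>set \<sigma>s. irreducible_rep G \<sigma>) \<and> equivalent_reps G \<rho> (direct_sum_rep \<sigma>s)"
    using assms
  proof (induction "rep_dim G \<rho>" arbitrary: \<rho> rule: less_induct)
    case less
    consider "rep_dim G \<rho> = 0" | "irreducible_rep G \<rho>"
      | W where "invariant_subspace G \<rho> W"
        "W \<noteq> {0\<^sub>v (rep_dim G \<rho>)}" "W \<noteq> carrier_vec (rep_dim G \<rho>)"
      using less.prems unfolding irreducible_rep_def by blast
    then show ?case
    proof cases
      case 1
      have "0\<^sub>m 0 0 \<in> intertwiners G \<rho> (direct_sum_rep [])"
        using unitary_repD(1)[OF less.prems] 1
        by (fastforce simp: intertwiners_def rep_dim_def direct_sum_rep_def intro!: eq_matI)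
      then have "equivalent_reps G \<rho> (direct_sum_rep [])"
        by (rule equivalent_repsI[of _ _ _ _ 0 "0\<^sub>m 0 0"])
          (use 1 in \<open>auto simp: rep_dim_def direct_sum_rep_def\<close>)
      then show ?thesis by (intro exI[of _ "[]"]) auto
    next
      case 2
      have "direct_sum_rep [\<rho>] = \<rho>"
        unfolding direct_sum_rep_def by (simp del: diag_block_mat.simps)
      then show ?thesis using 2 equivalent_reps_refl[OF less.prems] by (intro exI[of _ "[\<rho>]"]) auto
    next
      case 3
      then obtain \<sigma> \<tau> where u: "unitary_rep G \<sigma>" "unitary_rep G \<tau>"
        and eq: "equivalent_reps G \<rho> (sum_rep \<sigma> \<tau>)"
        and d: "rep_dim G \<sigma> < rep_dim G \<rho>" "rep_dim G \<tau> < rep_dim G \<rho>"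
        using invariant_subspace_splits[OF less.prems] by metis
      obtain \<sigma>s \<tau>s where s: "\<forall>\<sigma>\<in>set \<sigma>s. irreducible_rep G \<sigma>" "equivalent_reps G \<sigma> (direct_sum_rep \<sigma>s)"
        and t: "\<forall>\<sigma>\<in>set \<tau>s. irreducible_rep G \<sigma>" "equivalent_reps G \<tau> (direct_sum_rep \<tau>s)"
        using less.hyps[OF d(1) u(1)] less.hyps[OF d(2) u(2)] by blast
      have us: "unitary_rep G (direct_sum_rep \<sigma>s)" "unitary_rep G (direct_sum_rep \<tau>s)"
        using s(1) t(1) by (auto intro!: unitary_direct_sum_rep simp: irreducible_rep_def)
      have "equivalent_reps G \<rho> (direct_sum_rep (\<sigma>s @ \<tau>s))"
        unfolding direct_sum_rep_append
        by (rule equivalent_reps_trans[OF eq equivalent_sum_rep[OF s(2) t(2) u(1) us(1) u(2) us(2)]])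
          (use less.prems u us unitary_sum_rep in auto)
      then show ?thesis using s t by (intro exI[of _ "\<sigma>s @ \<tau>s"]) auto
    qed
  qed
  then show ?thesis using that by blast
qed

section \<open>Multiplicity-freeness and the commutant\<close>

text \<open>The matrix with the rows of \<open>A\<close> above those of \<open>B\<close>. Writing it as a block matrix with empty
  right-hand blocks makes the product rule for block matrices applicable.\<close>
definition stack :: "complex mat \<Rightarrow> complex mat \<Rightarrow> complex mat" where
  "stack A B = four_block_mat A (0\<^sub>m (dim_row A) 0) B (0\<^sub>m (dim_row B) 0)"

lemma stack_carrier [simp]:
  "A \<in> carrier_mat m k \<Longrightarrow> B \<in> carrier_mat n k \<Longrightarrow> stack A B \<in> carrier_mat (m + n) k"
  unfolding stack_def by auto

lemma as_four_block: "(A :: complex mat) \<in> carrier_mat m k \<Longrightarrow>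
    A = four_block_mat A (0\<^sub>m m 0) (0\<^sub>m 0 k) (0\<^sub>m 0 0)"
  by (intro eq_matI) auto

lemma stack_mult:
  assumes A: "A \<in> carrier_mat m k" and B: "B \<in> carrier_mat n k" and C: "C \<in> carrier_mat k l"
  shows "stack A B * C = stack (A * C) (B * C)"
proof -
  have "stack A B * C = four_block_mat A (0\<^sub>m m 0) B (0\<^sub>m n 0) *
      four_block_mat C (0\<^sub>m k 0) (0\<^sub>m 0 l) (0\<^sub>m 0 0)"
    using A B as_four_block[OF C] by (simp add: stack_def)
  also have "\<dots> = stack (A * C) (B * C)"
    by (subst mult_four_block_mat[of _ m k _ 0 _ n _ _ l _ 0]) (use A B C in \<open>auto simp: stack_def\<close>)
  finally show ?thesis .
qed

lemma diag_block_mult_stack: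
  assumes X: "X \<in> carrier_mat m m" and Y: "Y \<in> carrier_mat n n"
    and A: "A \<in> carrier_mat m k" and B: "B \<in> carrier_mat n k"
  shows "four_block_mat X (0\<^sub>m m n) (0\<^sub>m n m) Y * stack A B = stack (X * A) (Y * B)"
  unfolding stack_def
  by (subst mult_four_block_mat[of _ m m _ n _ n _ _ k _ 0]) (use X Y A B in auto)

lemma adjoint_stack_mult_stack:
  assumes A: "A \<in> carrier_mat m k" and B: "B \<in> carrier_mat n k"
    and C: "C \<in> carrier_mat m l" and D: "D \<in> carrier_mat n l"
  shows "mat_adjoint (stack A B) * stack C D = mat_adjoint A * C + mat_adjoint B * D"
proof -
  have "mat_adjoint (stack A B) =
      four_block_mat (mat_adjoint A) (mat_adjoint B) (0\<^sub>m 0 m) (0\<^sub>m 0 n)"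
    using A B by (intro eq_matI) (auto simp: stack_def)
  moreover have "stack C D = four_block_mat C (0\<^sub>m m 0) D (0\<^sub>m n 0)"
    using C D by (simp add: stack_def)
  ultimately have "mat_adjoint (stack A B) * stack C D =
      four_block_mat (mat_adjoint A) (mat_adjoint B) (0\<^sub>m 0 m) (0\<^sub>m 0 n) *
      four_block_mat C (0\<^sub>m m 0) D (0\<^sub>m n 0)" by simp
  also have "\<dots> = four_block_mat (mat_adjoint A * C + mat_adjoint B * D)
      (0\<^sub>m k 0) (0\<^sub>m 0 l) (0\<^sub>m 0 0)"
    using A B C D
    by (subst mult_four_block_mat[of _ k m _ n _ 0 _ _ l _ 0]) (auto intro!: cong_four_block_mat eq_matI)
  also have "\<dots> = mat_adjoint A * C + mat_adjoint B * D"
    by (rule as_four_block[symmetric]) (use A B C D in auto)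
  finally show ?thesis .
qed

lemma stack_cases:
  assumes Z: "Z \<in> carrier_mat (m + n) k"
  obtains A B where "A \<in> carrier_mat m k" "B \<in> carrier_mat n k" "Z = stack A B"
proof
  let ?A = "mat m k (\<lambda>(i, j). Z $$ (i, j))" and ?B = "mat n k (\<lambda>(i, j). Z $$ (i + m, j))"
  show "?A \<in> carrier_mat m k" "?B \<in> carrier_mat n k" by auto
  show "Z = stack ?A ?B" using Z by (intro eq_matI) (auto simp: stack_def)
qed

text \<open>The inclusions \<open>J i\<close> of the summands; their adjoints are the projections. The last clause
  expresses that the projections jointly separate points, which is the relation
  \<open>\<Sum> J i (J i)\<^sup>* = 1\<close> in a form that avoids sums of matrices.\<close>
lemma (in group) direct_sum_embeddings:
  assumes "\<And>\<sigma>. \<sigma> \<in> set \<sigma>s \<Longrightarrow> unitary_rep G \<sigma>"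
  shows "\<exists>J. (\<forall>i<length \<sigma>s. J i \<in> intertwiners G (\<sigma>s ! i) (direct_sum_rep \<sigma>s)) \<and>
    (\<forall>i<length \<sigma>s. \<forall>j<length \<sigma>s. mat_adjoint (J i) * J j =
       (if i = j then 1\<^sub>m (rep_dim G (\<sigma>s ! i)) else 0\<^sub>m (rep_dim G (\<sigma>s ! i)) (rep_dim G (\<sigma>s ! j)))) \<and>
    (\<forall>k. \<forall>Z\<in>carrier_mat (rep_dim G (direct_sum_rep \<sigma>s)) k.
       (\<forall>i<length \<sigma>s. mat_adjoint (J i) * Z = 0\<^sub>m (rep_dim G (\<sigma>s ! i)) k) \<longrightarrow>
       Z = 0\<^sub>m (rep_dim G (direct_sum_rep \<sigma>s)) k)"
  using assms
proof (induction \<sigma>s)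
  case Nil
  have "Z = 0\<^sub>m 0 k" if "Z \<in> carrier_mat 0 k" for Z :: "complex mat" and k
    using that by (intro eq_matI) auto
  then show ?case by (auto simp: rep_dim_def direct_sum_rep_def)
next
  case (Cons \<sigma> \<sigma>s)
  let ?D = "direct_sum_rep \<sigma>s"
  define d where "d = rep_dim G \<sigma>"
  define N where "N = rep_dim G ?D"
  define e where "e i = rep_dim G (\<sigma>s ! i)" for i
  have u: "unitary_rep G \<sigma>" "unitary_rep G ?D" "\<And>i. i < length \<sigma>s \<Longrightarrow> unitary_rep G (\<sigma>s ! i)"
    using Cons.prems by (auto intro: unitary_direct_sum_rep)
  obtain J where J: "\<And>i. i < length \<sigma>s \<Longrightarrow> J i \<in> intertwiners G (\<sigma>s ! i) ?D"
    and JJ: "\<And>i j. i < length \<sigma>s \<Longrightarrow> j < length \<sigma>s \<Longrightarrow> mat_adjoint (J i) * J j =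
       (if i = j then 1\<^sub>m (e i) else 0\<^sub>m (e i) (e j))"
    and JZ: "\<And>k Z. Z \<in> carrier_mat N k \<Longrightarrow>
       (\<forall>i<length \<sigma>s. mat_adjoint (J i) * Z = 0\<^sub>m (e i) k) \<Longrightarrow> Z = 0\<^sub>m N k"
    using Cons.IH Cons.prems unfolding N_def e_def by (metis list.set_intros(2))
  have Jc: "J i \<in> carrier_mat N (e i)" if "i < length \<sigma>s" for i
    using J[OF that] by (simp add: intertwiners_def N_def e_def)
  have \<sigma>c: "\<sigma> g \<in> carrier_mat d d" and Dc: "?D g \<in> carrier_mat N N" if "g \<in> carrier G" for g
    using unitary_repD(1)[OF u(1) that] unitary_repD(1)[OF u(2) that] by (auto simp: d_def N_def)
  define J' where "J' i = (case i of 0 \<Rightarrow> stack (1\<^sub>m d) (0\<^sub>m N d) | Suc i \<Rightarrow> stack (0\<^sub>m d (e i)) (J i))" for i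
  have J'0: "J' 0 = stack (1\<^sub>m d) (0\<^sub>m N d)" and J'S: "J' (Suc i) = stack (0\<^sub>m d (e i)) (J i)" for i
    by (simp_all add: J'_def)
  have block: "direct_sum_rep (\<sigma> # \<sigma>s) g = four_block_mat (\<sigma> g) (0\<^sub>m d N) (0\<^sub>m N d) (?D g)"
    if "g \<in> carrier G" for g
    unfolding direct_sum_rep_Cons sum_rep_block[OF u(1,2) that] d_def N_def ..
  have dim: "rep_dim G (direct_sum_rep (\<sigma> # \<sigma>s)) = d + N"
    by (simp add: direct_sum_rep_Cons d_def N_def)
  have "J' i \<in> intertwiners G ((\<sigma> # \<sigma>s) ! i) (direct_sum_rep (\<sigma> # \<sigma>s))" if "i < length (\<sigma> # \<sigma>s)" for i
  proof (cases i)
    case 0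
    have "J' 0 * \<sigma> g = direct_sum_rep (\<sigma> # \<sigma>s) g * J' 0" if g: "g \<in> carrier G" for g
      unfolding block[OF g] J'0
      using \<sigma>c[OF g] Dc[OF g]
      by (subst stack_mult[of _ d d _ N _ d]) (auto simp: diag_block_mult_stack[of _ d _ N _ d])
    then show ?thesis using 0 by (simp add: intertwiners_def dim J'0 flip: d_def)
  next
    case (Suc l)
    then have l: "l < length \<sigma>s" using that by simp
    have "J' i * (\<sigma>s ! l) g = direct_sum_rep (\<sigma> # \<sigma>s) g * J' i" if g: "g \<in> carrier G" for g
    proof -
      have c: "(\<sigma>s ! l) g \<in> carrier_mat (e l) (e l)"
        using unitary_repD(1)[OF u(3)[OF l] g] by (simp add: e_def)
      have "J l * (\<sigma>s ! l) g = ?D g * J l" using J[OF l] g by (simp add: intertwiners_def)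
      then show ?thesis
        unfolding block[OF g] Suc J'S using \<sigma>c[OF g] Dc[OF g] Jc[OF l] c
        by (subst stack_mult[of _ d "e l" _ N _ "e l"]) (auto simp: diag_block_mult_stack[of _ d _ N _ "e l"])
    qed
    then show ?thesis using Suc Jc[OF l] by (simp add: intertwiners_def dim J'S flip: e_def)
  qed
  moreover have "mat_adjoint (J' i) * J' j =
       (if i = j then 1\<^sub>m (rep_dim G ((\<sigma> # \<sigma>s) ! i))
        else 0\<^sub>m (rep_dim G ((\<sigma> # \<sigma>s) ! i)) (rep_dim G ((\<sigma> # \<sigma>s) ! j)))"
    if ij: "i < length (\<sigma> # \<sigma>s)" "j < length (\<sigma> # \<sigma>s)" for i j
  proof -
    consider "i = 0" "j = 0" | j' where "i = 0" "j = Suc j'" "j' < length \<sigma>s"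
      | i' where "i = Suc i'" "j = 0" "i' < length \<sigma>s"
      | i' j' where "i = Suc i'" "j = Suc j'" "i' < length \<sigma>s" "j' < length \<sigma>s"
      using ij by (cases i; cases j) auto
    then show ?thesis
    proof cases
      case 1
      then show ?thesis
        by (simp add: J'0 adjoint_stack_mult_stack[of _ d d _ N _ d] flip: d_def)
    next
      case 2
      then show ?thesis using Jc[OF 2(3)]
        by (simp add: J'0 J'S adjoint_stack_mult_stack[of _ d d _ N _ "e j'"] flip: d_def e_def)
    next
      case 3
      then show ?thesis using Jc[OF 3(3)]
        by (simp add: J'0 J'S adjoint_stack_mult_stack[of _ d "e i'" _ N _ d] flip: d_def e_def)
    next
      case 4
      then show ?thesis using Jc[OF 4(3)] Jc[OF 4(4)] JJ[OF 4(3,4)]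
        by (simp add: J'S adjoint_stack_mult_stack[of _ d "e i'" _ N _ "e j'"] flip: e_def)
    qed
  qed
  moreover have "Z = 0\<^sub>m (rep_dim G (direct_sum_rep (\<sigma> # \<sigma>s))) k"
    if Z: "Z \<in> carrier_mat (rep_dim G (direct_sum_rep (\<sigma> # \<sigma>s))) k"
      and 0: "\<forall>i<length (\<sigma> # \<sigma>s). mat_adjoint (J' i) * Z = 0\<^sub>m (rep_dim G ((\<sigma> # \<sigma>s) ! i)) k" for k Z
  proof -
    obtain A B where A: "A \<in> carrier_mat d k" and B: "B \<in> carrier_mat N k" and ZAB: "Z = stack A B"
      using stack_cases[of Z d N k] Z unfolding dim by metis
    have "mat_adjoint (J' 0) * Z = 0\<^sub>m d k" using 0 by (auto simp: d_def)
    then have "A = 0\<^sub>m d k" unfolding J'0 ZAB using A B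
      by (simp add: adjoint_stack_mult_stack[of _ d d _ N _ k])
    have "mat_adjoint (J i) * B = 0\<^sub>m (e i) k" if i: "i < length \<sigma>s" for i
    proof -
      have "mat_adjoint (J' (Suc i)) * Z = 0\<^sub>m (e i) k" using 0 i by (auto simp: e_def)
      moreover have "mat_adjoint (J i) * B \<in> carrier_mat (e i) k" using Jc[OF i] B by auto
      ultimately show ?thesis unfolding J'S ZAB using A B Jc[OF i]
        by (simp add: adjoint_stack_mult_stack[of _ d "e i" _ N _ k] del: mult_carrier_mat)
    qed
    then have "B = 0\<^sub>m N k" using JZ[OF B] by blast
    then show ?thesis unfolding ZAB dim \<open>A = 0\<^sub>m d k\<close>
      by (intro eq_matI) (auto simp: stack_def)
  qed
  ultimately show ?case by blast
qed

definition commuting :: "complex mat set \<Rightarrow> bool" where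
  "commuting M \<longleftrightarrow> (\<forall>X\<in>M. \<forall>Y\<in>M. X * Y = Y * X)"

text \<open>Conjugation by an invertible intertwiner is an isomorphism of the commutants.\<close>
lemma commuting_commutant_equivalent:
  assumes eq: "equivalent_reps G \<rho> \<sigma>" and u: "unitary_rep G \<rho>" "unitary_rep G \<sigma>"
    and c: "commuting (commutant G \<rho>)"
  shows "commuting (commutant G \<sigma>)"
  unfolding commuting_def
proof (intro ballI)
  fix X Y assume XY: "X \<in> commutant G \<sigma>" "Y \<in> commutant G \<sigma>"
  obtain n T S where a: "rep_dim G \<rho> = n" "rep_dim G \<sigma> = n"
    "T \<in> carrier_mat n n" "S \<in> carrier_mat n n" "T * S = 1\<^sub>m n"
    and TS: "T \<in> intertwiners G \<rho> \<sigma>" "S \<in> intertwiners G \<sigma> \<rho>"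
    using equivalent_repsE[OF eq u] by metis
  have carr: "X \<in> carrier_mat n n" "Y \<in> carrier_mat n n" using XY a by (auto simp: intertwiners_def)
  have conj: "S * (Z * T) \<in> commutant G \<rho>" if "Z \<in> commutant G \<sigma>" for Z
    by (rule intertwiners_mult[OF u(1,2,1) intertwiners_mult[OF u(1,2,2) TS(1) that] TS(2)])
  have prod: "T * (S * (A * T) * (S * (B * T))) * S = A * B"
    if A: "A \<in> carrier_mat n n" and B: "B \<in> carrier_mat n n" for A B
  proof -
    have "T * (S * (A * T) * (S * (B * T))) * S = (T * S) * A * (T * S) * B * (T * S)"
      using a(3,4) A B by (simp add: assoc_mult_mat[of _ n n _ n _ n])
    then show ?thesis using a A B by simp
  qed
  have "S * (X * T) * (S * (Y * T)) = S * (Y * T) * (S * (X * T))"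
    using c conj XY unfolding commuting_def by blast
  then show "X * Y = Y * X" using prod[OF carr] prod[OF carr(2,1)] by simp
qed

text \<open>If the summands are inequivalent, Schur's lemma shows that every element of the commutant acts
  as a scalar on each of them. Conversely, if the distinct summands \<open>i\<close> and \<open>j\<close> were equivalent by
  \<open>A\<close>, then the projection \<open>T\<close> onto summand \<open>i\<close> and the operator \<open>S\<close> that carries summand \<open>i\<close> to \<open>j\<close>
  by \<open>A\<close> would lie in the commutant and satisfy \<open>S T = S\<close> but \<open>T S = 0\<close>.\<close>
theorem (in group) multiplicity_free_iff_commuting_commutant:
  assumes u: "unitary_rep G \<rho>"
  shows "multiplicity_free G \<rho> \<longleftrightarrow> commuting (commutant G \<rho>)"
proof
  assume "multiplicity_free G \<rho>"
  then obtain \<sigma>s where irr: "\<forall>\<sigma>\<in>set \<sigma>s. irreducible_rep G \<sigma>"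
    and ineq: "\<forall>i<length \<sigma>s. \<forall>j<length \<sigma>s. i \<noteq> j \<longrightarrow> \<not> equivalent_reps G (\<sigma>s ! i) (\<sigma>s ! j)"
    and eq: "equivalent_reps G \<rho> (direct_sum_rep \<sigma>s)"
    unfolding multiplicity_free_def by blast
  let ?D = "direct_sum_rep \<sigma>s"
  define N where "N = rep_dim G ?D"
  define e where "e i = rep_dim G (\<sigma>s ! i)" for i
  have us: "\<And>\<sigma>. \<sigma> \<in> set \<sigma>s \<Longrightarrow> unitary_rep G \<sigma>" using irr by (auto simp: irreducible_rep_def)
  then have ui: "\<And>i. i < length \<sigma>s \<Longrightarrow> unitary_rep G (\<sigma>s ! i)" by auto
  have uD: "unitary_rep G ?D" using us by (rule unitary_direct_sum_rep)
  obtain J where J: "\<And>i. i < length \<sigma>s \<Longrightarrow> J i \<in> intertwiners G (\<sigma>s ! i) ?D"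
    and JJ: "\<And>i j. i < length \<sigma>s \<Longrightarrow> j < length \<sigma>s \<Longrightarrow> mat_adjoint (J i) * J j =
       (if i = j then 1\<^sub>m (e i) else 0\<^sub>m (e i) (e j))"
    and JZ: "\<And>k Z. Z \<in> carrier_mat N k \<Longrightarrow>
       (\<forall>i<length \<sigma>s. mat_adjoint (J i) * Z = 0\<^sub>m (e i) k) \<Longrightarrow> Z = 0\<^sub>m N k"
    using direct_sum_embeddings[OF us] unfolding N_def e_def by metis
  have Jc: "J i \<in> carrier_mat N (e i)" if "i < length \<sigma>s" for i
    using J[OF that] by (simp add: intertwiners_def N_def e_def)
  have scal: "\<exists>c. X * J j = c \<cdot>\<^sub>m J j" if X: "X \<in> commutant G ?D" and j: "j < length \<sigma>s" for X j
  proof -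
    have Xc: "X \<in> carrier_mat N N" using X by (auto simp: intertwiners_def N_def)
    have XJc: "X * J j \<in> carrier_mat N (e j)" using Xc Jc[OF j] by auto
    have P: "mat_adjoint (J i) * (X * J j) \<in> intertwiners G (\<sigma>s ! j) (\<sigma>s ! i)" if i: "i < length \<sigma>s" for i
      by (rule intertwiners_mult[OF ui[OF j] uD ui[OF i]
          intertwiners_mult[OF ui[OF j] uD uD J[OF j] X] intertwiners_adjoint[OF ui[OF i] uD J[OF i]]])
    obtain c where c: "mat_adjoint (J j) * (X * J j) = c \<cdot>\<^sub>m 1\<^sub>m (e j)"
      using schur_lemma_scalar[OF _ P[OF j]] irr j unfolding e_def by (metis nth_mem)
    have P0: "mat_adjoint (J i) * (X * J j) = 0\<^sub>m (e i) (e j)" if i: "i < length \<sigma>s" "i \<noteq> j" for i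
      using schur_lemma[OF _ _ P[OF i(1)]] irr ineq i j unfolding e_def by (metis nth_mem)
    define Z where "Z = X * J j - c \<cdot>\<^sub>m J j"
    have Zc: "Z \<in> carrier_mat N (e j)" using Jc[OF j] by (auto simp: Z_def)
    have "mat_adjoint (J i) * Z = 0\<^sub>m (e i) (e j)" if i: "i < length \<sigma>s" for i
    proof -
      have "mat_adjoint (J i) * Z = mat_adjoint (J i) * (X * J j) - c \<cdot>\<^sub>m (mat_adjoint (J i) * J j)"
        unfolding Z_def using Jc[OF i] Jc[OF j] XJc
        by (simp add: mult_minus_distrib_mat[of _ "e i" N] mult_smult_distrib[of _ "e i" N])
      then show ?thesis using c P0[OF i] JJ[OF i j] by (cases "i = j") auto
    qed
    then have "Z = 0\<^sub>m N (e j)" using JZ[OF Zc] by blast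
    have "X * J j = c \<cdot>\<^sub>m J j"
    proof (intro eq_matI)
      fix a b assume "a < dim_row (c \<cdot>\<^sub>m J j)" "b < dim_col (c \<cdot>\<^sub>m J j)"
      then show "(X * J j) $$ (a, b) = (c \<cdot>\<^sub>m J j) $$ (a, b)"
        using arg_cong[OF \<open>Z = 0\<^sub>m N (e j)\<close>, of "\<lambda>M. M $$ (a, b)"] Jc[OF j] XJc
        by (simp add: Z_def del: index_mult_mat)
    qed (use XJc Jc[OF j] in auto)
    then show ?thesis by blast
  qed
  have "commuting (commutant G ?D)"
    unfolding commuting_def
  proof (intro ballI)
    fix X Y assume XY: "X \<in> commutant G ?D" "Y \<in> commutant G ?D"
    have Xc: "X \<in> carrier_mat N N" and Yc: "Y \<in> carrier_mat N N"
      using XY by (auto simp: intertwiners_def N_def)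
    \<comment> \<open>Both products act on summand \<open>j\<close> by the same scalar, so \<open>W\<close> kills every inclusion. The separation property is about projections, hence the passage to the adjoint.\<close>
    define W where "W = X * Y - Y * X"
    have Wc: "W \<in> carrier_mat N N" using Xc Yc by (auto simp: W_def)
    have "mat_adjoint (J j) * mat_adjoint W = 0\<^sub>m (e j) N" if j: "j < length \<sigma>s" for j
    proof -
      obtain c d where cd: "X * J j = c \<cdot>\<^sub>m J j" "Y * J j = d \<cdot>\<^sub>m J j" using scal XY j by metis
      have "W * J j = X * (Y * J j) - Y * (X * J j)"
        unfolding W_def using Xc Yc Jc[OF j]
        by (simp add: minus_mult_distrib_mat[of _ N N] assoc_mult_mat[of _ N N _ N _ "e j"])
      also have "\<dots> = 0\<^sub>m N (e j)"
        using Jc[OF j] Xc Yc cd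
        by (intro eq_matI) (auto simp: mult_smult_distrib[of _ N N _ "e j"] simp del: index_mult_mat(1))
      finally have "mat_adjoint (W * J j) = 0\<^sub>m (e j) N" by simp
      then show ?thesis using mat_adjoint_mult[OF Wc Jc[OF j]] by simp
    qed
    then have "mat_adjoint W = 0\<^sub>m N N" using JZ[of "mat_adjoint W" N] Wc by auto
    then have "mat_adjoint (mat_adjoint W) = 0\<^sub>m N N" by simp
    then have W0: "W = 0\<^sub>m N N" by simp
    show "X * Y = Y * X"
    proof (intro eq_matI)
      fix a b assume "a < dim_row (Y * X)" "b < dim_col (Y * X)"
      then show "(X * Y) $$ (a, b) = (Y * X) $$ (a, b)"
        using arg_cong[OF W0, of "\<lambda>M. M $$ (a, b)"] Xc Yc
        by (simp add: W_def del: index_mult_mat(1))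
    qed (use Xc Yc in auto)
  qed
  then show "commuting (commutant G \<rho>)"
    by (rule commuting_commutant_equivalent[OF equivalent_reps_sym[OF eq u uD] uD u])
next
  assume comm: "commuting (commutant G \<rho>)"
  obtain \<sigma>s where irr: "\<And>\<sigma>. \<sigma> \<in> set \<sigma>s \<Longrightarrow> irreducible_rep G \<sigma>"
    and eq: "equivalent_reps G \<rho> (direct_sum_rep \<sigma>s)"
    using complete_reducibility[OF u] by blast
  let ?D = "direct_sum_rep \<sigma>s"
  define N where "N = rep_dim G ?D"
  define e where "e i = rep_dim G (\<sigma>s ! i)" for i
  have us: "\<And>\<sigma>. \<sigma> \<in> set \<sigma>s \<Longrightarrow> unitary_rep G \<sigma>" using irr by (auto simp: irreducible_rep_def)
  then have ui: "\<And>i. i < length \<sigma>s \<Longrightarrow> unitary_rep G (\<sigma>s ! i)" by auto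
  have uD: "unitary_rep G ?D" using us by (rule unitary_direct_sum_rep)
  have commD: "commuting (commutant G ?D)"
    by (rule commuting_commutant_equivalent[OF eq u uD comm])
  obtain J where J: "\<And>i. i < length \<sigma>s \<Longrightarrow> J i \<in> intertwiners G (\<sigma>s ! i) ?D"
    and JJ: "\<And>i j. i < length \<sigma>s \<Longrightarrow> j < length \<sigma>s \<Longrightarrow> mat_adjoint (J i) * J j =
       (if i = j then 1\<^sub>m (e i) else 0\<^sub>m (e i) (e j))"
    using direct_sum_embeddings[OF us] unfolding N_def e_def by metis
  have Jc: "J i \<in> carrier_mat N (e i)" if "i < length \<sigma>s" for i
    using J[OF that] by (simp add: intertwiners_def N_def e_def)
  have "\<not> equivalent_reps G (\<sigma>s ! i) (\<sigma>s ! j)" if i: "i < length \<sigma>s" and j: "j < length \<sigma>s" and "i \<noteq> j" for i j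
  proof
    assume "equivalent_reps G (\<sigma>s ! i) (\<sigma>s ! j)"
    then obtain n A B where n: "e i = n" "e j = n" and A: "A \<in> carrier_mat n n" "B \<in> carrier_mat n n" "A * B = 1\<^sub>m n"
      and AI: "A \<in> intertwiners G (\<sigma>s ! i) (\<sigma>s ! j)"
      using equivalent_repsE[OF _ ui[OF i] ui[OF j]] unfolding e_def by metis
    have Pi: "mat_adjoint (J i) \<in> intertwiners G ?D (\<sigma>s ! i)"
      by (rule intertwiners_adjoint[OF ui[OF i] uD J[OF i]])
    have c: "J i \<in> carrier_mat N n" "J j \<in> carrier_mat N n"
      "mat_adjoint (J i) \<in> carrier_mat n N" "mat_adjoint (J j) \<in> carrier_mat n N"
      using Jc[OF i] Jc[OF j] n by auto
    define S where "S = J j * (A * mat_adjoint (J i))"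
    define T where "T = J i * mat_adjoint (J i)"
    have SI: "S \<in> commutant G ?D"
      unfolding S_def by (rule intertwiners_mult[OF uD ui[OF j] uD intertwiners_mult[OF uD ui[OF i] ui[OF j] Pi AI] J[OF j]])
    have TI: "T \<in> commutant G ?D"
      unfolding T_def by (rule intertwiners_mult[OF uD ui[OF i] uD Pi J[OF i]])
    have c2: "A * mat_adjoint (J i) \<in> carrier_mat n N" using A c by auto
    have Sc: "S \<in> carrier_mat N N" and Tc: "T \<in> carrier_mat N N" using c c2 by (auto simp: S_def T_def)
    have "S * T = J j * (A * mat_adjoint (J i) * T)"
      unfolding S_def by (rule assoc_mult_mat) (use c c2 Tc in auto)
    also have "A * mat_adjoint (J i) * T = A * (mat_adjoint (J i) * T)"
      by (rule assoc_mult_mat) (use A c Tc in auto)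
    also have "mat_adjoint (J i) * T = (mat_adjoint (J i) * J i) * mat_adjoint (J i)"
      unfolding T_def by (rule assoc_mult_mat[symmetric]) (use c in auto)
    finally have "S * T = S" using JJ[OF i i] n c by (simp add: S_def)
    have "T * S = J i * (mat_adjoint (J i) * S)"
      unfolding T_def by (rule assoc_mult_mat) (use c Sc in auto)
    also have "mat_adjoint (J i) * S = (mat_adjoint (J i) * J j) * (A * mat_adjoint (J i))"
      unfolding S_def by (rule assoc_mult_mat[symmetric]) (use c c2 in auto)
    finally have "T * S = 0\<^sub>m N N" using JJ[OF i j] \<open>i \<noteq> j\<close> n
        left_mult_zero_mat[OF c2] right_mult_zero_mat[OF c(1)] by simp
    then have "S = 0\<^sub>m N N" using \<open>S * T = S\<close> commD SI TI unfolding commuting_def by metis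
    have "mat_adjoint (J j) * S = (mat_adjoint (J j) * J j) * (A * mat_adjoint (J i))"
      unfolding S_def by (rule assoc_mult_mat[symmetric]) (use c c2 in auto)
    then have "A * mat_adjoint (J i) = 0\<^sub>m n N" using \<open>S = 0\<^sub>m N N\<close> JJ[OF j j] n
        left_mult_one_mat[OF c2] right_mult_zero_mat[OF c(4)] by simp
    moreover have "A * mat_adjoint (J i) * J i = A * (mat_adjoint (J i) * J i)"
      by (rule assoc_mult_mat) (use A c in auto)
    ultimately have "A = 0\<^sub>m n n" using JJ[OF i i] n c A by simp
    then have "1\<^sub>m n = (0\<^sub>m n n :: complex mat)" using A by simp
    then have "(1\<^sub>m n :: complex mat) $$ (0, 0) = (0\<^sub>m n n :: complex mat) $$ (0, 0)"
      by (rule arg_cong)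
    moreover have "n \<noteq> 0" using irr[of "\<sigma>s ! i"] i n by (simp add: irreducible_rep_def e_def)
    ultimately show False by simp
  qed
  then show "multiplicity_free G \<rho>"
    unfolding multiplicity_free_def using irr eq by blast
qed

section \<open>Fourier coefficients\<close>

text \<open>The operator \<open>\<Sum> f(g) \<rho>(g)\<close>, given by its entries.\<close>
definition fourier ::
  "('g, 'b) monoid_scheme \<Rightarrow> ('g \<Rightarrow> complex) \<Rightarrow> ('g \<Rightarrow> complex mat) \<Rightarrow> complex mat" where
  "fourier G f \<rho> = mat (rep_dim G \<rho>) (rep_dim G \<rho>) (\<lambda>(i, j). \<Sum>g\<in>carrier G. f g * \<rho> g $$ (i, j))"

lemma fourier_carrier [simp]: "fourier G f \<rho> \<in> carrier_mat (rep_dim G \<rho>) (rep_dim G \<rho>)"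
  by (simp add: fourier_def)

lemma mult_fourier:
  assumes u: "unitary_rep G \<rho>" and X: "X \<in> carrier_mat m (rep_dim G \<rho>)"
    and i: "i < m" and j: "j < rep_dim G \<rho>"
  shows "(X * fourier G f \<rho>) $$ (i, j) = (\<Sum>g\<in>carrier G. f g * (X * \<rho> g) $$ (i, j))"
proof -
  let ?n = "rep_dim G \<rho>"
  have "(X * fourier G f \<rho>) $$ (i, j) = (\<Sum>k<?n. X $$ (i, k) * (\<Sum>g\<in>carrier G. f g * \<rho> g $$ (k, j)))"
    using j by (subst index_mult_mat_sum[OF X fourier_carrier i j]) (simp add: fourier_def)
  also have "\<dots> = (\<Sum>k<?n. \<Sum>g\<in>carrier G. f g * (X $$ (i, k) * \<rho> g $$ (k, j)))"
    by (simp add: sum_distrib_left mult_ac)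
  also have "\<dots> = (\<Sum>g\<in>carrier G. \<Sum>k<?n. f g * (X $$ (i, k) * \<rho> g $$ (k, j)))"
    by (rule sum.swap)
  also have "\<dots> = (\<Sum>g\<in>carrier G. f g * (X * \<rho> g) $$ (i, j))"
    by (intro sum.cong refl, subst index_mult_mat_sum[OF X unitary_repD(1)[OF u] i j])
      (simp_all add: sum_distrib_left)
  finally show ?thesis .
qed

lemma fourier_mult:
  assumes u: "unitary_rep G \<rho>" and X: "X \<in> carrier_mat (rep_dim G \<rho>) m"
    and i: "i < rep_dim G \<rho>" and j: "j < m"
  shows "(fourier G f \<rho> * X) $$ (i, j) = (\<Sum>g\<in>carrier G. f g * (\<rho> g * X) $$ (i, j))"
proof -
  let ?n = "rep_dim G \<rho>"
  have "(fourier G f \<rho> * X) $$ (i, j) = (\<Sum>k<?n. (\<Sum>g\<in>carrier G. f g * \<rho> g $$ (i, k)) * X $$ (k, j))"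
    using i by (subst index_mult_mat_sum[OF fourier_carrier X i j]) (simp add: fourier_def)
  also have "\<dots> = (\<Sum>k<?n. \<Sum>g\<in>carrier G. f g * (\<rho> g $$ (i, k) * X $$ (k, j)))"
    by (simp add: sum_distrib_left mult_ac)
  also have "\<dots> = (\<Sum>g\<in>carrier G. \<Sum>k<?n. f g * (\<rho> g $$ (i, k) * X $$ (k, j)))"
    by (rule sum.swap)
  also have "\<dots> = (\<Sum>g\<in>carrier G. f g * (\<rho> g * X) $$ (i, j))"
    by (intro sum.cong refl, subst index_mult_mat_sum[OF unitary_repD(1)[OF u] X i j])
      (simp_all add: sum_distrib_left)
  finally show ?thesis .
qed

text \<open>Each summand of the operator is intertwined. This is how vanishing of the Fourier coefficient
  passes to equivalent representations and to direct sums.\<close>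
lemma intertwiner_fourier:
  assumes u: "unitary_rep G \<rho>" "unitary_rep G \<sigma>" and X: "X \<in> intertwiners G \<rho> \<sigma>"
  shows "X * fourier G f \<rho> = fourier G f \<sigma> * X"
proof -
  have Xc: "X \<in> carrier_mat (rep_dim G \<sigma>) (rep_dim G \<rho>)" using X by (simp add: intertwiners_def)
  show ?thesis
  proof (intro eq_matI)
    fix i j assume "i < dim_row (fourier G f \<sigma> * X)" "j < dim_col (fourier G f \<sigma> * X)"
    then have i: "i < rep_dim G \<sigma>" and j: "j < rep_dim G \<rho>" using Xc by (auto simp: fourier_def)
    show "(X * fourier G f \<rho>) $$ (i, j) = (fourier G f \<sigma> * X) $$ (i, j)"
      unfolding mult_fourier[OF u(1) Xc i j] fourier_mult[OF u(2) Xc i j]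
      using X by (intro sum.cong refl) (simp add: intertwiners_def)
  qed (use Xc in \<open>auto simp: fourier_def\<close>)
qed

lemma (in group) sum_left_translate:
  assumes "h \<in> carrier G"
  shows "(\<Sum>g\<in>carrier G. f (h \<otimes> g)) = (\<Sum>g\<in>carrier G. f g)"
  by (rule sum.reindex_bij_witness[of _ "\<lambda>g. inv h \<otimes> g" "\<lambda>g. h \<otimes> g"])
    (use assms in \<open>auto simp: m_assoc[symmetric]\<close>)

lemma (in group) fourier_convolution:
  assumes u: "unitary_rep G \<rho>"
  shows "fourier G (convolution G f1 f2) \<rho> = fourier G f1 \<rho> * fourier G f2 \<rho>"
proof (intro eq_matI)
  let ?n = "rep_dim G \<rho>"
  fix i j assume "i < dim_row (fourier G f1 \<rho> * fourier G f2 \<rho>)" "j < dim_col (fourier G f1 \<rho> * fourier G f2 \<rho>)"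
  then have ij: "i < ?n" "j < ?n" by (auto simp: fourier_def)
  have "fourier G (convolution G f1 f2) \<rho> $$ (i, j) =
      (\<Sum>g\<in>carrier G. (\<Sum>h\<in>carrier G. f1 h * f2 (inv h \<otimes> g)) * \<rho> g $$ (i, j))"
    using ij by (simp add: fourier_def convolution_def)
  also have "\<dots> = (\<Sum>h\<in>carrier G. \<Sum>g\<in>carrier G. f1 h * f2 (inv h \<otimes> g) * \<rho> g $$ (i, j))"
    by (subst sum.swap) (simp add: sum_distrib_right)
  also have "\<dots> = (\<Sum>h\<in>carrier G. f1 h * (\<rho> h * fourier G f2 \<rho>) $$ (i, j))"
  proof (intro sum.cong refl)
    fix h assume h: "h \<in> carrier G"
    have "(\<Sum>g\<in>carrier G. f1 h * f2 (inv h \<otimes> g) * \<rho> g $$ (i, j)) =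
        (\<Sum>g\<in>carrier G. f1 h * f2 (inv h \<otimes> (h \<otimes> g)) * \<rho> (h \<otimes> g) $$ (i, j))"
      by (rule sum_left_translate[OF h, symmetric])
    also have "\<dots> = (\<Sum>g\<in>carrier G. f1 h * (f2 g * (\<rho> h * \<rho> g) $$ (i, j)))"
      using h unitary_repD(4)[OF u h] by (intro sum.cong refl) (simp add: m_assoc[symmetric])
    also have "\<dots> = f1 h * (\<rho> h * fourier G f2 \<rho>) $$ (i, j)"
      using mult_fourier[OF u unitary_repD(1)[OF u h] ij] by (simp only: sum_distrib_left)
    finally show "(\<Sum>g\<in>carrier G. f1 h * f2 (inv h \<otimes> g) * \<rho> g $$ (i, j)) =
        f1 h * (\<rho> h * fourier G f2 \<rho>) $$ (i, j)" .
  qed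
  also have "\<dots> = (fourier G f1 \<rho> * fourier G f2 \<rho>) $$ (i, j)"
    by (rule fourier_mult[OF u fourier_carrier ij, symmetric])
  finally show "fourier G (convolution G f1 f2) \<rho> $$ (i, j) = (fourier G f1 \<rho> * fourier G f2 \<rho>) $$ (i, j)" .
qed (auto simp: fourier_def)

section \<open>Orthogonality and completeness of matrix coefficients\<close>

text \<open>The orthogonality relations as a property of a representation, so that they pass
  from two factors to their outer tensor product by multiplying two sums.\<close>
definition schur_orthogonal :: "('g, 'b) monoid_scheme \<Rightarrow> ('g \<Rightarrow> complex mat) \<Rightarrow> bool" where
  "schur_orthogonal G \<rho> \<longleftrightarrow> (\<forall>i<rep_dim G \<rho>. \<forall>j<rep_dim G \<rho>. \<forall>k<rep_dim G \<rho>. \<forall>l<rep_dim G \<rho>.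
     (\<Sum>g\<in>carrier G. \<rho> g $$ (i, k) * cnj (\<rho> g $$ (j, l))) =
     (if i = j \<and> k = l then of_nat (card (carrier G)) / of_nat (rep_dim G \<rho>) else 0))"

text \<open>For fixed \<open>k\<close> and \<open>l\<close> the sums form the matrix \<open>\<Sum> \<rho>(g) E \<rho>(g)\<^sup>*\<close> with the elementary
  matrix \<open>E\<close> in position \<open>(k, l)\<close>. Averaging puts it in the commutant, so it is a scalar by Schur's
  lemma, and its trace determines the scalar.\<close>
lemma (in group) irreducible_schur_orthogonal:
  assumes irr: "irreducible_rep G \<rho>"
  shows "schur_orthogonal G \<rho>"
  unfolding schur_orthogonal_def
proof (intro allI impI)
  let ?n = "rep_dim G \<rho>"
  fix i j k l assume ij: "i < ?n" "j < ?n" and kl: "k < ?n" "l < ?n"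
  have u: "unitary_rep G \<rho>" using irr by (simp add: irreducible_rep_def)
  define M where "M = mat ?n ?n (\<lambda>(a, b). \<Sum>g\<in>carrier G. \<rho> g $$ (a, k) * cnj (\<rho> g $$ (b, l)))"
  have Mc: "M \<in> carrier_mat ?n ?n" by (simp add: M_def)
  have "M * \<rho> h = \<rho> h * M" if h: "h \<in> carrier G" for h
  proof (intro eq_matI)
    note rh = unitary_repD(1)[OF u h]
    fix a b assume "a < dim_row (\<rho> h * M)" "b < dim_col (\<rho> h * M)"
    then have ab: "a < ?n" "b < ?n" using rh Mc by auto
    have "(M * \<rho> h) $$ (a, b) =
        (\<Sum>c<?n. \<Sum>g\<in>carrier G. \<rho> g $$ (a, k) * cnj (\<rho> g $$ (c, l)) * \<rho> h $$ (c, b))"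
      using ab by (subst index_mult_mat_sum[OF Mc rh ab]) (simp add: M_def sum_distrib_right)
    also have "\<dots> = (\<Sum>g\<in>carrier G. \<Sum>c<?n. \<rho> g $$ (a, k) * cnj (\<rho> g $$ (c, l)) * \<rho> h $$ (c, b))"
      by (rule sum.swap)
    also have "\<dots> = (\<Sum>g\<in>carrier G. \<rho> g $$ (a, k) * cnj (\<rho> (inv h \<otimes> g) $$ (b, l)))"
    proof (intro sum.cong refl)
      fix g assume g: "g \<in> carrier G"
      have "\<rho> (inv h \<otimes> g) $$ (b, l) = (mat_adjoint (\<rho> h) * \<rho> g) $$ (b, l)"
        using unitary_repD(4)[OF u inv_closed[OF h] g] unitary_rep_inv[OF u h] by simp
      also have "\<dots> = (\<Sum>c<?n. cnj (\<rho> h $$ (c, b)) * \<rho> g $$ (c, l))"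
        using rh ab by (subst index_mult_mat_sum[OF mat_adjoint_carrier[OF rh] unitary_repD(1)[OF u g] ab(2) kl(2)]) auto
      finally show "(\<Sum>c<?n. \<rho> g $$ (a, k) * cnj (\<rho> g $$ (c, l)) * \<rho> h $$ (c, b)) =
          \<rho> g $$ (a, k) * cnj (\<rho> (inv h \<otimes> g) $$ (b, l))"
        by (simp add: sum_distrib_left mult_ac)
    qed
    also have "\<dots> = (\<Sum>g\<in>carrier G. \<rho> (h \<otimes> g) $$ (a, k) * cnj (\<rho> (inv h \<otimes> (h \<otimes> g)) $$ (b, l)))"
      by (rule sum_left_translate[OF h, symmetric])
    also have "\<dots> = (\<Sum>g\<in>carrier G. \<Sum>c<?n. \<rho> h $$ (a, c) * (\<rho> g $$ (c, k) * cnj (\<rho> g $$ (b, l))))"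
    proof (intro sum.cong refl)
      fix g assume g: "g \<in> carrier G"
      have "\<rho> (h \<otimes> g) $$ (a, k) = (\<Sum>c<?n. \<rho> h $$ (a, c) * \<rho> g $$ (c, k))"
        unfolding unitary_repD(4)[OF u h g] by (rule index_mult_mat_sum[OF rh unitary_repD(1)[OF u g] ab(1) kl(1)])
      moreover have "inv h \<otimes> (h \<otimes> g) = g" using g h by (simp add: m_assoc[symmetric])
      ultimately show "\<rho> (h \<otimes> g) $$ (a, k) * cnj (\<rho> (inv h \<otimes> (h \<otimes> g)) $$ (b, l)) =
          (\<Sum>c<?n. \<rho> h $$ (a, c) * (\<rho> g $$ (c, k) * cnj (\<rho> g $$ (b, l))))"
        by (simp add: sum_distrib_left mult_ac)
    qed
    also have "\<dots> = (\<Sum>c<?n. \<Sum>g\<in>carrier G. \<rho> h $$ (a, c) * (\<rho> g $$ (c, k) * cnj (\<rho> g $$ (b, l))))"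
      by (rule sum.swap)
    also have "\<dots> = (\<rho> h * M) $$ (a, b)"
      using ab by (subst index_mult_mat_sum[OF rh Mc ab]) (simp add: M_def sum_distrib_left)
    finally show "(M * \<rho> h) $$ (a, b) = (\<rho> h * M) $$ (a, b)" .
  qed (use unitary_repD(1)[OF u h] Mc in auto)
  then have "M \<in> commutant G \<rho>" using Mc by (simp add: intertwiners_def)
  then obtain c where c: "M = c \<cdot>\<^sub>m 1\<^sub>m ?n" using schur_lemma_scalar[OF irr] by blast
  have "of_nat ?n * c = (\<Sum>a<?n. M $$ (a, a))" by (simp add: c)
  also have "\<dots> = (\<Sum>g\<in>carrier G. \<Sum>a<?n. \<rho> g $$ (a, k) * cnj (\<rho> g $$ (a, l)))"
    by (subst sum.swap) (simp add: M_def)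
  also have "\<dots> = (\<Sum>g\<in>carrier G. if k = l then 1 else 0)"
  proof (intro sum.cong refl)
    fix g assume g: "g \<in> carrier G"
    note r = unitary_repD[OF u g]
    have "(mat_adjoint (\<rho> g) * \<rho> g) $$ (l, k) = (\<Sum>a<?n. cnj (\<rho> g $$ (a, l)) * \<rho> g $$ (a, k))"
      using r(1) kl by (subst index_mult_mat_sum[OF mat_adjoint_carrier[OF r(1)] r(1) kl(2,1)]) auto
    then show "(\<Sum>a<?n. \<rho> g $$ (a, k) * cnj (\<rho> g $$ (a, l))) = (if k = l then 1 else 0)"
      using r(3) kl by (auto simp: mult.commute)
  qed
  also have "\<dots> = (if k = l then of_nat (card (carrier G)) else 0)" by simp
  finally have nc: "of_nat ?n * c = (if k = l then of_nat (card (carrier G)) else 0)" .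
  have "?n \<noteq> 0" using ij by auto
  then have "c = (if k = l then of_nat (card (carrier G)) / of_nat ?n else 0)"
    using nc by (simp add: field_simps split: if_splits)
  moreover have "(\<Sum>g\<in>carrier G. \<rho> g $$ (i, k) * cnj (\<rho> g $$ (j, l))) = (if i = j then c else 0)"
    using arg_cong[OF c, of "\<lambda>M. M $$ (i, j)"] ij by (simp add: M_def)
  ultimately show "(\<Sum>g\<in>carrier G. \<rho> g $$ (i, k) * cnj (\<rho> g $$ (j, l))) =
     (if i = j \<and> k = l then of_nat (card (carrier G)) / of_nat ?n else 0)" by simp
qed

text \<open>Injectivity of the Fourier transform on functions, taken over all representations in \<open>R\<close>.\<close>
definition separating :: "('g, 'b) monoid_scheme \<Rightarrow> ('g \<Rightarrow> complex mat) set \<Rightarrow> bool" where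
  "separating G R \<longleftrightarrow>
     (\<forall>f. (\<forall>\<rho>\<in>R. fourier G f \<rho> = 0\<^sub>m (rep_dim G \<rho>) (rep_dim G \<rho>)) \<longrightarrow> (\<forall>g\<in>carrier G. f g = 0))"

text \<open>The left regular representation, as permutation matrices along an enumeration of the group.
  The column of the identity in a Fourier coefficient lists the values of \<open>f\<close>.\<close>
lemma (in group) regular_rep_exists:
  assumes fin: "finite (carrier G)"
  obtains \<rho> where "unitary_rep G \<rho>"
    "\<And>f g. fourier G f \<rho> = 0\<^sub>m (rep_dim G \<rho>) (rep_dim G \<rho>) \<Longrightarrow> g \<in> carrier G \<Longrightarrow> f g = 0"
proof -
  define n where "n = card (carrier G)"
  obtain e where e: "bij_betw e {..<n} (carrier G)"
    using ex_bij_betw_nat_finite[OF fin] by (auto simp: n_def atLeast0LessThan)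
  have ec: "e i \<in> carrier G" if "i < n" for i using e that by (auto simp: bij_betw_def)
  have einj: "e i = e j \<longleftrightarrow> i = j" if "i < n" "j < n" for i j
    using e that by (auto simp: bij_betw_def inj_on_def)
  have sum_e: "(\<Sum>i<n. F (e i)) = (\<Sum>x\<in>carrier G. F x)" for F :: "'a \<Rightarrow> complex"
    by (rule sum.reindex_bij_betw[OF e])
  define \<rho> :: "'a \<Rightarrow> complex mat" where
    "\<rho> g = mat n n (\<lambda>(i, j). if e i = g \<otimes> e j then 1 else 0)" for g
  have \<rho>c: "\<rho> g \<in> carrier_mat n n" for g by (simp add: \<rho>_def)
  have dim: "rep_dim G \<rho> = n" by (simp add: rep_dim_def \<rho>_def)
  have "\<rho> g * mat_adjoint (\<rho> g) = 1\<^sub>m n" if g: "g \<in> carrier G" for g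
  proof (intro eq_matI)
    fix i k assume "i < dim_row (1\<^sub>m n :: complex mat)" "k < dim_col (1\<^sub>m n :: complex mat)"
    then have ik: "i < n" "k < n" by auto
    have "(\<rho> g * mat_adjoint (\<rho> g)) $$ (i, k) =
        (\<Sum>j<n. (\<lambda>x. (if e i = g \<otimes> x then 1 else 0) * (if e k = g \<otimes> x then 1 else 0)) (e j))"
      using ik \<rho>c[of g]
      by (subst index_mult_mat_sum[OF \<rho>c mat_adjoint_carrier[OF \<rho>c] ik])
        (intro sum.cong refl, simp add: \<rho>_def)
    also have "\<dots> = (\<Sum>x\<in>carrier G. (if e i = g \<otimes> x then 1 else 0) * (if e k = g \<otimes> x then 1 else 0))"
      by (rule sum_e)
    also have "\<dots> = (\<Sum>x\<in>carrier G. if x = inv g \<otimes> e i then (if i = k then 1 else 0) else 0)"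
    proof (intro sum.cong refl)
      fix x assume x: "x \<in> carrier G"
      have "e i = g \<otimes> x \<longleftrightarrow> x = inv g \<otimes> e i"
      proof
        assume "e i = g \<otimes> x"
        then show "x = inv g \<otimes> e i" using g x by (simp add: m_assoc[symmetric])
      next
        assume "x = inv g \<otimes> e i"
        then show "e i = g \<otimes> x" using g ec[OF ik(1)] by (simp add: m_assoc[symmetric])
      qed
      moreover have "e k = e i \<longleftrightarrow> i = k" using einj[OF ik] by metis
      ultimately show "(if e i = g \<otimes> x then 1 else 0) * (if e k = g \<otimes> x then 1 else 0) =
          (if x = inv g \<otimes> e i then (if i = k then 1 else 0) else (0 :: complex))"
        by (cases "e i = g \<otimes> x") auto
    qed
    also have "\<dots> = 1\<^sub>m n $$ (i, k)" using fin g ec[OF ik(1)] ik by simp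
    finally show "(\<rho> g * mat_adjoint (\<rho> g)) $$ (i, k) = 1\<^sub>m n $$ (i, k)" .
  qed (auto simp: \<rho>_def)
  moreover have "\<rho> (g \<otimes> h) = \<rho> g * \<rho> h" if g: "g \<in> carrier G" and h: "h \<in> carrier G" for g h
  proof (intro eq_matI)
    fix i k assume "i < dim_row (\<rho> g * \<rho> h)" "k < dim_col (\<rho> g * \<rho> h)"
    then have ik: "i < n" "k < n" by (auto simp: \<rho>_def)
    have "(\<rho> g * \<rho> h) $$ (i, k) =
        (\<Sum>j<n. (\<lambda>x. (if e i = g \<otimes> x then 1 else 0) * (if x = h \<otimes> e k then 1 else 0)) (e j))"
      using ik by (subst index_mult_mat_sum[OF \<rho>c \<rho>c ik]) (intro sum.cong refl, simp add: \<rho>_def)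
    also have "\<dots> = (\<Sum>x\<in>carrier G. (if e i = g \<otimes> x then 1 else 0) * (if x = h \<otimes> e k then 1 else 0))"
      by (rule sum_e)
    also have "\<dots> = (\<Sum>x\<in>carrier G. if x = h \<otimes> e k then (if e i = g \<otimes> (h \<otimes> e k) then 1 else 0) else 0)"
      by (intro sum.cong) auto
    also have "\<dots> = (if e i = g \<otimes> (h \<otimes> e k) then 1 else 0)" using fin h ec[OF ik(2)] by simp
    finally show "\<rho> (g \<otimes> h) $$ (i, k) = (\<rho> g * \<rho> h) $$ (i, k)"
      using ik g h ec[OF ik(2)] by (simp add: \<rho>_def m_assoc)
  qed (auto simp: \<rho>_def)
  ultimately have u: "unitary_rep G \<rho>" using \<rho>c unfolding unitary_rep_def dim by auto
  have "f g = 0" if f: "fourier G f \<rho> = 0\<^sub>m (rep_dim G \<rho>) (rep_dim G \<rho>)" and g: "g \<in> carrier G" for f g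
  proof -
    obtain i where i: "i < n" "e i = g" using e g unfolding bij_betw_def by (metis imageE lessThan_iff)
    obtain j where j: "j < n" "e j = \<one>" using e one_closed unfolding bij_betw_def by (metis imageE lessThan_iff)
    have "0 = fourier G f \<rho> $$ (i, j)" using f i j dim by simp
    also have "\<dots> = (\<Sum>x\<in>carrier G. f x * (if g = x \<otimes> \<one> then 1 else 0))"
      using i j by (simp add: fourier_def dim \<rho>_def)
    also have "\<dots> = (\<Sum>x\<in>carrier G. if x = g then f g else 0)" by (intro sum.cong) auto
    also have "\<dots> = f g" using fin g by simp
    finally show ?thesis by simp
  qed
  then show ?thesis using that u by blast
qed

text \<open>If the Fourier coefficients of \<open>f\<close> vanish on \<open>R\<close>, they vanish on all irreducible
  representations, hence on their direct sums, hence on the regular representation, which detects \<open>f\<close>.\<close>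
lemma (in group) complete_irreps_separating:
  assumes fin: "finite (carrier G)" and R: "complete_irreps G R"
  shows "separating G R"
  unfolding separating_def
proof (intro allI impI ballI)
  fix f g
  assume "\<forall>\<rho>\<in>R. fourier G f \<rho> = 0\<^sub>m (rep_dim G \<rho>) (rep_dim G \<rho>)" and g: "g \<in> carrier G"
  then have fR: "fourier G f \<rho> = 0\<^sub>m (rep_dim G \<rho>) (rep_dim G \<rho>)" if "\<rho> \<in> R" for \<rho> using that by blast
  have equiv: "fourier G f \<rho> = 0\<^sub>m (rep_dim G \<rho>) (rep_dim G \<rho>)"
    if eq: "equivalent_reps G \<rho> \<sigma>" and u: "unitary_rep G \<rho>" "unitary_rep G \<sigma>"
      and 0: "fourier G f \<sigma> = 0\<^sub>m (rep_dim G \<sigma>) (rep_dim G \<sigma>)" for \<rho> \<sigma>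
  proof -
    obtain n T S where a: "rep_dim G \<rho> = n" "rep_dim G \<sigma> = n"
      "T \<in> carrier_mat n n" "S \<in> carrier_mat n n" "S * T = 1\<^sub>m n" and T: "T \<in> intertwiners G \<rho> \<sigma>"
      using equivalent_repsE[OF eq u] by metis
    have Fc: "fourier G f \<rho> \<in> carrier_mat n n" using a fourier_carrier[of G f \<rho>] by simp
    have "fourier G f \<rho> = (S * T) * fourier G f \<rho>" using a(5) Fc by simp
    also have "\<dots> = S * (T * fourier G f \<rho>)" by (rule assoc_mult_mat) (use a Fc in auto)
    also have "\<dots> = S * (fourier G f \<sigma> * T)" using intertwiner_fourier[OF u T] by simp
    also have "\<dots> = 0\<^sub>m n n" using a 0 by simp
    finally show ?thesis using a by simp
  qed
  obtain \<rho> where u: "unitary_rep G \<rho>"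
    and reg: "\<And>f g. fourier G f \<rho> = 0\<^sub>m (rep_dim G \<rho>) (rep_dim G \<rho>) \<Longrightarrow> g \<in> carrier G \<Longrightarrow> f g = 0"
    using regular_rep_exists[OF fin] by metis
  obtain \<sigma>s where irr: "\<And>\<sigma>. \<sigma> \<in> set \<sigma>s \<Longrightarrow> irreducible_rep G \<sigma>"
    and eq: "equivalent_reps G \<rho> (direct_sum_rep \<sigma>s)"
    using complete_reducibility[OF u] by blast
  let ?D = "direct_sum_rep \<sigma>s"
  have us: "\<And>\<sigma>. \<sigma> \<in> set \<sigma>s \<Longrightarrow> unitary_rep G \<sigma>" using irr by (auto simp: irreducible_rep_def)
  then have ui: "\<And>i. i < length \<sigma>s \<Longrightarrow> unitary_rep G (\<sigma>s ! i)" by auto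
  have uD: "unitary_rep G ?D" using us by (rule unitary_direct_sum_rep)
  obtain J where J: "\<And>i. i < length \<sigma>s \<Longrightarrow> J i \<in> intertwiners G (\<sigma>s ! i) ?D"
    and JZ: "\<And>k Z. Z \<in> carrier_mat (rep_dim G ?D) k \<Longrightarrow>
       (\<forall>i<length \<sigma>s. mat_adjoint (J i) * Z = 0\<^sub>m (rep_dim G (\<sigma>s ! i)) k) \<Longrightarrow> Z = 0\<^sub>m (rep_dim G ?D) k"
    using direct_sum_embeddings[OF us] by metis
  have "mat_adjoint (J i) * fourier G f ?D = 0\<^sub>m (rep_dim G (\<sigma>s ! i)) (rep_dim G ?D)"
    if i: "i < length \<sigma>s" for i
  proof -
    have P: "mat_adjoint (J i) \<in> intertwiners G ?D (\<sigma>s ! i)"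
      by (rule intertwiners_adjoint[OF ui[OF i] uD J[OF i]])
    obtain \<sigma> where \<sigma>: "\<sigma> \<in> R" "equivalent_reps G (\<sigma>s ! i) \<sigma>"
      using R irr[of "\<sigma>s ! i"] i unfolding complete_irreps_def by auto
    have "unitary_rep G \<sigma>" using \<sigma>(1) R by (auto simp: complete_irreps_def irreducible_rep_def)
    then have "fourier G f (\<sigma>s ! i) = 0\<^sub>m (rep_dim G (\<sigma>s ! i)) (rep_dim G (\<sigma>s ! i))"
      by (rule equiv[OF \<sigma>(2) ui[OF i] _ fR[OF \<sigma>(1)]])
    moreover have "mat_adjoint (J i) \<in> carrier_mat (rep_dim G (\<sigma>s ! i)) (rep_dim G ?D)"
      using P by (simp add: intertwiners_def)
    ultimately show ?thesis
      using intertwiner_fourier[OF uD ui[OF i] P, of f] left_mult_zero_mat by metis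
  qed
  then have "fourier G f ?D = 0\<^sub>m (rep_dim G ?D) (rep_dim G ?D)" using JZ[OF fourier_carrier] by blast
  from reg[OF equiv[OF eq u uD this] g] show "f g = 0" .
qed

section \<open>Class functions and commutants\<close>

text \<open>Invariance is required under conjugation by \<open>K\<close> only; the usual class functions are
  the case where \<open>K\<close> is the whole group.\<close>
definition class_functions :: "('g, 'b) monoid_scheme \<Rightarrow> 'g set \<Rightarrow> ('g \<Rightarrow> complex) set" where
  "class_functions G K =
     {f \<in> group_functions G. \<forall>g\<in>carrier G. \<forall>k\<in>K. f (k \<otimes>\<^bsub>G\<^esub> g \<otimes>\<^bsub>G\<^esub> inv\<^bsub>G\<^esub> k) = f g}"

lemma rep_dim_restrict_carrier [simp]: "rep_dim (G\<lparr>carrier := K\<rparr>) \<rho> = rep_dim G \<rho>"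
  by (simp add: rep_dim_def)

lemma (in group) sum_conjugate:
  assumes "k \<in> carrier G"
  shows "(\<Sum>g\<in>carrier G. f (k \<otimes> g \<otimes> inv k)) = (\<Sum>g\<in>carrier G. f g)"
proof -
  have cancel: "k \<otimes> (inv k \<otimes> x) = x" "inv k \<otimes> (k \<otimes> x) = x" if "x \<in> carrier G" for x
    using assms that by (simp_all add: m_assoc[symmetric])
  show ?thesis
    by (rule sum.reindex_bij_witness[of _ "\<lambda>g. inv k \<otimes> g \<otimes> k" "\<lambda>g. k \<otimes> g \<otimes> inv k"])
      (use assms cancel in \<open>auto simp: m_assoc\<close>)
qed

lemma (in group) fourier_class_function:
  assumes u: "unitary_rep G \<rho>" and K: "K \<subseteq> carrier G" and f: "f \<in> class_functions G K"
  shows "fourier G f \<rho> \<in> commutant (G\<lparr>carrier := K\<rparr>) \<rho>"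
proof -
  let ?n = "rep_dim G \<rho>"
  have "fourier G f \<rho> * \<rho> k = \<rho> k * fourier G f \<rho>" if kK: "k \<in> K" for k
  proof (intro eq_matI)
    have k: "k \<in> carrier G" using K kK by auto
    note rk = unitary_repD(1)[OF u k]
    fix i j assume "i < dim_row (\<rho> k * fourier G f \<rho>)" "j < dim_col (\<rho> k * fourier G f \<rho>)"
    then have ij: "i < ?n" "j < ?n" using rk by (auto simp: fourier_def)
    have "(fourier G f \<rho> * \<rho> k) $$ (i, j) = (\<Sum>g\<in>carrier G. f g * \<rho> (g \<otimes> k) $$ (i, j))"
      unfolding fourier_mult[OF u rk ij] using unitary_repD(4)[OF u _ k] by (intro sum.cong) auto
    also have "\<dots> = (\<Sum>g\<in>carrier G. f (k \<otimes> g \<otimes> inv k) * \<rho> (k \<otimes> g \<otimes> inv k \<otimes> k) $$ (i, j))"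
      by (rule sum_conjugate[OF k, symmetric])
    also have "\<dots> = (\<Sum>g\<in>carrier G. f g * (\<rho> k * \<rho> g) $$ (i, j))"
    proof (intro sum.cong refl)
      fix g assume g: "g \<in> carrier G"
      have "k \<otimes> g \<otimes> inv k \<otimes> k = k \<otimes> g" using g k by (simp add: m_assoc)
      moreover have "f (k \<otimes> g \<otimes> inv k) = f g" using f g kK by (simp add: class_functions_def)
      ultimately show "f (k \<otimes> g \<otimes> inv k) * \<rho> (k \<otimes> g \<otimes> inv k \<otimes> k) $$ (i, j) = f g * (\<rho> k * \<rho> g) $$ (i, j)"
        using unitary_repD(4)[OF u k g] by simp
    qed
    also have "\<dots> = (\<rho> k * fourier G f \<rho>) $$ (i, j)" by (rule mult_fourier[OF u rk ij, symmetric])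
    finally show "(fourier G f \<rho> * \<rho> k) $$ (i, j) = (\<rho> k * fourier G f \<rho>) $$ (i, j)" .
  qed (use unitary_repD(1)[OF u, of k] K kK in \<open>auto simp: fourier_def\<close>)
  then show ?thesis by (simp add: intertwiners_def)
qed

lemma sum_diag_mult_commute:
  fixes A B :: "complex mat"
  assumes A: "A \<in> carrier_mat n n" and B: "B \<in> carrier_mat n n"
  shows "(\<Sum>i<n. (A * B) $$ (i, i)) = (\<Sum>i<n. (B * A) $$ (i, i))"
proof -
  have "(\<Sum>i<n. (A * B) $$ (i, i)) = (\<Sum>i<n. \<Sum>j<n. A $$ (i, j) * B $$ (j, i))"
    by (intro sum.cong refl index_mult_mat_sum[OF A B]) auto
  also have "\<dots> = (\<Sum>j<n. \<Sum>i<n. B $$ (j, i) * A $$ (i, j))"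
    by (subst sum.swap) (simp add: mult.commute)
  also have "\<dots> = (\<Sum>j<n. (B * A) $$ (j, j))"
    by (intro sum.cong refl index_mult_mat_sum[OF B A, symmetric]) auto
  finally show ?thesis .
qed

text \<open>Fourier inversion: the function \<open>f(g) = (dim \<rho> / |G|) tr (T \<rho>(g)\<^sup>*)\<close> has Fourier coefficient
  \<open>T\<close> by orthogonality, and it is invariant under conjugation by \<open>K\<close> because \<open>T\<close> commutes with \<open>\<rho>(k)\<close>
  and the trace is cyclic.\<close>
lemma (in group) fourier_surjective:
  assumes fin: "finite (carrier G)" and u: "unitary_rep G \<rho>" and orth: "schur_orthogonal G \<rho>"
    and K: "K \<subseteq> carrier G" and T: "T \<in> commutant (G\<lparr>carrier := K\<rparr>) \<rho>"
  obtains f where "f \<in> class_functions G K" "fourier G f \<rho> = T"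
proof
  define n where "n = rep_dim G \<rho>"
  have Tc: "T \<in> carrier_mat n n" and Tk: "\<And>k. k \<in> K \<Longrightarrow> T * \<rho> k = \<rho> k * T"
    using T by (auto simp: intertwiners_def n_def)
  have rc: "\<rho> g \<in> carrier_mat n n" "mat_adjoint (\<rho> g) \<in> carrier_mat n n" if "g \<in> carrier G" for g
    using unitary_repD(1)[OF u that] by (auto simp: n_def)
  define c :: complex where "c = of_nat n / of_nat (card (carrier G))"
  define f where "f = (\<lambda>g\<in>carrier G. c * (\<Sum>i<n. (T * mat_adjoint (\<rho> g)) $$ (i, i)))"
  have card: "card (carrier G) \<noteq> 0" using fin one_closed by auto
  show "f \<in> class_functions G K"
    unfolding class_functions_def group_functions_def
  proof (intro CollectI conjI ballI)
    show "f \<in> carrier G \<rightarrow>\<^sub>E UNIV" by (simp add: f_def)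
  next
    fix g k assume g: "g \<in> carrier G" and kK: "k \<in> K"
    then have k: "k \<in> carrier G" using K by auto
    have c2: "mat_adjoint (\<rho> g) * mat_adjoint (\<rho> k) \<in> carrier_mat n n"
      "T * mat_adjoint (\<rho> g) \<in> carrier_mat n n" "T * mat_adjoint (\<rho> g) * mat_adjoint (\<rho> k) \<in> carrier_mat n n"
      using rc[OF g] rc[OF k] Tc by auto
    have "\<rho> (k \<otimes> g \<otimes> inv k) = \<rho> k * \<rho> g * mat_adjoint (\<rho> k)"
      using g k unitary_repD(4)[OF u] unitary_rep_inv[OF u k] by simp
    then have "mat_adjoint (\<rho> (k \<otimes> g \<otimes> inv k)) = mat_adjoint (\<rho> k * \<rho> g * mat_adjoint (\<rho> k))"
      by (rule arg_cong)
    also have "\<dots> = mat_adjoint (mat_adjoint (\<rho> k)) * mat_adjoint (\<rho> k * \<rho> g)"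
      by (rule mat_adjoint_mult[OF mult_carrier_mat[OF rc(1)[OF k] rc(1)[OF g]] rc(2)[OF k]])
    also have "\<dots> = \<rho> k * (mat_adjoint (\<rho> g) * mat_adjoint (\<rho> k))"
      using mat_adjoint_mult[OF rc(1)[OF k] rc(1)[OF g]] by simp
    finally have "mat_adjoint (\<rho> (k \<otimes> g \<otimes> inv k)) = \<rho> k * (mat_adjoint (\<rho> g) * mat_adjoint (\<rho> k))" .
    then have "T * mat_adjoint (\<rho> (k \<otimes> g \<otimes> inv k)) = T * \<rho> k * (mat_adjoint (\<rho> g) * mat_adjoint (\<rho> k))"
      using assoc_mult_mat[OF Tc rc(1)[OF k] c2(1)] by simp
    also have "\<dots> = \<rho> k * (T * (mat_adjoint (\<rho> g) * mat_adjoint (\<rho> k)))"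
      using Tk[OF kK] assoc_mult_mat[OF rc(1)[OF k] Tc c2(1)] by simp
    also have "T * (mat_adjoint (\<rho> g) * mat_adjoint (\<rho> k)) = T * mat_adjoint (\<rho> g) * mat_adjoint (\<rho> k)"
      by (rule assoc_mult_mat[OF Tc rc(2)[OF g] rc(2)[OF k], symmetric])
    finally have "(\<Sum>i<n. (T * mat_adjoint (\<rho> (k \<otimes> g \<otimes> inv k))) $$ (i, i)) =
        (\<Sum>i<n. (\<rho> k * (T * mat_adjoint (\<rho> g) * mat_adjoint (\<rho> k))) $$ (i, i))" by simp
    also have "\<dots> = (\<Sum>i<n. (T * mat_adjoint (\<rho> g) * mat_adjoint (\<rho> k) * \<rho> k) $$ (i, i))"
      by (rule sum_diag_mult_commute[OF rc(1)[OF k] c2(3)])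
    also have "T * mat_adjoint (\<rho> g) * mat_adjoint (\<rho> k) * \<rho> k = T * mat_adjoint (\<rho> g) * (mat_adjoint (\<rho> k) * \<rho> k)"
      by (rule assoc_mult_mat[OF c2(2) rc(2)[OF k] rc(1)[OF k]])
    also have "\<dots> = T * mat_adjoint (\<rho> g)"
      unfolding unitary_repD(3)[OF u k] using right_mult_one_mat[OF c2(2)] by (simp only: n_def)
    finally show "f (k \<otimes> g \<otimes> inv k) = f g" using g k by (simp add: f_def)
  qed
  show "fourier G f \<rho> = T"
  proof (intro eq_matI)
    fix a b assume "a < dim_row T" "b < dim_col T"
    then have ab: "a < n" "b < n" using Tc by auto
    have "fourier G f \<rho> $$ (a, b) =
        (\<Sum>g\<in>carrier G. \<Sum>i<n. \<Sum>j<n. c * T $$ (i, j) * (\<rho> g $$ (a, b) * cnj (\<rho> g $$ (i, j))))"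
    proof -
      have trace: "(\<Sum>i<n. (T * mat_adjoint (\<rho> g)) $$ (i, i)) = (\<Sum>i<n. \<Sum>j<n. T $$ (i, j) * cnj (\<rho> g $$ (i, j)))"
        if g: "g \<in> carrier G" for g
        using rc[OF g] by (intro sum.cong refl, subst index_mult_mat_sum[OF Tc rc(2)[OF g]]) auto
      then have "f g * \<rho> g $$ (a, b) =
          (\<Sum>i<n. \<Sum>j<n. c * T $$ (i, j) * (\<rho> g $$ (a, b) * cnj (\<rho> g $$ (i, j))))"
        if "g \<in> carrier G" for g
      proof -
        have "f g = c * (\<Sum>i<n. \<Sum>j<n. T $$ (i, j) * cnj (\<rho> g $$ (i, j)))"
          unfolding f_def restrict_apply'[OF that] trace[OF that] ..
        then show ?thesis by (simp add: sum_distrib_left mult_ac)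
      qed
      then show ?thesis using ab by (simp add: fourier_def flip: n_def)
    qed
    also have "\<dots> = (\<Sum>i<n. \<Sum>j<n. c * T $$ (i, j) * (\<Sum>g\<in>carrier G. \<rho> g $$ (a, b) * cnj (\<rho> g $$ (i, j))))"
      by (subst sum.swap, intro sum.cong refl, subst sum.swap) (simp add: sum_distrib_left)
    also have "\<dots> = (\<Sum>i<n. \<Sum>j<n. if i = a then (if j = b then T $$ (a, b) else 0) else 0)"
    proof (intro sum.cong refl)
      fix i j assume "i \<in> {..<n}" "j \<in> {..<n}"
      then have "(\<Sum>g\<in>carrier G. \<rho> g $$ (a, b) * cnj (\<rho> g $$ (i, j))) =
          (if a = i \<and> b = j then of_nat (card (carrier G)) / of_nat n else 0)"
        using orth ab unfolding schur_orthogonal_def n_def by auto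
      then show "c * T $$ (i, j) * (\<Sum>g\<in>carrier G. \<rho> g $$ (a, b) * cnj (\<rho> g $$ (i, j))) =
          (if i = a then (if j = b then T $$ (a, b) else 0) else 0)"
        using ab card by (auto simp: c_def)
    qed
    also have "\<dots> = (\<Sum>i<n. if i = a then T $$ (a, b) else 0)"
      using ab by (intro sum.cong refl) simp
    also have "\<dots> = T $$ (a, b)" using ab by simp
    finally show "fourier G f \<rho> $$ (a, b) = T $$ (a, b)" .
  qed (use Tc in \<open>auto simp: fourier_def n_def\<close>)
qed

text \<open>From left to right, elements of a commutant are Fourier coefficients of class functions; from
  right to left, the two convolutions have the same Fourier coefficients on the separating set \<open>R\<close>.\<close>
theorem (in group) class_functions_commute_iff:
  assumes fin: "finite (carrier G)" and K: "K \<subseteq> carrier G"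
    and R: "\<And>\<rho>. \<rho> \<in> R \<Longrightarrow> unitary_rep G \<rho>" "\<And>\<rho>. \<rho> \<in> R \<Longrightarrow> schur_orthogonal G \<rho>" "separating G R"
  shows "(\<forall>f1\<in>class_functions G K. \<forall>f2\<in>class_functions G K. convolution G f1 f2 = convolution G f2 f1)
    \<longleftrightarrow> (\<forall>\<rho>\<in>R. commuting (commutant (G\<lparr>carrier := K\<rparr>) \<rho>))"
proof
  assume comm: "\<forall>f1\<in>class_functions G K. \<forall>f2\<in>class_functions G K. convolution G f1 f2 = convolution G f2 f1"
  show "\<forall>\<rho>\<in>R. commuting (commutant (G\<lparr>carrier := K\<rparr>) \<rho>)"
    unfolding commuting_def
  proof (intro ballI)
    fix \<rho> X Y assume \<rho>: "\<rho> \<in> R" and XY: "X \<in> commutant (G\<lparr>carrier := K\<rparr>) \<rho>" "Y \<in> commutant (G\<lparr>carrier := K\<rparr>) \<rho>"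
    obtain f1 where f1: "f1 \<in> class_functions G K" "fourier G f1 \<rho> = X"
      using fourier_surjective[OF fin R(1,2)[OF \<rho>] K XY(1)] by metis
    obtain f2 where f2: "f2 \<in> class_functions G K" "fourier G f2 \<rho> = Y"
      using fourier_surjective[OF fin R(1,2)[OF \<rho>] K XY(2)] by metis
    have "convolution G f1 f2 = convolution G f2 f1" using comm f1 f2 by blast
    then show "X * Y = Y * X"
      using fourier_convolution[OF R(1)[OF \<rho>], of f1 f2] fourier_convolution[OF R(1)[OF \<rho>], of f2 f1] f1 f2 by simp
  qed
next
  assume comm: "\<forall>\<rho>\<in>R. commuting (commutant (G\<lparr>carrier := K\<rparr>) \<rho>)"
  show "\<forall>f1\<in>class_functions G K. \<forall>f2\<in>class_functions G K. convolution G f1 f2 = convolution G f2 f1"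
  proof (intro ballI)
    fix f1 f2 assume f: "f1 \<in> class_functions G K" "f2 \<in> class_functions G K"
    define d where "d g = convolution G f1 f2 g - convolution G f2 f1 g" for g
    have "fourier G d \<rho> = 0\<^sub>m (rep_dim G \<rho>) (rep_dim G \<rho>)" if \<rho>: "\<rho> \<in> R" for \<rho>
    proof (intro eq_matI)
      fix i j assume "i < dim_row (0\<^sub>m (rep_dim G \<rho>) (rep_dim G \<rho>) :: complex mat)"
        "j < dim_col (0\<^sub>m (rep_dim G \<rho>) (rep_dim G \<rho>) :: complex mat)"
      then have ij: "i < rep_dim G \<rho>" "j < rep_dim G \<rho>" by auto
      have "fourier G (convolution G f1 f2) \<rho> = fourier G (convolution G f2 f1) \<rho>"
        unfolding fourier_convolution[OF R(1)[OF \<rho>]]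
        using comm \<rho> fourier_class_function[OF R(1)[OF \<rho>] K] f unfolding commuting_def by blast
      from arg_cong[OF this, of "\<lambda>M. M $$ (i, j)"]
      show "fourier G d \<rho> $$ (i, j) = 0\<^sub>m (rep_dim G \<rho>) (rep_dim G \<rho>) $$ (i, j)"
        using ij by (simp add: fourier_def d_def left_diff_distrib sum_subtractf)
    qed (auto simp: fourier_def)
    then have "d g = 0" if "g \<in> carrier G" for g
      using R(3) that unfolding separating_def by blast
    then show "convolution G f1 f2 = convolution G f2 f1"
      by (intro ext) (auto simp: d_def convolution_def restrict_def)
  qed
qed

section \<open>Outer tensor products\<close>

lemma pair_index_less:
  fixes a b m n :: nat
  assumes "a < m" "b < n"
  shows "a * n + b < m * n"
proof -
  have "a * n + b < Suc a * n" using assms by simp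
  also have "\<dots> \<le> m * n" using assms by (intro mult_right_mono) auto
  finally show ?thesis .
qed

lemma div_mod_less:
  fixes i m n :: nat
  assumes "i < m * n"
  shows "i div n < m" "i mod n < n"
proof -
  have "n \<noteq> 0" using assms by (cases n) auto
  then show "i mod n < n" by simp
  show "i div n < m" using assms by (rule less_mult_imp_div_less)
qed

text \<open>The lexicographic indexing of the Kronecker product as a double sum.\<close>
lemma sum_div_mod:
  fixes f :: "nat \<Rightarrow> nat \<Rightarrow> complex"
  shows "(\<Sum>k<m * n. f (k div n) (k mod n)) = (\<Sum>a<m. \<Sum>b<n. f a b)"
proof -
  have "(\<Sum>k<m * n. f (k div n) (k mod n)) = (\<Sum>(a, b)\<in>{..<m} \<times> {..<n}. f a b)"
    by (rule sum.reindex_bij_witness[of _ "\<lambda>(a, b). a * n + b" "\<lambda>k. (k div n, k mod n)"])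
      (auto intro: pair_index_less div_mod_less)
  then show ?thesis by (simp add: sum.cartesian_product)
qed


lemma kronecker_carrier [simp]:
  "A \<in> carrier_mat m k \<Longrightarrow> B \<in> carrier_mat n l \<Longrightarrow> kronecker_mat A B \<in> carrier_mat (m * n) (k * l)"
  by (auto simp: kronecker_mat_def)

lemma index_kronecker:
  assumes "A \<in> carrier_mat m k" "B \<in> carrier_mat n l" "i < m * n" "j < k * l"
  shows "kronecker_mat A B $$ (i, j) = A $$ (i div n, j div l) * B $$ (i mod n, j mod l)"
  using assms by (auto simp: kronecker_mat_def)

lemma kronecker_mult:
  assumes A: "A \<in> carrier_mat m k" and B: "B \<in> carrier_mat n l"
    and C: "C \<in> carrier_mat k p" and D: "D \<in> carrier_mat l q"
  shows "kronecker_mat A B * kronecker_mat C D = kronecker_mat (A * C) (B * D)"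
proof (intro eq_matI)
  have AC: "A * C \<in> carrier_mat m p" and BD: "B * D \<in> carrier_mat n q" using A B C D by auto
  fix i j assume "i < dim_row (kronecker_mat (A * C) (B * D))" "j < dim_col (kronecker_mat (A * C) (B * D))"
  then have i: "i < m * n" and j: "j < p * q" using A B C D by (auto simp: kronecker_mat_def)
  note id = div_mod_less[OF i] and jd = div_mod_less[OF j]
  have "(kronecker_mat A B * kronecker_mat C D) $$ (i, j) =
      (\<Sum>r<k * l. A $$ (i div n, r div l) * B $$ (i mod n, r mod l) *
        (C $$ (r div l, j div q) * D $$ (r mod l, j mod q)))"
    using A B C D i j
    by (subst index_mult_mat_sum[OF kronecker_carrier[OF A B] kronecker_carrier[OF C D] i j])
      (intro sum.cong refl, simp add: index_kronecker)
  also have "\<dots> = (\<Sum>a<k. \<Sum>b<l. A $$ (i div n, a) * B $$ (i mod n, b) *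
        (C $$ (a, j div q) * D $$ (b, j mod q)))"
    by (rule sum_div_mod)
  also have "\<dots> = (\<Sum>a<k. A $$ (i div n, a) * C $$ (a, j div q)) * (\<Sum>b<l. B $$ (i mod n, b) * D $$ (b, j mod q))"
    by (simp add: sum_product mult_ac)
  also have "\<dots> = (A * C) $$ (i div n, j div q) * (B * D) $$ (i mod n, j mod q)"
    using index_mult_mat_sum[OF A C id(1) jd(1)] index_mult_mat_sum[OF B D id(2) jd(2)] by simp
  also have "\<dots> = kronecker_mat (A * C) (B * D) $$ (i, j)"
    by (rule index_kronecker[OF AC BD i j, symmetric])
  finally show "(kronecker_mat A B * kronecker_mat C D) $$ (i, j) = kronecker_mat (A * C) (B * D) $$ (i, j)" .
qed (use A B C D in \<open>auto simp: kronecker_mat_def\<close>)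

lemma mat_adjoint_kronecker:
  assumes A: "A \<in> carrier_mat m k" and B: "B \<in> carrier_mat n l"
  shows "mat_adjoint (kronecker_mat A B) = kronecker_mat (mat_adjoint A) (mat_adjoint B)"
proof (intro eq_matI)
  fix i j assume "i < dim_row (kronecker_mat (mat_adjoint A) (mat_adjoint B))"
    "j < dim_col (kronecker_mat (mat_adjoint A) (mat_adjoint B))"
  then have i: "i < k * l" and j: "j < m * n" using A B by (auto simp: kronecker_mat_def)
  note id = div_mod_less[OF i] and jd = div_mod_less[OF j]
  show "mat_adjoint (kronecker_mat A B) $$ (i, j) = kronecker_mat (mat_adjoint A) (mat_adjoint B) $$ (i, j)"
    using A B i j id jd carrier_matD[OF kronecker_carrier[OF A B]]
    by (simp add: index_kronecker[OF A B j i] index_kronecker[OF mat_adjoint_carrier[OF A] mat_adjoint_carrier[OF B] i j])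
qed (use A B in \<open>auto simp: kronecker_mat_def\<close>)

lemma kronecker_one: "kronecker_mat (1\<^sub>m m) (1\<^sub>m n) = 1\<^sub>m (m * n)"
proof (intro eq_matI)
  fix i j assume "i < dim_row (1\<^sub>m (m * n) :: complex mat)" "j < dim_col (1\<^sub>m (m * n) :: complex mat)"
  then have i: "i < m * n" and j: "j < m * n" by auto
  note id = div_mod_less[OF i] and jd = div_mod_less[OF j]
  have "i = j \<longleftrightarrow> i div n = j div n \<and> i mod n = j mod n" by (metis div_mult_mod_eq)
  then show "kronecker_mat (1\<^sub>m m) (1\<^sub>m n) $$ (i, j) = 1\<^sub>m (m * n) $$ (i, j)"
    using index_kronecker[OF one_carrier_mat one_carrier_mat i j] i j id jd by auto
qed (auto simp: kronecker_mat_def)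

definition outer_tensor_rep ::
  "('g \<Rightarrow> complex mat) \<Rightarrow> ('g \<Rightarrow> complex mat) \<Rightarrow> 'g \<times> 'g \<Rightarrow> complex mat" where
  "outer_tensor_rep \<rho>1 \<rho>2 = (\<lambda>(x, y). kronecker_mat (\<rho>1 x) (\<rho>2 y))"

lemma rep_dim_outer_tensor_rep [simp]:
  "rep_dim (G \<times>\<times> G') (outer_tensor_rep \<rho>1 \<rho>2) = rep_dim G \<rho>1 * rep_dim G' \<rho>2"
  by (simp add: rep_dim_def outer_tensor_rep_def one_DirProd kronecker_mat_def)

lemma unitary_outer_tensor_rep:
  assumes u: "unitary_rep G \<rho>1" "unitary_rep G \<rho>2"
  shows "unitary_rep (G \<times>\<times> G) (outer_tensor_rep \<rho>1 \<rho>2)"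
  unfolding unitary_rep_def rep_dim_outer_tensor_rep
proof (intro conjI ballI)
  fix g assume "g \<in> carrier (G \<times>\<times> G)"
  then obtain x y where g: "g = (x, y)" "x \<in> carrier G" "y \<in> carrier G" by auto
  note r = unitary_repD[OF u(1) g(2)] and s = unitary_repD[OF u(2) g(3)]
  let ?R = "outer_tensor_rep \<rho>1 \<rho>2"
  show "?R g \<in> carrier_mat (rep_dim G \<rho>1 * rep_dim G \<rho>2) (rep_dim G \<rho>1 * rep_dim G \<rho>2)"
    using r s by (simp add: g outer_tensor_rep_def)
  show "?R g * mat_adjoint (?R g) = 1\<^sub>m (rep_dim G \<rho>1 * rep_dim G \<rho>2)"
    unfolding g outer_tensor_rep_def prod.case mat_adjoint_kronecker[OF r(1) s(1)]
      kronecker_mult[OF r(1) s(1) mat_adjoint_carrier[OF r(1)] mat_adjoint_carrier[OF s(1)]] r(2) s(2)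
    by (rule kronecker_one)
next
  fix g h assume "g \<in> carrier (G \<times>\<times> G)" "h \<in> carrier (G \<times>\<times> G)"
  then obtain x y x' y' where g: "g = (x, y)" "x \<in> carrier G" "y \<in> carrier G"
    and h: "h = (x', y')" "x' \<in> carrier G" "y' \<in> carrier G" by auto
  show "outer_tensor_rep \<rho>1 \<rho>2 (g \<otimes>\<^bsub>G \<times>\<times> G\<^esub> h) = outer_tensor_rep \<rho>1 \<rho>2 g * outer_tensor_rep \<rho>1 \<rho>2 h"
    using unitary_repD(4)[OF u(1) g(2) h(2)] unitary_repD(4)[OF u(2) g(3) h(3)]
      kronecker_mult[OF unitary_repD(1)[OF u(1) g(2)] unitary_repD(1)[OF u(2) g(3)]
        unitary_repD(1)[OF u(1) h(2)] unitary_repD(1)[OF u(2) h(3)]]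
    by (simp add: g h outer_tensor_rep_def)
qed

lemma index_outer_tensor_rep:
  assumes u: "unitary_rep G \<rho>1" "unitary_rep G \<rho>2" and xy: "x \<in> carrier G" "y \<in> carrier G"
    and "i < rep_dim G \<rho>1 * rep_dim G \<rho>2" "j < rep_dim G \<rho>1 * rep_dim G \<rho>2"
  shows "outer_tensor_rep \<rho>1 \<rho>2 (x, y) $$ (i, j) =
    \<rho>1 x $$ (i div rep_dim G \<rho>2, j div rep_dim G \<rho>2) * \<rho>2 y $$ (i mod rep_dim G \<rho>2, j mod rep_dim G \<rho>2)"
  unfolding outer_tensor_rep_def prod.case
  by (rule index_kronecker[OF unitary_repD(1)[OF u(1) xy(1)] unitary_repD(1)[OF u(2) xy(2)] assms(5,6)])

lemma schur_orthogonal_outer_tensor_rep: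
  assumes u: "unitary_rep G \<rho>1" "unitary_rep G \<rho>2"
    and o: "schur_orthogonal G \<rho>1" "schur_orthogonal G \<rho>2"
  shows "schur_orthogonal (G \<times>\<times> G) (outer_tensor_rep \<rho>1 \<rho>2)"
  unfolding schur_orthogonal_def rep_dim_outer_tensor_rep
proof (intro allI impI)
  let ?m = "rep_dim G \<rho>1" and ?n = "rep_dim G \<rho>2" and ?R = "outer_tensor_rep \<rho>1 \<rho>2"
  fix i j k l assume i: "i < ?m * ?n" and j: "j < ?m * ?n" and k: "k < ?m * ?n" and l: "l < ?m * ?n"
  note d = div_mod_less[OF i] div_mod_less[OF j] div_mod_less[OF k] div_mod_less[OF l]
  have "(\<Sum>g\<in>carrier (G \<times>\<times> G). ?R g $$ (i, k) * cnj (?R g $$ (j, l))) =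
      (\<Sum>x\<in>carrier G. \<Sum>y\<in>carrier G. ?R (x, y) $$ (i, k) * cnj (?R (x, y) $$ (j, l)))"
    by (simp add: sum.cartesian_product)
  also have "\<dots> = (\<Sum>x\<in>carrier G. \<Sum>y\<in>carrier G.
      (\<rho>1 x $$ (i div ?n, k div ?n) * cnj (\<rho>1 x $$ (j div ?n, l div ?n))) *
      (\<rho>2 y $$ (i mod ?n, k mod ?n) * cnj (\<rho>2 y $$ (j mod ?n, l mod ?n))))"
    by (intro sum.cong refl) (simp add: index_outer_tensor_rep[OF u] i j k l)
  also have "\<dots> = (\<Sum>x\<in>carrier G. \<rho>1 x $$ (i div ?n, k div ?n) * cnj (\<rho>1 x $$ (j div ?n, l div ?n))) *
      (\<Sum>y\<in>carrier G. \<rho>2 y $$ (i mod ?n, k mod ?n) * cnj (\<rho>2 y $$ (j mod ?n, l mod ?n)))"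
    by (rule sum_product[symmetric])
  also have "\<dots> = (if i div ?n = j div ?n \<and> k div ?n = l div ?n then of_nat (card (carrier G)) / of_nat ?m else 0) *
      (if i mod ?n = j mod ?n \<and> k mod ?n = l mod ?n then of_nat (card (carrier G)) / of_nat ?n else 0)"
    using o d by (simp add: schur_orthogonal_def)
  also have "\<dots> = (if i = j \<and> k = l then of_nat (card (carrier (G \<times>\<times> G))) / of_nat (?m * ?n) else 0)"
  proof -
    have "i = j \<longleftrightarrow> i div ?n = j div ?n \<and> i mod ?n = j mod ?n"
      "k = l \<longleftrightarrow> k div ?n = l div ?n \<and> k mod ?n = l mod ?n" by (metis div_mult_mod_eq)+
    then show ?thesis by (auto simp: card_cartesian_product)
  qed
  finally show "(\<Sum>g\<in>carrier (G \<times>\<times> G). ?R g $$ (i, k) * cnj (?R g $$ (j, l))) =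
     (if i = j \<and> k = l then of_nat (card (carrier (G \<times>\<times> G))) / of_nat (?m * ?n) else 0)" .
qed

text \<open>Separation in one variable at a time: summing \<open>f(x, y)\<close> against a coefficient of \<open>\<rho>2\<close> in the
  second variable leaves a function of \<open>x\<close> all of whose Fourier coefficients vanish.\<close>
lemma separating_outer_tensor_rep:
  assumes u: "\<And>\<rho>. \<rho> \<in> R \<Longrightarrow> unitary_rep G \<rho>" and sep: "separating G R"
  shows "separating (G \<times>\<times> G) {outer_tensor_rep \<rho>1 \<rho>2 | \<rho>1 \<rho>2. \<rho>1 \<in> R \<and> \<rho>2 \<in> R}"
  unfolding separating_def
proof (intro allI impI ballI)
  fix f p
  assume 0: "\<forall>\<rho>\<in>{outer_tensor_rep \<rho>1 \<rho>2 | \<rho>1 \<rho>2. \<rho>1 \<in> R \<and> \<rho>2 \<in> R}.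
      fourier (G \<times>\<times> G) f \<rho> = 0\<^sub>m (rep_dim (G \<times>\<times> G) \<rho>) (rep_dim (G \<times>\<times> G) \<rho>)"
    and "p \<in> carrier (G \<times>\<times> G)"
  then obtain x y where p: "p = (x, y)" "x \<in> carrier G" "y \<in> carrier G" by auto
  have "fourier G (\<lambda>y. f (x, y)) \<rho>2 = 0\<^sub>m (rep_dim G \<rho>2) (rep_dim G \<rho>2)" if \<rho>2: "\<rho>2 \<in> R" for \<rho>2
  proof (intro eq_matI)
    let ?n = "rep_dim G \<rho>2"
    fix a b assume "a < dim_row (0\<^sub>m ?n ?n :: complex mat)" "b < dim_col (0\<^sub>m ?n ?n :: complex mat)"
    then have ab: "a < ?n" "b < ?n" by auto
    define h where "h x = (\<Sum>y\<in>carrier G. f (x, y) * \<rho>2 y $$ (a, b))" for x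
    have "fourier G h \<rho>1 = 0\<^sub>m (rep_dim G \<rho>1) (rep_dim G \<rho>1)" if \<rho>1: "\<rho>1 \<in> R" for \<rho>1
    proof (intro eq_matI)
      let ?m = "rep_dim G \<rho>1" and ?R = "outer_tensor_rep \<rho>1 \<rho>2"
      fix i j assume "i < dim_row (0\<^sub>m ?m ?m :: complex mat)" "j < dim_col (0\<^sub>m ?m ?m :: complex mat)"
      then have ij: "i < ?m" "j < ?m" by auto
      note ia = pair_index_less[OF ij(1) ab(1)] and jb = pair_index_less[OF ij(2) ab(2)]
      have "fourier G h \<rho>1 $$ (i, j) =
          (\<Sum>x\<in>carrier G. \<Sum>y\<in>carrier G. f (x, y) * (\<rho>1 x $$ (i, j) * \<rho>2 y $$ (a, b)))"
        using ij by (simp add: fourier_def h_def sum_distrib_left mult_ac)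
      also have "\<dots> = (\<Sum>x\<in>carrier G. \<Sum>y\<in>carrier G. f (x, y) * ?R (x, y) $$ (i * ?n + a, j * ?n + b))"
        using ab by (intro sum.cong refl) (simp add: index_outer_tensor_rep[OF u[OF \<rho>1] u[OF \<rho>2] _ _ ia jb])
      also have "\<dots> = fourier (G \<times>\<times> G) f ?R $$ (i * ?n + a, j * ?n + b)"
        using ia jb by (simp add: fourier_def sum.cartesian_product)
      also have "fourier (G \<times>\<times> G) f ?R = 0\<^sub>m (rep_dim (G \<times>\<times> G) ?R) (rep_dim (G \<times>\<times> G) ?R)"
        using 0 \<rho>1 \<rho>2 by blast
      also have "\<dots> $$ (i * ?n + a, j * ?n + b) = 0" using ia jb by simp
      finally show "fourier G h \<rho>1 $$ (i, j) = 0\<^sub>m ?m ?m $$ (i, j)" using ij by simp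
    qed (auto simp: fourier_def)
    then have "h x = 0" using sep p(2) unfolding separating_def by blast
    then show "fourier G (\<lambda>y. f (x, y)) \<rho>2 $$ (a, b) = 0\<^sub>m ?n ?n $$ (a, b)"
      using ab by (simp add: fourier_def h_def)
  qed (auto simp: fourier_def)
  then show "f p = 0" using sep p(3) unfolding separating_def p(1) by blast
qed

section \<open>The diagonal subgroup\<close>

abbreviation "pair_diagonal H \<equiv> {(h, h) | h. h \<in> H}"

context
  fixes G :: "('g, 'b) monoid_scheme" and H :: "'g set"
  assumes G: "group G" and fin: "finite (carrier G)" and H: "subgroup H G"
begin

interpretation G: group G by (rule G)
interpretation H: subgroup H G by (rule H)

abbreviation (input) "\<Gamma> \<equiv> G \<times>\<times> G \<times>\<times> G\<lparr>carrier := H\<rparr>"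

lemma inv_pair: "x \<in> carrier G \<Longrightarrow> y \<in> carrier G \<Longrightarrow> inv\<^bsub>G \<times>\<times> G\<^esub> (x, y) = (inv\<^bsub>G\<^esub> x, inv\<^bsub>G\<^esub> y)"
  using G by (simp add: inv_DirProd)

lemma inv_triple:
  assumes "x \<in> carrier G" "y \<in> carrier G" "h \<in> H"
  shows "inv\<^bsub>\<Gamma>\<^esub> (x, y, h) = (inv\<^bsub>G\<^esub> x, inv\<^bsub>G\<^esub> y, inv\<^bsub>G\<^esub> h)"
proof -
  have gH: "group (G\<lparr>carrier := H\<rparr>)" using G.subgroup_imp_group H by blast
  have "group (G \<times>\<times> G\<lparr>carrier := H\<rparr>)" using DirProd_group G gH by blast
  then show ?thesis using assms G gH H by (simp add: inv_DirProd G.m_inv_consistent)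
qed

lemma pair_diagonal_subset: "pair_diagonal H \<subseteq> carrier (G \<times>\<times> G)"
  by auto

definition slice :: "('g \<times> 'g \<times> 'g \<Rightarrow> complex) \<Rightarrow> 'g \<times> 'g \<Rightarrow> complex" where
  "slice f = (\<lambda>(x, y)\<in>carrier (G \<times>\<times> G). f (x, y, \<one>\<^bsub>G\<^esub>))"

text \<open>The extension of a class function on \<open>G \<times> G\<close> that \<open>bi_invariant_eq_slice\<close> forces.\<close>
definition unslice :: "('g \<times> 'g \<Rightarrow> complex) \<Rightarrow> 'g \<times> 'g \<times> 'g \<Rightarrow> complex" where
  "unslice F = (\<lambda>(x, y, h)\<in>carrier \<Gamma>. F (x \<otimes>\<^bsub>G\<^esub> inv\<^bsub>G\<^esub> h, y \<otimes>\<^bsub>G\<^esub> inv\<^bsub>G\<^esub> h))"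

lemma bi_invariant_translate:
  assumes f: "f \<in> bi_invariant_functions \<Gamma> (triple_diagonal H)"
    and "x \<in> carrier G" "y \<in> carrier G" "h \<in> H" "k \<in> H" "l \<in> H"
  shows "f (k \<otimes>\<^bsub>G\<^esub> x \<otimes>\<^bsub>G\<^esub> l, k \<otimes>\<^bsub>G\<^esub> y \<otimes>\<^bsub>G\<^esub> l, k \<otimes>\<^bsub>G\<^esub> h \<otimes>\<^bsub>G\<^esub> l) = f (x, y, h)"
proof -
  have "(k, k, k) \<in> triple_diagonal H" "(l, l, l) \<in> triple_diagonal H" "(x, y, h) \<in> carrier \<Gamma>"
    using assms by (auto simp: triple_diagonal_def)
  then have "f ((k, k, k) \<otimes>\<^bsub>\<Gamma>\<^esub> (x, y, h) \<otimes>\<^bsub>\<Gamma>\<^esub> (l, l, l)) = f (x, y, h)"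
    using f unfolding bi_invariant_functions_def by blast
  then show ?thesis by simp
qed

text \<open>Translating by \<open>(h, h, h)\<close> on the right moves the last coordinate to the identity.\<close>
lemma bi_invariant_eq_slice:
  assumes f: "f \<in> bi_invariant_functions \<Gamma> (triple_diagonal H)"
    and xyh: "x \<in> carrier G" "y \<in> carrier G" "h \<in> H"
  shows "f (x, y, h) = slice f (x \<otimes>\<^bsub>G\<^esub> inv\<^bsub>G\<^esub> h, y \<otimes>\<^bsub>G\<^esub> inv\<^bsub>G\<^esub> h)"
  using bi_invariant_translate[OF f xyh H.one_closed H.m_inv_closed[OF xyh(3)]] xyh
  by (simp add: slice_def)

lemma slice_class_function:
  assumes f: "f \<in> bi_invariant_functions \<Gamma> (triple_diagonal H)"
  shows "slice f \<in> class_functions (G \<times>\<times> G) (pair_diagonal H)"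
  unfolding class_functions_def group_functions_def
proof (intro CollectI conjI ballI)
  show "slice f \<in> carrier (G \<times>\<times> G) \<rightarrow>\<^sub>E UNIV" by (simp add: slice_def)
next
  fix g k assume "g \<in> carrier (G \<times>\<times> G)" "k \<in> pair_diagonal H"
  then obtain x y h where g: "g = (x, y)" "x \<in> carrier G" "y \<in> carrier G" and k: "k = (h, h)" "h \<in> H" by auto
  show "slice f (k \<otimes>\<^bsub>G \<times>\<times> G\<^esub> g \<otimes>\<^bsub>G \<times>\<times> G\<^esub> inv\<^bsub>G \<times>\<times> G\<^esub> k) = slice f g"
    using bi_invariant_translate[OF f g(2,3) H.one_closed k(2) H.m_inv_closed[OF k(2)]] g k
    by (simp add: slice_def inv_pair)
qed

lemma unslice_bi_invariant:
  assumes F: "F \<in> class_functions (G \<times>\<times> G) (pair_diagonal H)"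
  shows "unslice F \<in> bi_invariant_functions \<Gamma> (triple_diagonal H)"
  unfolding bi_invariant_functions_def group_functions_def
proof (intro CollectI conjI ballI)
  show "unslice F \<in> carrier \<Gamma> \<rightarrow>\<^sub>E UNIV" by (simp add: unslice_def)
next
  fix g k1 k2 assume "g \<in> carrier \<Gamma>" "k1 \<in> triple_diagonal H" "k2 \<in> triple_diagonal H"
  then obtain x y h k l where g: "g = (x, y, h)" "x \<in> carrier G" "y \<in> carrier G" "h \<in> H"
    and k: "k1 = (k, k, k)" "k \<in> H" and l: "k2 = (l, l, l)" "l \<in> H"
    by (auto simp: triple_diagonal_def)
  have cancel: "k \<otimes>\<^bsub>G\<^esub> z \<otimes>\<^bsub>G\<^esub> l \<otimes>\<^bsub>G\<^esub> inv\<^bsub>G\<^esub> (k \<otimes>\<^bsub>G\<^esub> h \<otimes>\<^bsub>G\<^esub> l) =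
      k \<otimes>\<^bsub>G\<^esub> (z \<otimes>\<^bsub>G\<^esub> inv\<^bsub>G\<^esub> h) \<otimes>\<^bsub>G\<^esub> inv\<^bsub>G\<^esub> k" if z: "z \<in> carrier G" for z
  proof -
    have "l \<otimes>\<^bsub>G\<^esub> (inv\<^bsub>G\<^esub> l \<otimes>\<^bsub>G\<^esub> w) = w" if "w \<in> carrier G" for w
      using l that by (simp add: G.m_assoc[symmetric])
    then show ?thesis using z g k l by (simp add: G.m_assoc G.inv_mult_group)
  qed
  have "F ((k, k) \<otimes>\<^bsub>G \<times>\<times> G\<^esub> (x \<otimes>\<^bsub>G\<^esub> inv\<^bsub>G\<^esub> h, y \<otimes>\<^bsub>G\<^esub> inv\<^bsub>G\<^esub> h) \<otimes>\<^bsub>G \<times>\<times> G\<^esub> inv\<^bsub>G \<times>\<times> G\<^esub> (k, k)) =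
      F (x \<otimes>\<^bsub>G\<^esub> inv\<^bsub>G\<^esub> h, y \<otimes>\<^bsub>G\<^esub> inv\<^bsub>G\<^esub> h)"
    using F g k unfolding class_functions_def by auto
  then show "unslice F (k1 \<otimes>\<^bsub>\<Gamma>\<^esub> g \<otimes>\<^bsub>\<Gamma>\<^esub> k2) = unslice F g"
    using g k l cancel[OF g(2)] cancel[OF g(3)] by (simp add: unslice_def inv_pair)
qed

lemma slice_unslice:
  assumes F: "F \<in> class_functions (G \<times>\<times> G) (pair_diagonal H)"
  shows "slice (unslice F) = F"
proof
  fix p
  have "F \<in> extensional (carrier (G \<times>\<times> G))"
    using F by (auto simp: class_functions_def group_functions_def PiE_def)
  then have "F p = undefined" if "p \<notin> carrier (G \<times>\<times> G)" using that by (rule extensional_arb)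
  then show "slice (unslice F) p = F p"
    by (cases "p \<in> carrier (G \<times>\<times> G)") (auto simp: slice_def unslice_def)
qed

text \<open>Substituting \<open>(a, b) = (a' k, b' k)\<close> in the sum over \<open>(a, b, k)\<close> removes \<open>k\<close> from the summand:
  it disappears from \<open>f1\<close> by right invariance and from \<open>f2\<close> by the conjugation invariance of its
  slice. The sum over \<open>k\<close> then contributes the factor \<open>|H|\<close>.\<close>
lemma convolution_slice:
  assumes f1: "f1 \<in> bi_invariant_functions \<Gamma> (triple_diagonal H)"
    and f2: "f2 \<in> bi_invariant_functions \<Gamma> (triple_diagonal H)"
    and xyh: "x \<in> carrier G" "y \<in> carrier G" "h \<in> H"
  shows "convolution \<Gamma> f1 f2 (x, y, h) = of_nat (card H) *
    convolution (G \<times>\<times> G) (slice f1) (slice f2) (x \<otimes>\<^bsub>G\<^esub> inv\<^bsub>G\<^esub> h, y \<otimes>\<^bsub>G\<^esub> inv\<^bsub>G\<^esub> h)"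
proof -
  let ?Q = "G \<times>\<times> G"
  let ?q = "(x \<otimes>\<^bsub>G\<^esub> inv\<^bsub>G\<^esub> h, y \<otimes>\<^bsub>G\<^esub> inv\<^bsub>G\<^esub> h)"
  have hG: "h \<in> carrier G" using xyh by auto
  have summand: "f1 (a, b, k) * f2 (inv\<^bsub>\<Gamma>\<^esub> (a, b, k) \<otimes>\<^bsub>\<Gamma>\<^esub> (x, y, h)) =
      slice f1 (a \<otimes>\<^bsub>G\<^esub> inv\<^bsub>G\<^esub> k, b \<otimes>\<^bsub>G\<^esub> inv\<^bsub>G\<^esub> k) *
      slice f2 (inv\<^bsub>?Q\<^esub> (a \<otimes>\<^bsub>G\<^esub> inv\<^bsub>G\<^esub> k, b \<otimes>\<^bsub>G\<^esub> inv\<^bsub>G\<^esub> k) \<otimes>\<^bsub>?Q\<^esub> ?q)"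
    if ab: "a \<in> carrier G" "b \<in> carrier G" and k: "k \<in> H" for a b k
  proof -
    have kG: "k \<in> carrier G" using k by auto
    have cancel: "k \<otimes>\<^bsub>G\<^esub> (inv\<^bsub>G\<^esub> k \<otimes>\<^bsub>G\<^esub> w) = w" if "w \<in> carrier G" for w
      using kG that by (simp add: G.m_assoc[symmetric])
    have "f2 (inv\<^bsub>G\<^esub> a \<otimes>\<^bsub>G\<^esub> x, inv\<^bsub>G\<^esub> b \<otimes>\<^bsub>G\<^esub> y, inv\<^bsub>G\<^esub> k \<otimes>\<^bsub>G\<^esub> h) =
        f2 (k \<otimes>\<^bsub>G\<^esub> (inv\<^bsub>G\<^esub> a \<otimes>\<^bsub>G\<^esub> x) \<otimes>\<^bsub>G\<^esub> inv\<^bsub>G\<^esub> h,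
          k \<otimes>\<^bsub>G\<^esub> (inv\<^bsub>G\<^esub> b \<otimes>\<^bsub>G\<^esub> y) \<otimes>\<^bsub>G\<^esub> inv\<^bsub>G\<^esub> h,
          k \<otimes>\<^bsub>G\<^esub> (inv\<^bsub>G\<^esub> k \<otimes>\<^bsub>G\<^esub> h) \<otimes>\<^bsub>G\<^esub> inv\<^bsub>G\<^esub> h)"
      using ab k xyh by (intro bi_invariant_translate[OF f2, symmetric]) auto
    also have "\<dots> = slice f2 (inv\<^bsub>?Q\<^esub> (a \<otimes>\<^bsub>G\<^esub> inv\<^bsub>G\<^esub> k, b \<otimes>\<^bsub>G\<^esub> inv\<^bsub>G\<^esub> k) \<otimes>\<^bsub>?Q\<^esub> ?q)"
      using ab kG hG xyh cancel
      by (simp add: slice_def inv_pair G.inv_mult_group G.m_assoc)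
    finally show ?thesis
      using bi_invariant_eq_slice[OF f1 ab k] ab k xyh by (simp add: inv_triple)
  qed
  have "convolution \<Gamma> f1 f2 (x, y, h) =
      (\<Sum>(a, b, k)\<in>carrier G \<times> carrier G \<times> H. f1 (a, b, k) * f2 (inv\<^bsub>\<Gamma>\<^esub> (a, b, k) \<otimes>\<^bsub>\<Gamma>\<^esub> (x, y, h)))"
    using xyh by (simp add: convolution_def case_prod_unfold)
  also have "\<dots> = (\<Sum>(a, b, k)\<in>carrier G \<times> carrier G \<times> H.
      slice f1 (a \<otimes>\<^bsub>G\<^esub> inv\<^bsub>G\<^esub> k, b \<otimes>\<^bsub>G\<^esub> inv\<^bsub>G\<^esub> k) *
      slice f2 (inv\<^bsub>?Q\<^esub> (a \<otimes>\<^bsub>G\<^esub> inv\<^bsub>G\<^esub> k, b \<otimes>\<^bsub>G\<^esub> inv\<^bsub>G\<^esub> k) \<otimes>\<^bsub>?Q\<^esub> ?q))"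
    by (intro sum.cong refl, clarify, rule summand)
  also have "\<dots> = (\<Sum>(k, p)\<in>H \<times> carrier ?Q. slice f1 p * slice f2 (inv\<^bsub>?Q\<^esub> p \<otimes>\<^bsub>?Q\<^esub> ?q))"
    by (rule sum.reindex_bij_witness[of _
          "\<lambda>(k, a, b). (a \<otimes>\<^bsub>G\<^esub> k, b \<otimes>\<^bsub>G\<^esub> k, k)"
          "\<lambda>(a, b, k). (k, a \<otimes>\<^bsub>G\<^esub> inv\<^bsub>G\<^esub> k, b \<otimes>\<^bsub>G\<^esub> inv\<^bsub>G\<^esub> k)"])
      (auto simp: G.m_assoc)
  also have "\<dots> = of_nat (card H) * (\<Sum>p\<in>carrier ?Q. slice f1 p * slice f2 (inv\<^bsub>?Q\<^esub> p \<otimes>\<^bsub>?Q\<^esub> ?q))"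
    by (simp add: sum.cartesian_product[symmetric] del: carrier_DirProd)
  also have "(\<Sum>p\<in>carrier ?Q. slice f1 p * slice f2 (inv\<^bsub>?Q\<^esub> p \<otimes>\<^bsub>?Q\<^esub> ?q)) =
      convolution ?Q (slice f1) (slice f2) ?q"
    using xyh hG by (simp add: convolution_def)
  finally show ?thesis .
qed

theorem gelfand_pair_iff_class_functions_commute:
  "gelfand_pair \<Gamma> (triple_diagonal H) \<longleftrightarrow>
    (\<forall>F1\<in>class_functions (G \<times>\<times> G) (pair_diagonal H). \<forall>F2\<in>class_functions (G \<times>\<times> G) (pair_diagonal H).
       convolution (G \<times>\<times> G) F1 F2 = convolution (G \<times>\<times> G) F2 F1)"
proof
  assume gp: "gelfand_pair \<Gamma> (triple_diagonal H)"
  have card: "card H \<noteq> 0" using fin H.subset H.one_closed finite_subset by (metis card_eq_0_iff empty_iff)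
  show "\<forall>F1\<in>class_functions (G \<times>\<times> G) (pair_diagonal H). \<forall>F2\<in>class_functions (G \<times>\<times> G) (pair_diagonal H).
       convolution (G \<times>\<times> G) F1 F2 = convolution (G \<times>\<times> G) F2 F1"
  proof (intro ballI ext)
    fix F1 F2 p
    assume F: "F1 \<in> class_functions (G \<times>\<times> G) (pair_diagonal H)" "F2 \<in> class_functions (G \<times>\<times> G) (pair_diagonal H)"
    note u = unslice_bi_invariant[OF F(1)] unslice_bi_invariant[OF F(2)]
    have eq: "convolution \<Gamma> (unslice F1) (unslice F2) = convolution \<Gamma> (unslice F2) (unslice F1)"
      using gp u unfolding gelfand_pair_def by blast
    show "convolution (G \<times>\<times> G) F1 F2 p = convolution (G \<times>\<times> G) F2 F1 p"
    proof (cases "p \<in> carrier (G \<times>\<times> G)")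
      case True
      then obtain x y where p: "p = (x, y)" "x \<in> carrier G" "y \<in> carrier G" by auto
      have "of_nat (card H) * convolution (G \<times>\<times> G) F1 F2 p = convolution \<Gamma> (unslice F1) (unslice F2) (x, y, \<one>\<^bsub>G\<^esub>)"
        using convolution_slice[OF u p(2,3) H.one_closed] p F by (simp add: slice_unslice)
      also have "\<dots> = of_nat (card H) * convolution (G \<times>\<times> G) F2 F1 p"
        unfolding eq using convolution_slice[OF u(2,1) p(2,3) H.one_closed] p F by (simp add: slice_unslice)
      finally show ?thesis using card by simp
    qed (simp add: convolution_def)
  qed
next
  assume comm: "\<forall>F1\<in>class_functions (G \<times>\<times> G) (pair_diagonal H). \<forall>F2\<in>class_functions (G \<times>\<times> G) (pair_diagonal H).
       convolution (G \<times>\<times> G) F1 F2 = convolution (G \<times>\<times> G) F2 F1"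
  show "gelfand_pair \<Gamma> (triple_diagonal H)"
    unfolding gelfand_pair_def
  proof (intro ballI ext)
    fix f1 f2 p
    assume f: "f1 \<in> bi_invariant_functions \<Gamma> (triple_diagonal H)" "f2 \<in> bi_invariant_functions \<Gamma> (triple_diagonal H)"
    have eq: "convolution (G \<times>\<times> G) (slice f1) (slice f2) = convolution (G \<times>\<times> G) (slice f2) (slice f1)"
      using comm slice_class_function f by blast
    show "convolution \<Gamma> f1 f2 p = convolution \<Gamma> f2 f1 p"
    proof (cases "p \<in> carrier \<Gamma>")
      case True
      then obtain x y h where p: "p = (x, y, h)" "x \<in> carrier G" "y \<in> carrier G" "h \<in> H" by auto
      show ?thesis unfolding p(1) convolution_slice[OF f p(2-4)] convolution_slice[OF f(2,1) p(2-4)] eq ..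
    qed (simp add: convolution_def)
  qed
qed

lemma rep_dim_res_tensor_rep:
  "rep_dim (G\<lparr>carrier := H\<rparr>) (res_rep H (tensor_rep \<rho>1 \<rho>2)) = rep_dim G \<rho>1 * rep_dim G \<rho>2"
  by (simp add: rep_dim_def res_rep_def tensor_rep_def kronecker_mat_def)

lemma res_tensor_rep_eq_outer:
  "h \<in> H \<Longrightarrow> res_rep H (tensor_rep \<rho>1 \<rho>2) h = outer_tensor_rep \<rho>1 \<rho>2 (h, h)"
  by (simp add: res_rep_def tensor_rep_def outer_tensor_rep_def)

lemma unitary_res_tensor_rep:
  assumes u: "unitary_rep G \<rho>1" "unitary_rep G \<rho>2"
  shows "unitary_rep (G\<lparr>carrier := H\<rparr>) (res_rep H (tensor_rep \<rho>1 \<rho>2))"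
proof -
  note U = unitary_outer_tensor_rep[OF u]
  have c: "(h, h) \<in> carrier (G \<times>\<times> G)" if "h \<in> H" for h using that by auto
  show ?thesis
    unfolding unitary_rep_def rep_dim_res_tensor_rep
    using unitary_repD[OF U c] unitary_repD(4)[OF U c c]
    by (simp add: res_tensor_rep_eq_outer)
qed

lemma commutant_res_tensor_rep:
  "commutant (G\<lparr>carrier := H\<rparr>) (res_rep H (tensor_rep \<rho>1 \<rho>2)) =
   commutant ((G \<times>\<times> G)\<lparr>carrier := pair_diagonal H\<rparr>) (outer_tensor_rep \<rho>1 \<rho>2)"
  unfolding intertwiners_def rep_dim_res_tensor_rep
  by (auto simp: res_tensor_rep_eq_outer)

end

theorem theorem1p1:
  fixes G :: "('g, 'b) monoid_scheme"
    and H :: "'g set"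
    and Ghat :: "('g \<Rightarrow> complex mat) set"
  assumes "group G"
    and "finite (carrier G)"
    and "subgroup H G"
    and "complete_irreps G Ghat"
  shows "gelfand_pair (G \<times>\<times> G \<times>\<times> G\<lparr>carrier := H\<rparr>) (triple_diagonal H) \<longleftrightarrow>
    (\<forall>\<rho>1\<in>Ghat. \<forall>\<rho>2\<in>Ghat.
       multiplicity_free (G\<lparr>carrier := H\<rparr>) (res_rep H (tensor_rep \<rho>1 \<rho>2)))"
proof -
  interpret G: group G by fact
  interpret Q: group "G \<times>\<times> G" using DirProd_group assms(1) by blast
  interpret H: group "G\<lparr>carrier := H\<rparr>" using G.subgroup_imp_group assms(3) by blast
  have irr: "irreducible_rep G \<rho>" if "\<rho> \<in> Ghat" for \<rho>
    using assms(4) that by (simp add: complete_irreps_def)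
  then have u: "unitary_rep G \<rho>" if "\<rho> \<in> Ghat" for \<rho>
    using that by (auto simp: irreducible_rep_def)
  let ?R = "{outer_tensor_rep \<rho>1 \<rho>2 | \<rho>1 \<rho>2. \<rho>1 \<in> Ghat \<and> \<rho>2 \<in> Ghat}"
  have "gelfand_pair (G \<times>\<times> G \<times>\<times> G\<lparr>carrier := H\<rparr>) (triple_diagonal H) \<longleftrightarrow>
      (\<forall>\<rho>\<in>?R. commuting (commutant ((G \<times>\<times> G)\<lparr>carrier := pair_diagonal H\<rparr>) \<rho>))"
    unfolding gelfand_pair_iff_class_functions_commute[OF assms(1-3)]
  proof (rule Q.class_functions_commute_iff)
    show "finite (carrier (G \<times>\<times> G))" using assms(2) by simp
    show "pair_diagonal H \<subseteq> carrier (G \<times>\<times> G)" by (rule pair_diagonal_subset[OF assms(1-3)])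
    show "separating (G \<times>\<times> G) ?R"
      by (rule separating_outer_tensor_rep[OF u G.complete_irreps_separating[OF assms(2,4)]])
    fix \<rho> assume "\<rho> \<in> ?R"
    then obtain \<rho>1 \<rho>2 where \<rho>: "\<rho> = outer_tensor_rep \<rho>1 \<rho>2" "\<rho>1 \<in> Ghat" "\<rho>2 \<in> Ghat" by blast
    show "unitary_rep (G \<times>\<times> G) \<rho>" using \<rho> u unitary_outer_tensor_rep by blast
    show "schur_orthogonal (G \<times>\<times> G) \<rho>"
      unfolding \<rho>(1) by (rule schur_orthogonal_outer_tensor_rep[OF u[OF \<rho>(2)] u[OF \<rho>(3)]
          G.irreducible_schur_orthogonal[OF irr[OF \<rho>(2)]] G.irreducible_schur_orthogonal[OF irr[OF \<rho>(3)]]])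
  qed
  also have "\<dots> \<longleftrightarrow> (\<forall>\<rho>1\<in>Ghat. \<forall>\<rho>2\<in>Ghat.
      commuting (commutant ((G \<times>\<times> G)\<lparr>carrier := pair_diagonal H\<rparr>) (outer_tensor_rep \<rho>1 \<rho>2)))"
    by blast
  also have "\<dots> \<longleftrightarrow> (\<forall>\<rho>1\<in>Ghat. \<forall>\<rho>2\<in>Ghat.
       multiplicity_free (G\<lparr>carrier := H\<rparr>) (res_rep H (tensor_rep \<rho>1 \<rho>2)))"
    using H.multiplicity_free_iff_commuting_commutant[OF unitary_res_tensor_rep[OF assms(1-3) u u]]
    by (simp add: commutant_res_tensor_rep[OF assms(1-3)])
  finally show ?thesis .
qed

end
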